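(* Let $\mathcal{U}=\{U_0,\ldots,U_n\}$ be a finite collection of finite simplicial filtrations $U_i=(U_i^\alpha)_{\alpha\ge 0}$, where all the $U_i^\alpha$ are subcomplexes of one sufficiently large simplicial complex. Let $\mathcal{W}=(W^\alpha)_{\alpha\ge 0}$ with $W^\alpha=\bigcup_{i=0}^n U_i^\alpha$. If $\mathcal{U}$ is a good cover filtration of $\mathcal{W}$, then $$\mathrm{Dgm}(\mathcal{W})=\mathrm{Dgm}(\mathrm{Nrv}\,\mathcal{U}),$$ that is, $\mathrm{Dgm}_K(\mathcal{W})=\mathrm{Dgm}_K(\mathrm{Nrv}\,\mathcal{U})$ for all integers $K\ge 0$.
   Context: All homology is taken with coefficients in $\mathbb{Z}/2\mathbb{Z}$. A finite simplicial filtration is a family $(F^\alpha)_{\alpha\ge 0}$ of finite simplicial complexes, indexed by real $\alpha\ge 0$, with $F^\alpha\subseteq F^\beta$ whenever $\alpha\le\beta$. Write $[n]=\{0,\ldots,n\}$ and $\mathcal{U}^\alpha=\{U_0^\alpha,\ldots,U_n^\alpha\}$. The nerve is the abstract simplicial complex $\mathrm{Nrv}\,\mathcal{U}^\alpha=\{\emptyset\ne\sigma\subseteq[n] : \bigcap_{i\in\sigma}U_i^\alpha\neq\emptyset\}$, and the nerve filtration is $\mathrm{Nrv}\,\mathcal{U}=(\mathrm{Nrv}\,\mathcal{U}^\alpha)_{\alpha\ge 0}$. $\mathcal{U}$ is a good cover filtration of $\mathcal{W}$ if for every $\alpha\ge 0$ and every non-empty $\sigma\subseteq[n]$ the complex $\bigcap_{i\in\sigma}U_i^\alpha$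 is empty or contractible. For a filtration $\mathcal{F}$ with pointwise finite-dimensional homology, $\mathrm{Dgm}_K(\mathcal{F})$ is the persistence diagram of the persistence module $(H_K(F^\alpha))_{\alpha\ge 0}$ with maps induced by inclusions: the multiset of (birth, death) points together with all diagonal points with infinite multiplicity; $\mathrm{Dgm}(\mathcal{F})=(\mathrm{Dgm}_K(\mathcal{F}))_{K\ge 0}$. Persistence diagrams are assumed finite, i.e. to have finitely many off-diagonal points. *)

theory Defs
  imports
    "HOL-Analysis.Analysis"
    "HOL-Algebra.Product_Groups"
    "HOL-Library.Z2"
    "HOL-Library.Extended_Nat"
begin

section \<open>Simplicial complexes\<close>

text \<open>Abstract simplicial complexes; the empty simplex is excluded and the empty complex is
  allowed.  Vertices are the \<open>v\<close> with \<open>{v} \<in> X\<close>.\<close>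

definition abstract_complex :: "'a set set \<Rightarrow> bool" where
  "abstract_complex X \<longleftrightarrow>
     (\<forall>\<sigma>\<in>X. finite \<sigma> \<and> \<sigma> \<noteq> {} \<and> (\<forall>\<tau>. \<tau> \<subseteq> \<sigma> \<and> \<tau> \<noteq> {} \<longrightarrow> \<tau> \<in> X))"

definition subcomplex :: "'a set set \<Rightarrow> 'a set set \<Rightarrow> bool" where
  "subcomplex X L \<longleftrightarrow> abstract_complex X \<and> X \<subseteq> L"

text \<open>The geometric realization in barycentric coordinates.  The topology is the one of pointwise
  convergence of the coordinates; on finite complexes, the only ones it is used for here, it is
  the usual (weak) topology.\<close>

definition realization :: "'a set set \<Rightarrow> ('a \<Rightarrow> real) topology" where
  "realization X = subtopology (powertop_real UNIV)
     {x. (\<forall>v. 0 \<le> x v) \<and> {v. x v \<noteq> 0} \<in> X \<and> (\<Sum>v | x v \<noteq> 0. x v) = 1}"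

definition contractible_complex :: "'a set set \<Rightarrow> bool" where
  "contractible_complex X \<longleftrightarrow> X \<noteq> {} \<and> contractible_space (realization X)"

text \<open>Only the values at parameters \<open>\<alpha> \<ge> 0\<close> are meaningful.\<close>

definition finite_filtration :: "(real \<Rightarrow> 'a set set) \<Rightarrow> bool" where
  "finite_filtration F \<longleftrightarrow>
     (\<forall>\<alpha>\<ge>0. finite (F \<alpha>) \<and> abstract_complex (F \<alpha>)) \<and>
     (\<forall>\<alpha> \<beta>. 0 \<le> \<alpha> \<and> \<alpha> \<le> \<beta> \<longrightarrow> F \<alpha> \<subseteq> F \<beta>)"


section \<open>Nerves and good covers\<close>

definition nerve :: "nat \<Rightarrow> (nat \<Rightarrow> 'a set set) \<Rightarrow> nat set set" where
  "nerve n V = {\<sigma>. \<sigma> \<noteq> {} \<and> \<sigma> \<subseteq> {0..n} \<and> (\<Inter>i\<in>\<sigma>. V i) \<noteq> {}}"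

definition nerve_filtration :: "nat \<Rightarrow> (nat \<Rightarrow> real \<Rightarrow> 'a set set) \<Rightarrow> real \<Rightarrow> nat set set" where
  "nerve_filtration n U = (\<lambda>\<alpha>. nerve n (\<lambda>i. U i \<alpha>))"

text \<open>The covered filtration is the levelwise union of \<open>U 0, \<dots>, U n\<close> and therefore not a parameter.\<close>

definition good_cover_filtration :: "nat \<Rightarrow> (nat \<Rightarrow> real \<Rightarrow> 'a set set) \<Rightarrow> bool" where
  "good_cover_filtration n U \<longleftrightarrow>
     (\<forall>\<alpha>\<ge>0. \<forall>\<sigma>. \<sigma> \<noteq> {} \<and> \<sigma> \<subseteq> {0..n} \<longrightarrow>
        (\<Inter>i\<in>\<sigma>. U i \<alpha>) = {} \<or> contractible_complex (\<Inter>i\<in>\<sigma>. U i \<alpha>))"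


section \<open>Simplicial homology with coefficients in the field of two elements\<close>

text \<open>Vector spaces over the two-element field are represented by their additive groups: the scalar
  multiplication is determined by the addition, and the linear maps (isomorphisms) are exactly
  the group homomorphisms (isomorphisms).  Multiplicative group notation stands for addition.\<close>

definition chains :: "'a set set \<Rightarrow> nat \<Rightarrow> ('a set \<Rightarrow> bit) set" where
  "chains X k = {c. finite {\<sigma>. c \<sigma> \<noteq> 0} \<and> {\<sigma>. c \<sigma> \<noteq> 0} \<subseteq> {\<sigma>\<in>X. card \<sigma> = Suc k}}"

text \<open>The coefficient of \<open>\<tau>\<close> is the sum of the coefficients of the simplices having \<open>\<tau>\<close> as a
  facet.  Homology is unreduced: the empty face is discarded, so 0-chains have boundary 0.\<close>

definition boundary :: "('a set \<Rightarrow> bit) \<Rightarrow> 'a set \<Rightarrow> bit" where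
  "boundary c = (\<lambda>\<tau>. if \<tau> = {} then 0
     else (\<Sum>\<sigma> | c \<sigma> \<noteq> 0 \<and> \<tau> \<subseteq> \<sigma> \<and> card \<sigma> = Suc (card \<tau>). c \<sigma>))"

definition cycle_group :: "'a set set \<Rightarrow> nat \<Rightarrow> ('a set \<Rightarrow> bit) monoid" where
  "cycle_group X k =
     \<lparr>carrier = {c \<in> chains X k. boundary c = (\<lambda>_. 0)},
      monoid.mult = (\<lambda>c d \<sigma>. c \<sigma> + d \<sigma>),
      one = (\<lambda>_. 0)\<rparr>"

definition boundaries :: "'a set set \<Rightarrow> nat \<Rightarrow> ('a set \<Rightarrow> bit) set" where
  "boundaries X k = boundary ` chains X (Suc k)"

definition homology :: "'a set set \<Rightarrow> nat \<Rightarrow> ('a set \<Rightarrow> bit) set monoid" where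
  "homology X k = cycle_group X k Mod boundaries X k"

text \<open>For \<open>X \<subseteq> Y\<close> the inclusion sends the class \<open>z + boundaries X k\<close> to \<open>z + boundaries Y k\<close>,
  which is the sum of the former coset with \<open>boundaries Y k\<close>.\<close>

definition homology_incl :: "'a set set \<Rightarrow> nat \<Rightarrow> ('a set \<Rightarrow> bit) set \<Rightarrow> ('a set \<Rightarrow> bit) set" where
  "homology_incl Y k C = C <#>\<^bsub>cycle_group Y k\<^esub> boundaries Y k"


section \<open>Persistence modules over the field of two elements\<close>

text \<open>A persistence module indexed by the reals \<open>\<ge> 0\<close>: spaces \<open>spc M \<alpha>\<close> and structure maps
  \<open>trn M \<alpha> \<beta>\<close> for \<open>0 \<le> \<alpha> \<le> \<beta>\<close>.\<close>

record 'v pers_module =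
  spc :: "real \<Rightarrow> 'v monoid"
  trn :: "real \<Rightarrow> real \<Rightarrow> 'v \<Rightarrow> 'v"

definition homology_module ::
    "(real \<Rightarrow> 'a set set) \<Rightarrow> nat \<Rightarrow> ('a set \<Rightarrow> bit) set pers_module" where
  "homology_module F k =
     \<lparr>spc = (\<lambda>\<alpha>. homology (F \<alpha>) k), trn = (\<lambda>\<alpha> \<beta>. homology_incl (F \<beta>) k)\<rparr>"

definition pers_iso :: "'v pers_module \<Rightarrow> 'w pers_module \<Rightarrow> bool" where
  "pers_iso M N \<longleftrightarrow> (\<exists>h.
     (\<forall>\<alpha>\<ge>0. h \<alpha> \<in> iso (spc M \<alpha>) (spc N \<alpha>)) \<and>
     (\<forall>\<alpha> \<beta>. 0 \<le> \<alpha> \<and> \<alpha> \<le> \<beta> \<longrightarrow>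
        (\<forall>x\<in>carrier (spc M \<alpha>). h \<beta> (trn M \<alpha> \<beta> x) = trn N \<alpha> \<beta> (h \<alpha> x))))"

definition bit_group :: "bit monoid" where
  "bit_group = \<lparr>carrier = UNIV, monoid.mult = (+), one = 0\<rparr>"

definition interval_module :: "real set \<Rightarrow> bit pers_module" where
  "interval_module I =
     \<lparr>spc = (\<lambda>\<alpha>. if \<alpha> \<in> I then bit_group else singleton_group 0),
      trn = (\<lambda>\<alpha> \<beta> x. if \<alpha> \<in> I \<and> \<beta> \<in> I then x else 0)\<rparr>"

definition direct_sum :: "'j set \<Rightarrow> ('j \<Rightarrow> 'v pers_module) \<Rightarrow> ('j \<Rightarrow> 'v) pers_module" where
  "direct_sum J M =
     \<lparr>spc = (\<lambda>\<alpha>. sum_group J (\<lambda>j. spc (M j) \<alpha>)),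
      trn = (\<lambda>\<alpha> \<beta> x. \<lambda>j\<in>J. trn (M j) \<alpha> \<beta> (x j))\<rparr>"


section \<open>Persistence diagrams\<close>

text \<open>The barcode: \<open>m I\<close> is the number of summands with support the interval \<open>I\<close> in a decomposition
  into interval modules.  A pointwise finite-dimensional module has exactly one barcode
  (Crawley-Boevey; Krull-Schmidt-Azumaya), and each interval has finite multiplicity in it.\<close>

definition is_barcode :: "'v pers_module \<Rightarrow> (real set \<Rightarrow> nat) \<Rightarrow> bool" where
  "is_barcode M m \<longleftrightarrow>
     (\<forall>I. m I \<noteq> 0 \<longrightarrow> I \<noteq> {} \<and> I \<subseteq> {0..} \<and> is_interval I) \<and>
     pers_iso M (direct_sum {(I, k). k < m I} (\<lambda>(I, k). interval_module I))"

definition barcode :: "'v pers_module \<Rightarrow> real set \<Rightarrow> nat" where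
  "barcode M = (THE m. is_barcode M m)"

text \<open>A persistence diagram is given by the multiplicities of its points (birth, death); the death
  may be \<open>\<infinity>\<close>.  Open and closed endpoints are not distinguished, so up to four intervals contribute
  to an off-diagonal point, and one-point intervals are absorbed by the diagonal.\<close>

type_synonym pers_diagram = "real \<times> ereal \<Rightarrow> enat"

definition diagonal :: "(real \<times> ereal) set" where
  "diagonal = {(b, d). d = ereal b}"

definition diagram_of :: "(real set \<Rightarrow> nat) \<Rightarrow> pers_diagram" where
  "diagram_of m = (\<lambda>(b, d). if (b, d) \<in> diagonal then \<infinity>
     else enat (card {(I, k). k < m I \<and> Inf I = b \<and> (SUP x\<in>I. ereal x) = d}))"

definition Dgm :: "(real \<Rightarrow> 'a set set) \<Rightarrow> nat \<Rightarrow> pers_diagram" where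
  "Dgm F k = diagram_of (barcode (homology_module F k))"

definition finite_diagram :: "pers_diagram \<Rightarrow> bool" where
  "finite_diagram D \<longleftrightarrow>
     finite {p. p \<notin> diagonal \<and> D p \<noteq> 0} \<and> (\<forall>p. p \<notin> diagonal \<longrightarrow> D p \<noteq> \<infinity>)"

end

theory Submission
  imports Defs "HOL-Library.Function_Algebras"
begin

text \<open>Let \<open>Z\<close> be the complex of all \<open>\<rho> \<squnion> \<tau>\<close> such that \<open>\<rho> \<subseteq> \<sigma>\<close> for some simplex \<open>\<sigma>\<close> of \<open>W\<close> that lies in
  every \<open>U i\<close> with \<open>i \<in> \<tau>\<close>. It contains both \<open>W\<close> and the nerve, and this is compatible with the
  filtrations, so naturality is automatic. The links in \<open>Z\<close> of the simplices of the nerve are the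
  intersections of the cover and the links of the simplices of \<open>W\<close> are full simplices; since all of them
  are acyclic, both inclusions induce isomorphisms in homology. Hence the two persistence modules
  are isomorphic and have the same barcodes.

  That a finite complex \<open>X\<close> with contractible realization is acyclic is proved without subdivisions. A cycle of
  \<open>X\<close> is replaced by a cycle of finely spaced points of the realization (the Vietoris-Rips complexes of
  closed stars are acyclic, as stars contract linearly), which is moved along the null-homotopy in small time
  steps to a single point. All of this takes place in a mapping cylinder of the map that sends a point
  to a vertex at which it has a large barycentric coordinate; the homology of this cylinder is that of \<open>X\<close>.\<close>

section \<open>Chains with coefficients in the field of two elements\<close>

text \<open>A direct simplicial map between \<open>W\<close> and the nerve would depend on choices
  that need not fit together as the parameter grows; two inclusions into a complex that grows with
  the cover need no choices.

  Chains have mixed dimensions and may contain the empty simplex, so that one statement about links,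
  \<open>rel_acyclic_join\<close>, covers all degrees at once. It is used four times. Each time the
  vertices are of two kinds, separated by a sum type, and only the links of simplices on one kind of
  vertices have to be examined.

  Contractibility concerns the topology of the realization, homology concerns finite chains. The
  bridge is the constant \<open>1 / card V\<close>: every point has a barycentric coordinate at
  least this large, and if two points are closer than this in the l1 distance, then the vertex
  chosen for one lies in the support of the other. Hence the vertices chosen for a set of close
  points span a simplex, however discontinuous the choice is.\<close>

definition supp :: "('a set \<Rightarrow> bit) \<Rightarrow> 'a set set" where
  "supp c = {\<sigma>. c \<sigma> \<noteq> 0}"

text \<open>Chains of all dimensions together. Finiteness of the simplices is demanded separately
  because \<open>K\<close> may contain infinite sets: in \<open>mapping_cylinder\<close> infinitely
  many points can share one vertex.\<close>

definition fchains :: "'a set set \<Rightarrow> ('a set \<Rightarrow> bit) set" where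
  "fchains K = {c. finite (supp c) \<and> (\<forall>\<sigma>\<in>supp c. finite \<sigma> \<and> \<sigma> \<in> K)}"

text \<open>In contrast to \<open>boundary\<close>, the empty face is kept: this is the augmented boundary, and
  \<open>acyclic_chains\<close>, used for families that contain the empty simplex, refers to reduced homology.\<close>

definition bd :: "('a set \<Rightarrow> bit) \<Rightarrow> 'a set \<Rightarrow> bit" where
  "bd c = (\<lambda>\<tau>. \<Sum>x\<in>\<Union>(supp c) - \<tau>. c (insert x \<tau>))"

text \<open>Simplices of \<open>c\<close> that already contain \<open>w\<close> are dropped, since
  \<open>\<tau> - {w}\<close> never contains \<open>w\<close>. This is the join with
  \<open>w\<close> in which a repeated vertex counts as zero.\<close>

definition cone :: "'a \<Rightarrow> ('a set \<Rightarrow> bit) \<Rightarrow> 'a set \<Rightarrow> bit" where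
  "cone w c = (\<lambda>\<tau>. if w \<in> \<tau> then c (\<tau> - {w}) else 0)"

definition acyclic_chains :: "'a set set \<Rightarrow> bool" where
  "acyclic_chains K \<longleftrightarrow> (\<forall>c\<in>fchains K. bd c = 0 \<longrightarrow> (\<exists>d\<in>fchains K. bd d = c))"

definition down_closed :: "'a set set \<Rightarrow> bool" where
  "down_closed K \<longleftrightarrow> (\<forall>\<sigma>\<in>K. \<forall>\<tau>. \<tau> \<subseteq> \<sigma> \<longrightarrow> \<tau> \<in> K)"

text \<open>Keeps coefficients in additive form, so that sums and group laws apply to them, and
  keeps \<open>c \<sigma> \<noteq> 0\<close> as the test for membership in the support.\<close>

declare add_bit_eq_xor [simp del] bit_not_zero_iff [simp del]

lemma bit_add_self [simp]: "a + a = (0 :: bit)"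
  by (cases a rule: bit.exhaust) simp_all

lemma bit_add_left_self [simp]: "a + (a + b) = (b :: bit)"
  using add.assoc[of a a b] by simp

lemma supp_iff [simp]: "\<sigma> \<in> supp c \<longleftrightarrow> c \<sigma> \<noteq> 0"
  by (simp add: supp_def)

lemma chain_add_self [simp]: "c + c = (0 :: 'a \<Rightarrow> bit)"
  by (simp add: fun_eq_iff plus_fun_def)

lemma chain_add_left_self [simp]: "c + (c + d) = (d :: 'a \<Rightarrow> bit)"
  by (simp add: fun_eq_iff)

lemma supp_add: "supp (c + d) \<subseteq> supp c \<union> supp d"
  by auto

lemma fchains_0 [simp]: "0 \<in> fchains K"
  by (simp add: fchains_def supp_def)

lemma fchains_add [intro]: "c \<in> fchains K \<Longrightarrow> d \<in> fchains K \<Longrightarrow> c + d \<in> fchains K"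
  unfolding fchains_def using supp_add[of c d]
  by (auto intro: finite_subset)

lemma fchains_monoD: "c \<in> fchains K \<Longrightarrow> K \<subseteq> L \<Longrightarrow> c \<in> fchains L"
  by (auto simp: fchains_def)

lemma fchains_subset_supp: "c \<in> fchains K \<Longrightarrow> supp c \<subseteq> L \<Longrightarrow> c \<in> fchains L"
  by (auto simp: fchains_def)

lemma fchains_imp_in: "c \<in> fchains K \<Longrightarrow> c \<sigma> \<noteq> 0 \<Longrightarrow> \<sigma> \<in> K"
  by (auto simp: fchains_def)

lemma fchains_imp_finite: "c \<in> fchains K \<Longrightarrow> c \<sigma> \<noteq> 0 \<Longrightarrow> finite \<sigma>"
  by (auto simp: fchains_def)

lemma finite_vertices: "c \<in> fchains K \<Longrightarrow> finite (\<Union>(supp c))"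
  by (auto simp: fchains_def)

lemma bd_eq:
  assumes "finite V" "\<Union>(supp c) \<subseteq> V"
  shows "bd c \<tau> = (\<Sum>x\<in>V - \<tau>. c (insert x \<tau>))"
  unfolding bd_def using assms
  by (intro sum.mono_neutral_left) auto

lemma bd_0 [simp]: "bd 0 = 0"
  by (simp add: bd_def fun_eq_iff)

lemma bd_add:
  assumes "c \<in> fchains K" "d \<in> fchains L"
  shows "bd (c + d) = bd c + bd d"
proof
  fix \<tau>
  let ?V = "\<Union>(supp c) \<union> \<Union>(supp d)"
  have fin: "finite ?V" using assms finite_vertices by blast
  have "\<Union>(supp (c + d)) \<subseteq> ?V" using supp_add[of c d] by blast
  then show "bd (c + d) \<tau> = (bd c + bd d) \<tau>"
    using fin by (simp add: bd_eq[of ?V] sum.distrib)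
qed

lemma bd_nonzeroE:
  assumes "bd c \<tau> \<noteq> 0"
  obtains x where "x \<notin> \<tau>" "c (insert x \<tau>) \<noteq> 0"
  using assms sum.not_neutral_contains_not_neutral[of "\<lambda>x. c (insert x \<tau>)" "\<Union>(supp c) - \<tau>"]
  unfolding bd_def by auto

lemma bd_in_fchains:
  assumes "c \<in> fchains K" "down_closed K"
  shows "bd c \<in> fchains K"
proof -
  have sub: "supp (bd c) \<subseteq> (\<Union>\<sigma>\<in>supp c. Pow \<sigma>)"
    by clarsimp (metis bd_nonzeroE subset_insertI supp_iff)
  have fin: "finite (\<Union>\<sigma>\<in>supp c. Pow \<sigma>)"
    using assms by (auto simp: fchains_def)
  have "finite \<sigma> \<and> \<sigma> \<in> K" if \<sigma>: "\<sigma> \<in> supp (bd c)" for \<sigma>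
  proof -
    obtain \<rho> where "\<rho> \<in> supp c" "\<sigma> \<subseteq> \<rho>" using \<sigma> sub by blast
    then show ?thesis using assms unfolding fchains_def down_closed_def
      using finite_subset by blast
  qed
  then show ?thesis
    unfolding fchains_def using finite_subset[OF sub fin] by blast
qed

text \<open>The terms at (x, y) and (y, x) cancel in characteristic two. In \<open>bd_bd\<close>
  these are the two ways to reach a face of codimension two.\<close>

lemma sum_symmetric_bit:
  fixes g :: "'a \<Rightarrow> 'a \<Rightarrow> bit"
  assumes "finite W" "\<And>x y. g x y = g y x" "\<And>x. g x x = 0"
  shows "(\<Sum>x\<in>W. \<Sum>y\<in>W. g x y) = 0"
  using assms(1)
proof (induction W rule: finite_induct)
  case (insert a W)
  have "(\<Sum>x\<in>W. g x a) = (\<Sum>y\<in>W. g a y)"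
    by (intro sum.cong refl assms(2))
  then show ?case using insert by (simp add: sum.distrib assms(3))
qed simp

lemma bd_bd:
  assumes "c \<in> fchains K"
  shows "bd (bd c) = 0"
proof
  fix \<tau>
  let ?V = "\<Union>(supp c)"
  have fin: "finite ?V" using assms by (rule finite_vertices)
  have sub: "\<Union>(supp (bd c)) \<subseteq> ?V"
  proof
    fix x assume "x \<in> \<Union>(supp (bd c))"
    then obtain \<tau> where "x \<in> \<tau>" "bd c \<tau> \<noteq> 0" by auto
    then show "x \<in> ?V" by (elim bd_nonzeroE) (use supp_iff in blast)
  qed
  let ?W = "?V - \<tau>"
  \<comment> \<open>The value 0 on the diagonal lets the inner sum, which leaves out
    \<open>x\<close>, run over the same range as the outer one.\<close>
  define g where "g = (\<lambda>x y. if x = y then 0 else c (insert y (insert x \<tau>)))"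
  have "(\<Sum>y\<in>?V - insert x \<tau>. c (insert y (insert x \<tau>))) = (\<Sum>y\<in>?W. g x y)"
    if "x \<in> ?W" for x
    by (rule sum.mono_neutral_cong_left) (use fin in \<open>auto simp: g_def\<close>)
  then have "bd (bd c) \<tau> = (\<Sum>x\<in>?W. \<Sum>y\<in>?W. g x y)"
    unfolding bd_eq[OF fin sub] bd_eq[OF fin order_refl] by (rule sum.cong[OF refl])
  also have "\<dots> = 0"
    by (rule sum_symmetric_bit) (use fin in \<open>auto simp: g_def insert_commute\<close>)
  finally show "bd (bd c) \<tau> = 0 \<tau>" by simp
qed

lemma cone_in_fchains:
  assumes "c \<in> fchains K" "\<And>\<sigma>. \<sigma> \<in> supp c \<Longrightarrow> insert w \<sigma> \<in> L"
  shows "cone w c \<in> fchains L"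
proof -
  have *: "supp (cone w c) \<subseteq> insert w ` supp c"
  proof
    fix \<tau> assume "\<tau> \<in> supp (cone w c)"
    then have "w \<in> \<tau>" "c (\<tau> - {w}) \<noteq> 0" by (auto simp: cone_def split: if_splits)
    then show "\<tau> \<in> insert w ` supp c" by (intro image_eqI[of _ _ "\<tau> - {w}"]) auto
  qed
  then show ?thesis using assms unfolding fchains_def
    by (auto intro: finite_subset simp del: supp_iff)
qed

lemma cone_0 [simp]: "cone w 0 = 0"
  by (rule ext) (simp add: cone_def)

lemma cone_in [simp]: "w \<in> \<tau> \<Longrightarrow> cone w c \<tau> = c (\<tau> - {w})"
  and cone_notin [simp]: "w \<notin> \<tau> \<Longrightarrow> cone w c \<tau> = 0"
  by (simp_all add: cone_def)

text \<open>No assumption that \<open>w\<close> is a new vertex is made. Write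
  \<open>c = w * a + b\<close> with \<open>w\<close> in neither \<open>a\<close> nor
  \<open>b\<close>: the cone is \<open>w * b\<close>, with boundary \<open>b + w * bd b\<close>, and
  on the right the two copies of \<open>w * a\<close> cancel.\<close>

lemma bd_cone:
  assumes "c \<in> fchains K"
  shows "bd (cone w c) = c + cone w (bd c)"
proof
  fix \<tau>
  let ?V = "insert w (\<Union>(supp c))"
  have fin: "finite ?V" using assms finite_vertices by blast
  have sub: "\<Union>(supp (cone w c)) \<subseteq> ?V"
  proof clarsimp
    fix x \<tau> assume "x \<in> \<tau>" "cone w c \<tau> \<noteq> 0" "\<forall>\<rho>\<in>supp c. x \<notin> \<rho>"
    then have "x \<notin> \<tau> - {w}" unfolding cone_def by (metis supp_iff)
    then show "x = w" using \<open>x \<in> \<tau>\<close> by simp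
  qed
  have eq: "bd (cone w c) \<tau> = (\<Sum>x\<in>?V - \<tau>. cone w c (insert x \<tau>))"
    by (rule bd_eq[OF fin sub])
  show "bd (cone w c) \<tau> = (c + cone w (bd c)) \<tau>"
  proof (cases "w \<in> \<tau>")
    case True
    have ins: "?V - (\<tau> - {w}) = insert w (?V - \<tau>)" using True by auto
    have "bd c (\<tau> - {w}) = (\<Sum>x\<in>?V - (\<tau> - {w}). c (insert x (\<tau> - {w})))"
      by (rule bd_eq[OF fin]) blast
    also have "\<dots> = c (insert w (\<tau> - {w})) + (\<Sum>x\<in>?V - \<tau>. c (insert x (\<tau> - {w})))"
      unfolding ins by (rule sum.insert) (use fin True in auto)
    also have "insert w (\<tau> - {w}) = \<tau>" using True by auto
    also have "(\<Sum>x\<in>?V - \<tau>. c (insert x (\<tau> - {w}))) = (\<Sum>x\<in>?V - \<tau>. cone w c (insert x \<tau>))"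
      by (intro sum.cong refl) (use True in \<open>auto simp: cone_def insert_Diff_if\<close>)
    finally have "bd c (\<tau> - {w}) = c \<tau> + bd (cone w c) \<tau>" unfolding eq .
    then have "bd (cone w c) \<tau> = c \<tau> + bd c (\<tau> - {w})" by (simp only: bit_add_left_self)
    then show ?thesis by (simp only: plus_fun_apply cone_in[OF True])
  next
    case False
    have "(\<Sum>x\<in>?V - \<tau>. cone w c (insert x \<tau>)) = (\<Sum>x\<in>{w}. cone w c (insert x \<tau>))"
      using fin False by (intro sum.mono_neutral_right) (auto simp: cone_def)
    also have "\<dots> = c \<tau>" using False by (simp only: sum.insert sum.empty finite.emptyI cone_in insertI1 Diff_insert_absorb empty_iff simp_thms add_0_right)
    finally have "bd (cone w c) \<tau> = c \<tau>" unfolding eq .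
    then show ?thesis by (simp only: plus_fun_apply cone_notin[OF False] add_0_right)
  qed
qed

text \<open>The cone over a cycle fills it. No degree is exceptional: the empty simplex is itself a
  cycle of the augmented complex, and its cone is the vertex \<open>w\<close>.\<close>

lemma acyclic_chains_cone:
  assumes "\<And>\<sigma>. \<sigma> \<in> K \<Longrightarrow> insert w \<sigma> \<in> K"
  shows "acyclic_chains K"
  unfolding acyclic_chains_def
proof (intro ballI impI)
  fix c assume c: "c \<in> fchains K" "bd c = 0"
  then have "bd (cone w c) = c"
    using bd_cone[OF c(1), of w] by simp
  moreover have "cone w c \<in> fchains K"
    by (rule cone_in_fchains[OF c(1)]) (use assms fchains_imp_in[OF c(1)] in simp)
  ultimately show "\<exists>d\<in>fchains K. bd d = c" by blast
qed

section \<open>Relative acyclicity of joins and deformation of cycles\<close>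

text \<open>Vanishing of the homology of the pair, stated without quotients. For down-closed
  \<open>A \<subseteq> Z\<close> the long exact sequence turns this into isomorphisms in reduced
  homology; the two halves that matter are derived by hand below.\<close>

definition rel_acyclic :: "'a set set \<Rightarrow> 'a set set \<Rightarrow> bool" where
  "rel_acyclic Z A \<longleftrightarrow>
     (\<forall>c\<in>fchains Z. bd c \<in> fchains A \<longrightarrow> (\<exists>d\<in>fchains Z. c + bd d \<in> fchains A))"

text \<open>The coefficient of \<tau> when \<open>c\<close> is written as a sum of joins of
  simplices \<tau> in \<open>B\<close> with chains outside \<open>B\<close>.\<close>

definition link_chain :: "'a set \<Rightarrow> 'a set \<Rightarrow> ('a set \<Rightarrow> bit) \<Rightarrow> 'a set \<Rightarrow> bit" where
  "link_chain B \<tau> c = (\<lambda>\<rho>. if \<rho> \<inter> B = {} then c (\<rho> \<union> \<tau>) else 0)"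

lemma link_chain_in_fchains:
  assumes "c \<in> fchains Z" "\<tau> \<subseteq> B"
  shows "link_chain B \<tau> c \<in> fchains {\<rho>. \<rho> \<inter> B = {} \<and> \<rho> \<union> \<tau> \<in> Z}"
proof -
  have "supp (link_chain B \<tau> c) \<subseteq> (\<lambda>\<sigma>. \<sigma> - B) ` supp c"
  proof
    fix \<rho> assume "\<rho> \<in> supp (link_chain B \<tau> c)"
    then have "\<rho> \<inter> B = {}" "c (\<rho> \<union> \<tau>) \<noteq> 0"
      by (auto simp: link_chain_def split: if_splits)
    moreover have "\<rho> = (\<rho> \<union> \<tau>) - B" using calculation assms(2) by auto
    ultimately show "\<rho> \<in> (\<lambda>\<sigma>. \<sigma> - B) ` supp c" by auto
  qed
  moreover have "finite ((\<lambda>\<sigma>. \<sigma> - B) ` supp c)" using assms by (auto simp: fchains_def)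
  ultimately have "finite (supp (link_chain B \<tau> c))" by (rule finite_subset)
  moreover have "finite \<rho> \<and> \<rho> \<inter> B = {} \<and> \<rho> \<union> \<tau> \<in> Z" if "link_chain B \<tau> c \<rho> \<noteq> 0" for \<rho>
  proof -
    have "\<rho> \<inter> B = {}" "c (\<rho> \<union> \<tau>) \<noteq> 0"
      using that by (auto simp: link_chain_def split: if_splits)
    moreover have "finite (\<rho> \<union> \<tau>) \<and> \<rho> \<union> \<tau> \<in> Z"
      using fchains_imp_finite[OF assms(1)] fchains_imp_in[OF assms(1)] calculation(2) by blast
    ultimately show ?thesis by simp
  qed
  ultimately show ?thesis by (simp add: fchains_def)
qed

text \<open>The coefficient of \<open>\<rho> \<union> \<tau>\<close> in \<open>bd c\<close> collects
  insertions of vertices outside \<open>B\<close>, which make up the boundary of the link chain, and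
  insertions of vertices of \<open>B\<close>. The latter vanish because no simplex of
  \<open>c\<close> meets \<open>B\<close> in more than \<open>card \<tau>\<close> vertices.\<close>

lemma bd_link_chain:
  assumes c: "c \<in> fchains Z" and \<tau>: "\<tau> \<subseteq> B" "finite \<tau>"
    and top: "\<And>\<sigma>. c \<sigma> \<noteq> 0 \<Longrightarrow> card (\<sigma> \<inter> B) \<le> card \<tau>"
    and zero: "\<And>\<rho>. \<rho> \<inter> B = {} \<Longrightarrow> bd c (\<rho> \<union> \<tau>) = 0"
  shows "bd (link_chain B \<tau> c) = 0"
proof
  fix \<rho>
  show "bd (link_chain B \<tau> c) \<rho> = 0 \<rho>"
  proof (cases "\<rho> \<inter> B = {}")
    case False
    then have "link_chain B \<tau> c (insert x \<rho>) = 0" for x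
      by (auto simp: link_chain_def)
    then show ?thesis by (simp add: bd_def)
  next
    case True
    let ?V = "\<Union>(supp c)"
    have fin: "finite ?V" using c by (rule finite_vertices)
    have sub: "\<Union>(supp (link_chain B \<tau> c)) \<subseteq> ?V"
    proof
      fix x assume "x \<in> \<Union>(supp (link_chain B \<tau> c))"
      then obtain \<rho> where "x \<in> \<rho>" "link_chain B \<tau> c \<rho> \<noteq> 0" by auto
      then have "x \<in> \<rho> \<union> \<tau>" "\<rho> \<union> \<tau> \<in> supp c"
        by (auto simp: link_chain_def split: if_splits)
      then show "x \<in> ?V" by blast
    qed
    have "bd c (\<rho> \<union> \<tau>) = (\<Sum>x\<in>?V - (\<rho> \<union> \<tau>). c (insert x (\<rho> \<union> \<tau>)))"
      by (rule bd_eq[OF fin]) blast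
    also have "\<dots> = (\<Sum>x\<in>?V - \<rho>. link_chain B \<tau> c (insert x \<rho>))"
    proof (rule sum.mono_neutral_cong_left)
      show "finite (?V - \<rho>)" using fin by blast
      show "?V - (\<rho> \<union> \<tau>) \<subseteq> ?V - \<rho>" by blast
      show "\<forall>i\<in>?V - \<rho> - (?V - (\<rho> \<union> \<tau>)). link_chain B \<tau> c (insert i \<rho>) = 0"
        using \<tau>(1) by (auto simp: link_chain_def)
      fix x assume x: "x \<in> ?V - (\<rho> \<union> \<tau>)"
      show "c (insert x (\<rho> \<union> \<tau>)) = link_chain B \<tau> c (insert x \<rho>)"
      proof (cases "x \<in> B")
        case xB: True
        have "insert x (\<rho> \<union> \<tau>) \<inter> B = insert x \<tau>" using True xB \<tau> by blast
        then have "card (insert x (\<rho> \<union> \<tau>) \<inter> B) = Suc (card \<tau>)" using x \<tau>(2) by simp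
        then have "c (insert x (\<rho> \<union> \<tau>)) = 0" using top[of "insert x (\<rho> \<union> \<tau>)"] by linarith
        then show ?thesis using xB by (simp add: link_chain_def)
      qed (use True in \<open>simp add: link_chain_def\<close>)
    qed
    also have "\<dots> = bd (link_chain B \<tau> c) \<rho>"
      by (rule bd_eq[OF fin sub, symmetric])
    finally show ?thesis using zero[OF True] by simp
  qed
qed

text \<open>\<open>D\<close> is the sum of the joins of \<open>d \<tau>\<close> with \<tau>. Its
  boundary consists of the joins of \<open>bd (d \<tau>)\<close> with \<tau> and of the joins of
  \<open>d \<tau>\<close> with the facets of \<tau>; the latter meet \<open>B\<close> in fewer than
  \<open>k\<close> vertices and are invisible in the range considered.\<close>

lemma bd_join_chains:
  assumes T: "finite T" "\<And>\<tau>. \<tau> \<in> T \<Longrightarrow> \<tau> \<subseteq> B \<and> finite \<tau> \<and> card \<tau> = k"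
    and d: "\<And>\<tau>. \<tau> \<in> T \<Longrightarrow> d \<tau> \<in> fchains {\<rho>. \<rho> \<inter> B = {} \<and> \<rho> \<union> \<tau> \<in> Z}"
    and D_def: "D = (\<lambda>\<sigma>. if \<sigma> \<inter> B \<in> T then d (\<sigma> \<inter> B) (\<sigma> - B) else 0)"
  shows "D \<in> fchains Z"
    and "finite \<sigma> \<Longrightarrow> k \<le> card (\<sigma> \<inter> B) \<Longrightarrow>
      bd D \<sigma> = (if \<sigma> \<inter> B \<in> T then bd (d (\<sigma> \<inter> B)) (\<sigma> - B) else 0)"
proof -
  have *: "\<sigma> \<inter> B \<in> T \<and> d (\<sigma> \<inter> B) (\<sigma> - B) \<noteq> 0" if "D \<sigma> \<noteq> 0" for \<sigma>
    using that by (auto simp: D_def split: if_splits)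
  have "supp D \<subseteq> (\<Union>\<tau>\<in>T. (\<lambda>\<rho>. \<rho> \<union> \<tau>) ` supp (d \<tau>))"
  proof
    fix \<sigma> assume "\<sigma> \<in> supp D"
    then have "\<sigma> \<inter> B \<in> T" "\<sigma> - B \<in> supp (d (\<sigma> \<inter> B))" using *[of \<sigma>] by auto
    moreover have "\<sigma> = (\<sigma> - B) \<union> (\<sigma> \<inter> B)" by blast
    ultimately show "\<sigma> \<in> (\<Union>\<tau>\<in>T. (\<lambda>\<rho>. \<rho> \<union> \<tau>) ` supp (d \<tau>))" by blast
  qed
  moreover have "finite (\<Union>\<tau>\<in>T. (\<lambda>\<rho>. \<rho> \<union> \<tau>) ` supp (d \<tau>))"
    using T(1) d by (auto simp: fchains_def)
  ultimately have "finite (supp D)" by (rule finite_subset)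
  moreover have "finite \<sigma> \<and> \<sigma> \<in> Z" if "D \<sigma> \<noteq> 0" for \<sigma>
  proof -
    have T': "\<sigma> \<inter> B \<in> T" and "d (\<sigma> \<inter> B) (\<sigma> - B) \<noteq> 0" using *[OF that] by auto
    then have "finite (\<sigma> - B)" "(\<sigma> - B) \<union> (\<sigma> \<inter> B) \<in> Z"
      using d[OF T'] by (auto simp: fchains_def)
    moreover have "finite (\<sigma> \<inter> B)" using T(2)[OF T'] by blast
    moreover have "\<sigma> = (\<sigma> - B) \<union> (\<sigma> \<inter> B)" by blast
    ultimately show ?thesis by (metis finite_UnI)
  qed
  ultimately show D: "D \<in> fchains Z" by (simp add: fchains_def)
  assume \<sigma>: "finite \<sigma>" "k \<le> card (\<sigma> \<inter> B)"
  have up: "D (insert x \<sigma>) = 0" if "x \<in> B - \<sigma>" for x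
  proof -
    have "insert x \<sigma> \<inter> B = insert x (\<sigma> \<inter> B)" using that by blast
    then have "card (insert x \<sigma> \<inter> B) = Suc (card (\<sigma> \<inter> B))" using that \<sigma>(1) by simp
    then have "insert x \<sigma> \<inter> B \<notin> T" using T(2)[of "insert x \<sigma> \<inter> B"] \<sigma>(2) by force
    then show ?thesis by (simp add: D_def)
  qed
  have side: "D (insert x \<sigma>) = (if \<sigma> \<inter> B \<in> T then d (\<sigma> \<inter> B) (insert x (\<sigma> - B)) else 0)"
    if "x \<notin> B" for x
    using that by (simp add: D_def insert_Diff_if)
  show "bd D \<sigma> = (if \<sigma> \<inter> B \<in> T then bd (d (\<sigma> \<inter> B)) (\<sigma> - B) else 0)"
  proof (cases "\<sigma> \<inter> B \<in> T")
    case False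
    have "D (insert x \<sigma>) = 0" if "x \<notin> \<sigma>" for x
      using up[of x] side[of x] that False by (cases "x \<in> B") auto
    then show ?thesis using False unfolding bd_def by simp
  next
    case True
    let ?e = "d (\<sigma> \<inter> B)"
    let ?V = "\<Union>(supp D) \<union> \<Union>(supp ?e)"
    have fin: "finite ?V" using D d[OF True] finite_vertices by blast
    have e0: "?e (insert x \<rho>) = 0" if "x \<in> B" for x \<rho>
      using fchains_imp_in[OF d[OF True], of "insert x \<rho>"] that by auto
    have "bd D \<sigma> = (\<Sum>x\<in>?V - \<sigma>. D (insert x \<sigma>))"
      by (rule bd_eq[OF fin]) blast
    also have "\<dots> = (\<Sum>x\<in>?V - (\<sigma> - B). ?e (insert x (\<sigma> - B)))"
    proof (rule sum.mono_neutral_cong_left)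
      show "finite (?V - (\<sigma> - B))" using fin by blast
      show "?V - \<sigma> \<subseteq> ?V - (\<sigma> - B)" by blast
      show "\<forall>i\<in>?V - (\<sigma> - B) - (?V - \<sigma>). ?e (insert i (\<sigma> - B)) = 0"
        using e0 by blast
      fix x assume "x \<in> ?V - \<sigma>"
      then show "D (insert x \<sigma>) = ?e (insert x (\<sigma> - B))"
        using up[of x] side[of x] e0[of x] True by (cases "x \<in> B") auto
    qed
    also have "\<dots> = bd ?e (\<sigma> - B)"
      by (rule bd_eq[OF fin, symmetric]) blast
    finally show ?thesis using True by simp
  qed
qed

text \<open>If \<open>\<tau>\<close> is a largest set of vertices in \<open>B\<close> that occurs in a relative cycle, then the part of the cycle
  over \<open>\<tau>\<close> is a cycle of the link of \<open>\<tau>\<close>, and filling it there removes \<open>\<tau>\<close> from the cycle.\<close>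

lemma rel_acyclic_join:
  assumes Z: "down_closed Z"
    and links: "\<And>\<tau>. \<tau> \<noteq> {} \<Longrightarrow> \<tau> \<subseteq> B \<Longrightarrow> finite \<tau> \<Longrightarrow> \<tau> \<in> Z \<Longrightarrow>
      acyclic_chains {\<rho>. \<rho> \<inter> B = {} \<and> \<rho> \<union> \<tau> \<in> Z}"
  shows "rel_acyclic Z {\<sigma>\<in>Z. \<sigma> \<inter> B = {}}"
proof -
  let ?A = "{\<sigma>\<in>Z. \<sigma> \<inter> B = {}}"
  have "\<exists>d\<in>fchains Z. c + bd d \<in> fchains ?A"
    if "c \<in> fchains Z" "bd c \<in> fchains ?A" "\<And>\<sigma>. c \<sigma> \<noteq> 0 \<Longrightarrow> card (\<sigma> \<inter> B) \<le> m" for c m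
    using that
  proof (induction m arbitrary: c)
    case 0
    have "\<sigma> \<inter> B = {}" if "c \<sigma> \<noteq> 0" for \<sigma>
    proof -
      have "finite \<sigma>" using that 0(1) by (simp add: fchains_def)
      then show ?thesis using 0(3)[OF that] by simp
    qed
    then have "c \<in> fchains ?A" using 0(1) by (auto simp: fchains_def)
    then show ?case by (intro bexI[of _ 0]) (simp_all only: bd_0 add_0_right fchains_0)
  next
    case (Suc m)
    \<comment> \<open>The traces on \<open>B\<close> of the largest size that the bound permits;
      they are all removed in one step.\<close>
    let ?T = "{\<tau>. card \<tau> = Suc m \<and> (\<exists>\<sigma>\<in>supp c. \<tau> = \<sigma> \<inter> B)}"
    have fin: "finite (supp c)" "\<And>\<sigma>. c \<sigma> \<noteq> 0 \<Longrightarrow> finite \<sigma> \<and> \<sigma> \<in> Z"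
      using Suc.prems(1) by (auto simp: fchains_def)
    have T: "finite ?T" using fin(1) by simp
    have T': "\<tau> \<subseteq> B \<and> finite \<tau> \<and> card \<tau> = Suc m" if "\<tau> \<in> ?T" for \<tau>
      using that fin(2) by auto
    have "\<exists>e\<in>fchains {\<rho>. \<rho> \<inter> B = {} \<and> \<rho> \<union> \<tau> \<in> Z}. bd e = link_chain B \<tau> c" if \<tau>: "\<tau> \<in> ?T" for \<tau>
    proof -
      note T'[OF \<tau>]
      moreover have "\<tau> \<in> Z"
      proof -
        obtain \<sigma> where "c \<sigma> \<noteq> 0" "\<tau> = \<sigma> \<inter> B" using \<tau> by auto
        then show ?thesis using fin(2)[of \<sigma>] Z unfolding down_closed_def by blast
      qed
      moreover have "\<tau> \<noteq> {}" using \<tau> by auto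
      ultimately have "acyclic_chains {\<rho>. \<rho> \<inter> B = {} \<and> \<rho> \<union> \<tau> \<in> Z}"
        using links by blast
      moreover have "link_chain B \<tau> c \<in> fchains {\<rho>. \<rho> \<inter> B = {} \<and> \<rho> \<union> \<tau> \<in> Z}"
        using link_chain_in_fchains[OF Suc.prems(1)] T'[OF \<tau>] by blast
      moreover have "bd (link_chain B \<tau> c) = 0"
      proof (rule bd_link_chain[OF Suc.prems(1)])
        fix \<rho> assume "\<rho> \<inter> B = {}"
        moreover have "\<tau> \<noteq> {}" using T'[OF \<tau>] by auto
        \<comment> \<open>\<open>bd c\<close> is supported on simplices that miss \<open>B\<close>,
          so it vanishes on everything that contains the nonempty set \<tau>.\<close>
        ultimately have "\<rho> \<union> \<tau> \<notin> ?A" using T'[OF \<tau>] by blast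
        then show "bd c (\<rho> \<union> \<tau>) = 0"
          using fchains_imp_in[OF Suc.prems(2), of "\<rho> \<union> \<tau>"] by argo
      qed (use T'[OF \<tau>] Suc.prems(3) in simp_all)
      ultimately show ?thesis unfolding acyclic_chains_def by blast
    qed
    then have "\<forall>\<tau>\<in>?T. \<exists>e. e \<in> fchains {\<rho>. \<rho> \<inter> B = {} \<and> \<rho> \<union> \<tau> \<in> Z} \<and> bd e = link_chain B \<tau> c"
      by blast
    from bchoice[OF this] obtain d where d: "\<And>\<tau>. \<tau> \<in> ?T \<Longrightarrow> d \<tau> \<in> fchains {\<rho>. \<rho> \<inter> B = {} \<and> \<rho> \<union> \<tau> \<in> Z}"
      "\<And>\<tau>. \<tau> \<in> ?T \<Longrightarrow> bd (d \<tau>) = link_chain B \<tau> c"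
      by blast
    define D where "D = (\<lambda>\<sigma>. if \<sigma> \<inter> B \<in> ?T then d (\<sigma> \<inter> B) (\<sigma> - B) else 0)"
    have D: "D \<in> fchains Z"
      by (rule bd_join_chains(1)[OF T T' d(1) D_def])
    have D': "bd D \<sigma> = (if \<sigma> \<inter> B \<in> ?T then bd (d (\<sigma> \<inter> B)) (\<sigma> - B) else 0)"
      if "finite \<sigma>" "Suc m \<le> card (\<sigma> \<inter> B)" for \<sigma>
      by (rule bd_join_chains(2)[OF T T' d(1) D_def that])
    have bdD: "bd D \<in> fchains Z" using D Z by (rule bd_in_fchains)
    have eq: "bd (c + bd D) = bd c"
      using bd_add[OF Suc.prems(1) bdD] bd_bd[OF D] by simp
    have cD: "c + bd D \<in> fchains Z" using Suc.prems(1) bdD by (rule fchains_add)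
    \<comment> \<open>On simplices with more than \<open>m\<close> vertices in \<open>B\<close> the
      chains \<open>c\<close> and \<open>bd D\<close> agree and cancel; what \<open>bd D\<close>
      adds elsewhere has at most \<open>m\<close> such vertices.\<close>
    have low: "card (\<sigma> \<inter> B) \<le> m" if \<sigma>: "(c + bd D) \<sigma> \<noteq> 0" for \<sigma>
    proof (rule ccontr)
      assume "\<not> ?thesis"
      then have m: "Suc m \<le> card (\<sigma> \<inter> B)" by simp
      have "finite \<sigma>" using cD \<sigma> by (rule fchains_imp_finite)
      have "bd D \<sigma> = c \<sigma>"
      proof (cases "\<sigma> \<inter> B \<in> ?T")
        case True
        then have "bd D \<sigma> = link_chain B (\<sigma> \<inter> B) c (\<sigma> - B)"
          using D'[OF \<open>finite \<sigma>\<close> m] d(2) by simp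
        also have "\<dots> = c ((\<sigma> - B) \<union> (\<sigma> \<inter> B))"
          unfolding link_chain_def by (rule if_P) blast
        also have "(\<sigma> - B) \<union> (\<sigma> \<inter> B) = \<sigma>" by blast
        finally show ?thesis .
      next
        case False
        moreover have "c \<sigma> = 0"
        proof (rule ccontr)
          assume "c \<sigma> \<noteq> 0"
          then have "card (\<sigma> \<inter> B) = Suc m" "\<sigma> \<in> supp c" using Suc.prems(3)[of \<sigma>] m by simp_all
          then have "\<sigma> \<inter> B \<in> ?T" by blast
          then show False using False by contradiction
        qed
        ultimately show ?thesis using D'[OF \<open>finite \<sigma>\<close> m] by (simp only: if_False)
      qed
      then show False using \<sigma> by simp
    qed
    have "bd (c + bd D) \<in> fchains ?A" unfolding eq by (rule Suc.prems(2))
    from Suc.IH[OF cD this low] obtain e where e: "e \<in> fchains Z" "(c + bd D) + bd e \<in> fchains ?A"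
      by blast
    have "c + bd (D + e) = (c + bd D) + bd e"
      using bd_add[OF D e(1)] by (simp add: add.assoc)
    then have "c + bd (D + e) \<in> fchains ?A" using e(2) by (simp only:)
    moreover have "D + e \<in> fchains Z" using D e(1) by (rule fchains_add)
    ultimately show ?case by blast
  qed
  note * = this
  show ?thesis unfolding rel_acyclic_def
  proof (intro ballI impI)
    fix c assume c: "c \<in> fchains Z" "bd c \<in> fchains ?A"
    have "finite (supp c)" using c(1) by (simp add: fchains_def)
    then have "card (\<sigma> \<inter> B) \<le> Max ((\<lambda>\<sigma>. card (\<sigma> \<inter> B)) ` supp c)" if "c \<sigma> \<noteq> 0" for \<sigma>
      using that by (intro Max_ge) auto
    from *[OF c this] show "\<exists>d\<in>fchains Z. c + bd d \<in> fchains ?A" .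
  qed
qed

text \<open>Write \<open>z = v * a + b\<close>, where \<open>v\<close> occurs in neither \<open>a\<close> nor \<open>b\<close>; adding the boundary of \<open>w * v * a\<close>
  gives \<open>w * a + b\<close>.\<close>

lemma replace_vertex:
  assumes z: "z \<in> fchains L" "bd z = 0" and "v \<noteq> w"
    and K: "\<And>\<sigma>. z \<sigma> \<noteq> 0 \<Longrightarrow> v \<in> \<sigma> \<Longrightarrow> insert w \<sigma> \<in> K"
  obtains d where "d \<in> fchains K"
    "\<And>\<sigma>. (z + bd d) \<sigma> \<noteq> 0 \<Longrightarrow>
       (z \<sigma> \<noteq> 0 \<and> v \<notin> \<sigma>) \<or> (\<exists>\<rho>. z \<rho> \<noteq> 0 \<and> v \<in> \<rho> \<and> \<sigma> = insert w (\<rho> - {v}))"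
proof -
  define a where "a = (\<lambda>\<tau>. if v \<in> \<tau> then 0 else z (insert v \<tau>))"
  define b where "b = (\<lambda>\<tau>. if v \<in> \<tau> then 0 else z \<tau>)"
  have finz: "finite (supp z)" "\<And>\<sigma>. z \<sigma> \<noteq> 0 \<Longrightarrow> finite \<sigma>" using z(1) by (auto simp: fchains_def)
  have "supp a \<subseteq> (\<lambda>\<sigma>. \<sigma> - {v}) ` supp z"
  proof
    fix \<tau> assume "\<tau> \<in> supp a"
    then have "v \<notin> \<tau>" "insert v \<tau> \<in> supp z" by (auto simp: a_def split: if_splits)
    then show "\<tau> \<in> (\<lambda>\<sigma>. \<sigma> - {v}) ` supp z" by (intro image_eqI[of _ _ "insert v \<tau>"]) auto
  qed
  then have "finite (supp a)" using finz(1) finite_subset by blast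
  moreover have "finite \<tau>" if "a \<tau> \<noteq> 0" for \<tau>
    using that finz(2)[of "insert v \<tau>"] by (auto simp: a_def split: if_splits)
  ultimately have a: "a \<in> fchains UNIV" by (simp add: fchains_def)
  have "supp b \<subseteq> supp z" by (auto simp: b_def split: if_splits)
  then have "finite (supp b)" using finz(1) finite_subset by blast
  moreover have "finite \<tau>" if "b \<tau> \<noteq> 0" for \<tau>
    using that finz(2)[of \<tau>] by (auto simp: b_def split: if_splits)
  ultimately have b: "b \<in> fchains UNIV" by (simp add: fchains_def)
  have va: "cone v a \<in> fchains UNIV" by (rule cone_in_fchains[OF a]) simp
  have zab: "z = cone v a + b"
  proof
    fix \<tau> show "z \<tau> = (cone v a + b) \<tau>"
      by (cases "v \<in> \<tau>") (auto simp: a_def b_def insert_absorb)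
  qed
  have sum0: "a + cone v (bd a) + bd b = 0"
    using z(2) unfolding zab bd_add[OF va b] bd_cone[OF a] .
  \<comment> \<open>In \<open>sum0\<close> only \<open>cone v (bd a)\<close> contains simplices
    through \<open>v\<close>, so comparing coefficients at \<open>insert v \<rho>\<close> shows that
    \<open>a\<close> is a cycle.\<close>
  have bda: "bd a = 0"
  proof
    fix \<rho> show "bd a \<rho> = 0 \<rho>"
    proof (cases "v \<in> \<rho>")
      case True
      then have "a (insert x \<rho>) = 0" for x by (simp add: a_def)
      then show ?thesis by (simp add: bd_def)
    next
      case False
      have "b (insert x (insert v \<rho>)) = 0" for x by (simp add: b_def)
      then have "bd b (insert v \<rho>) = 0" by (simp add: bd_def)
      moreover have "a (insert v \<rho>) = 0" by (simp add: a_def)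
      moreover have "(a + cone v (bd a) + bd b) (insert v \<rho>) = 0" unfolding sum0 by simp
      ultimately show ?thesis using False by simp
    qed
  qed
  \<comment> \<open>Simplices of \<open>a\<close> that already contain \<open>w\<close> would become
    degenerate under the replacement; \<open>cone w\<close> discards exactly these.\<close>
  define d where "d = cone w (cone v a)"
  have dK: "d \<in> fchains K" unfolding d_def
  proof (rule cone_in_fchains[OF va])
    fix \<sigma> assume "\<sigma> \<in> supp (cone v a)"
    then have "v \<in> \<sigma>" "z (insert v (\<sigma> - {v})) \<noteq> 0"
      by (auto simp: cone_def a_def split: if_splits)
    moreover have "insert v (\<sigma> - {v}) = \<sigma>" using calculation(1) by blast
    ultimately show "insert w \<sigma> \<in> K" using K by simp
  qed
  have "bd d = cone v a + cone w a"
    unfolding d_def bd_cone[OF va] bd_cone[OF a] bda by simp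
  then have eq: "z + bd d = b + cone w a" unfolding zab by (simp add: add.left_commute add.commute)
  have "(z \<sigma> \<noteq> 0 \<and> v \<notin> \<sigma>) \<or> (\<exists>\<rho>. z \<rho> \<noteq> 0 \<and> v \<in> \<rho> \<and> \<sigma> = insert w (\<rho> - {v}))"
    if "(z + bd d) \<sigma> \<noteq> 0" for \<sigma>
  proof (cases "b \<sigma> = 0")
    case False
    then show ?thesis by (auto simp: b_def split: if_splits)
  next
    case True
    then have "cone w a \<sigma> \<noteq> 0" using that eq by simp
    then have w: "w \<in> \<sigma>" "v \<notin> \<sigma> - {w}" "z (insert v (\<sigma> - {w})) \<noteq> 0"
      by (auto simp: cone_def a_def split: if_splits)
    have "\<sigma> = insert w (insert v (\<sigma> - {w}) - {v})" using w(1,2) by blast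
    then show ?thesis using w(3) by blast
  qed
  then show ?thesis using that dK by blast
qed

text \<open>Moving the vertices one at a time, in order of increasing rank, a vertex is never moved onto
  one that still has to be moved.\<close>

lemma deform_cycle:
  fixes r :: "'a \<Rightarrow> real"
  assumes z: "z \<in> fchains K" "bd z = 0" and K: "down_closed K"
    and contig: "\<And>\<sigma>. z \<sigma> \<noteq> 0 \<Longrightarrow> \<sigma> \<union> f ` \<sigma> \<in> K"
    and rank: "\<And>v. v \<in> \<Union>(supp z) \<Longrightarrow> f v \<noteq> v \<Longrightarrow> r (f v) < r v"
  obtains d where "d \<in> fchains K" "\<And>\<sigma>. (z + bd d) \<sigma> \<noteq> 0 \<Longrightarrow> \<exists>\<rho>. z \<rho> \<noteq> 0 \<and> \<sigma> = f ` \<rho>"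
proof -
  \<comment> \<open>The intermediate map that has moved only the vertices in
    \<open>S\<close>.\<close>
  define g where "g = (\<lambda>S v. if v \<in> S then f v else v)"
  have fin: "finite (\<Union>(supp z))" using z(1) by (rule finite_vertices)
  have "S \<subseteq> \<Union>(supp z) \<longrightarrow>
     (\<exists>d\<in>fchains K. \<forall>\<sigma>. (z + bd d) \<sigma> \<noteq> 0 \<longrightarrow> (\<exists>\<rho>. z \<rho> \<noteq> 0 \<and> \<sigma> = g S ` \<rho>))"
    if "finite S" for S
    using that
  proof (induction S rule: finite_ranking_induct[where f = r])
    case empty
    show ?case by (auto simp: g_def intro!: bexI[of _ 0])
  next
    case (insert v S)
    show ?case
    proof
      assume S: "insert v S \<subseteq> \<Union>(supp z)"
      then obtain d where d: "d \<in> fchains K"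
        "\<And>\<sigma>. (z + bd d) \<sigma> \<noteq> 0 \<Longrightarrow> \<exists>\<rho>. z \<rho> \<noteq> 0 \<and> \<sigma> = g S ` \<rho>"
        using insert.IH by auto
      have gv: "g (insert v S) u = (if u = v then f v else g S u)" for u
        by (simp add: g_def)
      show "\<exists>d\<in>fchains K. \<forall>\<sigma>. (z + bd d) \<sigma> \<noteq> 0 \<longrightarrow> (\<exists>\<rho>. z \<rho> \<noteq> 0 \<and> \<sigma> = g (insert v S) ` \<rho>)"
      proof (cases "f v = v \<or> v \<in> S")
        case True
        then have "g (insert v S) = g S" by (auto simp: g_def)
        then show ?thesis using d by auto
      next
        case False
        have bdd: "bd d \<in> fchains K" using d(1) K by (rule bd_in_fchains)
        have z': "z + bd d \<in> fchains K" using z(1) bdd by blast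
        have bz': "bd (z + bd d) = 0" using bd_add[OF z(1) bdd] bd_bd[OF d(1)] z(2) by simp
        \<comment> \<open>No vertex moved so far has landed on \<open>v\<close>: if
          \<open>f u = v\<close> with \<open>u\<close> in \<open>S\<close> and
          \<open>u \<noteq> v\<close>, then \<open>r v < r u\<close>, whereas the ranking induction
          adds \<open>v\<close> with the largest rank. Hence \<open>v\<close> occurs only as itself
          and can be replaced alone.\<close>
        have gne: "u = v" if "g S u = v" for u
        proof (cases "u \<in> S")
          case True
          then have "f u = v" using that by (simp add: g_def)
          moreover have "u \<noteq> v" using True False by blast
          ultimately have "r v < r u" using rank[of u] S True by auto
          then show ?thesis using insert.hyps(2)[OF True] by simp
        qed (use that in \<open>simp add: g_def\<close>)
        have gvv: "g S v = v" using False by (simp add: g_def)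
        have gsub: "insert (f v) (g S ` \<rho>) \<subseteq> \<rho> \<union> f ` \<rho>" if "v \<in> \<rho>" for \<rho>
          using that by (auto simp: g_def)
        have step: "insert (f v) \<sigma> \<in> K" if \<sigma>: "(z + bd d) \<sigma> \<noteq> 0" "v \<in> \<sigma>" for \<sigma>
        proof -
          obtain \<rho> where \<rho>: "z \<rho> \<noteq> 0" "\<sigma> = g S ` \<rho>" using d(2)[OF \<sigma>(1)] by blast
          then have "v \<in> \<rho>" using \<sigma>(2) gne by (metis imageE)
          then show ?thesis using gsub[of \<rho>] contig[OF \<rho>(1)] K \<rho>(2)
            unfolding down_closed_def by blast
        qed
        have vf: "v \<noteq> f v" using False by metis
        obtain e where e: "e \<in> fchains K"
          "\<And>\<sigma>. (z + bd d + bd e) \<sigma> \<noteq> 0 \<Longrightarrow> ((z + bd d) \<sigma> \<noteq> 0 \<and> v \<notin> \<sigma>) \<or>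
             (\<exists>\<rho>. (z + bd d) \<rho> \<noteq> 0 \<and> v \<in> \<rho> \<and> \<sigma> = insert (f v) (\<rho> - {v}))"
        proof (rule replace_vertex[OF z' bz' vf, where K = K])
          show "insert (f v) \<sigma> \<in> K" if "(z + bd d) \<sigma> \<noteq> 0" "v \<in> \<sigma>" for \<sigma>
            using that by (rule step)
        qed (rule that)
        have "\<exists>\<rho>. z \<rho> \<noteq> 0 \<and> \<sigma> = g (insert v S) ` \<rho>" if \<sigma>: "(z + bd d + bd e) \<sigma> \<noteq> 0" for \<sigma>
          using e(2)[OF \<sigma>]
        proof (elim disjE conjE exE)
          assume "(z + bd d) \<sigma> \<noteq> 0" and v: "v \<notin> \<sigma>"
          then obtain \<rho> where \<rho>: "z \<rho> \<noteq> 0" "\<sigma> = g S ` \<rho>" using d(2) by blast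
          then have "v \<notin> \<rho>" using v gvv image_eqI[of v "g S" v \<rho>] by auto
          then have "g (insert v S) ` \<rho> = g S ` \<rho>" by (intro image_cong) (auto simp: gv)
          then show ?thesis using \<rho> by blast
        next
          fix \<rho> assume \<rho>: "(z + bd d) \<rho> \<noteq> 0" "v \<in> \<rho>" "\<sigma> = insert (f v) (\<rho> - {v})"
          obtain \<pi> where \<pi>: "z \<pi> \<noteq> 0" "\<rho> = g S ` \<pi>" using d(2)[OF \<rho>(1)] by blast
          have v: "v \<in> \<pi>" using \<rho>(2) \<pi>(2) gne by (metis imageE)
          have "g (insert v S) ` \<pi> = insert (f v) (g S ` (\<pi> - {v}))"
          proof -
            have "g (insert v S) ` (\<pi> - {v}) = g S ` (\<pi> - {v})"
              by (intro image_cong refl) (simp add: gv)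
            moreover have "\<pi> = insert v (\<pi> - {v})" using v by blast
            ultimately show ?thesis using gv[of v] by (metis (no_types) image_insert)
          qed
          also have "g S ` (\<pi> - {v}) = g S ` \<pi> - {v}"
          proof
            show "g S ` (\<pi> - {v}) \<subseteq> g S ` \<pi> - {v}" using gne by blast
            show "g S ` \<pi> - {v} \<subseteq> g S ` (\<pi> - {v})" using gvv by blast
          qed
          finally have "\<sigma> = g (insert v S) ` \<pi>" using \<pi>(2) \<rho>(3) by simp
          then show ?thesis using \<pi>(1) by blast
        qed
        then have "\<forall>\<sigma>. (z + bd (d + e)) \<sigma> \<noteq> 0 \<longrightarrow> (\<exists>\<rho>. z \<rho> \<noteq> 0 \<and> \<sigma> = g (insert v S) ` \<rho>)"
          unfolding bd_add[OF d(1) e(1)] add.assoc by blast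
        moreover have "d + e \<in> fchains K" using d(1) e(1) by blast
        ultimately show ?thesis by blast
      qed
    qed
  qed
  from this[OF fin] obtain d where d: "d \<in> fchains K"
    "\<And>\<sigma>. (z + bd d) \<sigma> \<noteq> 0 \<Longrightarrow> \<exists>\<rho>. z \<rho> \<noteq> 0 \<and> \<sigma> = g (\<Union>(supp z)) ` \<rho>" by auto
  have "g (\<Union>(supp z)) ` \<rho> = f ` \<rho>" if "z \<rho> \<noteq> 0" for \<rho>
    by (rule image_cong) (use that in \<open>auto simp: g_def\<close>)
  then have "\<exists>\<rho>. z \<rho> \<noteq> 0 \<and> \<sigma> = f ` \<rho>" if "(z + bd d) \<sigma> \<noteq> 0" for \<sigma>
    using d(2)[OF that] by blast
  then show ?thesis using that d(1) by blast
qed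

section \<open>Injective vertex maps and Vietoris-Rips complexes\<close>

text \<open>The injectivity half of \<open>rel_acyclic\<close>: \<open>d\<close> is a relative
  cycle, and correcting it by a boundary moves it into \<open>A\<close> without changing
  \<open>bd d\<close>.\<close>

lemma rel_acyclic_boundary:
  assumes rel: "rel_acyclic Z A" and Z: "down_closed Z"
    and d: "d \<in> fchains Z" "bd d \<in> fchains A"
  obtains e where "e \<in> fchains A" "bd e = bd d"
proof -
  obtain f where f: "f \<in> fchains Z" "d + bd f \<in> fchains A"
    using rel d unfolding rel_acyclic_def by blast
  have "bd (d + bd f) = bd d"
    using bd_add[OF d(1) bd_in_fchains[OF f(1) Z]] bd_bd[OF f(1)] by simp
  then show ?thesis using that f(2) by blast
qed

text \<open>Meant for injective \<open>f\<close>, where each simplex has at most one preimage and no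
  sum over fibres occurs. The test on the range is essential, because the preimage ignores vertices
  outside the range.\<close>

definition push :: "('a \<Rightarrow> 'b) \<Rightarrow> ('a set \<Rightarrow> bit) \<Rightarrow> 'b set \<Rightarrow> bit" where
  "push f c = (\<lambda>\<sigma>. if \<sigma> \<subseteq> range f then c (f -` \<sigma>) else 0)"

lemma push_image [simp]: "inj f \<Longrightarrow> push f c (f ` \<sigma>) = c \<sigma>"
  by (simp add: push_def inj_vimage_image_eq image_mono)

lemma push_nonzeroE:
  assumes "push f c \<sigma> \<noteq> 0"
  obtains \<tau> where "\<sigma> = f ` \<tau>" "c \<tau> \<noteq> 0"
proof -
  have "\<sigma> \<subseteq> range f" "c (f -` \<sigma>) \<noteq> 0" using assms by (auto simp: push_def split: if_splits)
  moreover have "\<sigma> = f ` (f -` \<sigma>)" using calculation(1) by auto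
  ultimately show ?thesis using that by blast
qed

lemma push_add: "push f (c + d) = push f c + push f d"
  by (rule ext) (simp add: push_def)

lemma push_0 [simp]: "push f 0 = 0"
  by (rule ext) (simp add: push_def)

lemma push_inject:
  assumes "inj f" "push f c = push f d"
  shows "c = d"
proof
  fix \<sigma> show "c \<sigma> = d \<sigma>" using push_image[OF assms(1)] assms(2) by metis
qed

lemma supp_push: "inj f \<Longrightarrow> supp (push f c) = (`) f ` supp c"
  by (auto elim!: push_nonzeroE)

lemma push_in_fchains:
  assumes "inj f" "c \<in> fchains K"
  shows "push f c \<in> fchains ((`) f ` K)"
proof -
  have "finite (supp (push f c))" using assms by (simp add: supp_push fchains_def)
  moreover have "finite \<sigma> \<and> \<sigma> \<in> (`) f ` K" if \<sigma>: "push f c \<sigma> \<noteq> 0" for \<sigma>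
  proof -
    obtain \<tau> where \<tau>: "\<sigma> = f ` \<tau>" "c \<tau> \<noteq> 0" using push_nonzeroE[OF \<sigma>] .
    then show ?thesis
      using fchains_imp_finite[OF assms(2) \<tau>(2)] fchains_imp_in[OF assms(2) \<tau>(2)] by simp
  qed
  ultimately show ?thesis by (simp add: fchains_def)
qed

lemma bd_push:
  assumes "inj f" "c \<in> fchains K"
  shows "bd (push f c) = push f (bd c)"
proof
  fix \<sigma>
  show "bd (push f c) \<sigma> = push f (bd c) \<sigma>"
  proof (cases "\<sigma> \<subseteq> range f")
    case False
    then have "push f c (insert x \<sigma>) = 0" for x by (simp add: push_def)
    then show ?thesis using False by (simp add: bd_def push_def)
  next
    case True
    then obtain \<tau> where \<tau>: "\<sigma> = f ` \<tau>" by (auto simp: subset_image_iff)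
    let ?V = "\<Union>(supp c)"
    have fin: "finite (f ` ?V)" using finite_vertices[OF assms(2)] by (rule finite_imageI)
    have "\<Union>(supp (push f c)) \<subseteq> f ` ?V" unfolding supp_push[OF assms(1)] by blast
    from bd_eq[OF fin this, of \<sigma>]
    have "bd (push f c) \<sigma> = (\<Sum>x\<in>f ` (?V - \<tau>). push f c (insert x (f ` \<tau>)))"
      unfolding \<tau> image_set_diff[OF assms(1)] .
    also have "\<dots> = (\<Sum>x\<in>?V - \<tau>. push f c (f ` insert x \<tau>))"
      by (subst sum.reindex) (auto intro: inj_on_subset[OF assms(1)] simp: push_def)
    also have "\<dots> = push f (bd c) \<sigma>"
      unfolding \<tau> push_image[OF assms(1)] bd_def ..
    finally show ?thesis .
  qed
qed

lemma fchains_image: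
  assumes "inj f" "e \<in> fchains ((`) f ` K)"
  obtains c where "c \<in> fchains K" "e = push f c"
proof -
  define c where "c = (\<lambda>\<tau>. e (f ` \<tau>))"
  have e: "e = push f c"
  proof
    fix \<sigma> show "e \<sigma> = push f c \<sigma>"
    proof (cases "\<sigma> \<subseteq> range f")
      case True
      then have "f ` (f -` \<sigma>) = \<sigma>" by auto
      then show ?thesis using True by (simp add: push_def c_def)
    next
      case False
      then have "\<sigma> \<notin> (`) f ` K" by blast
      then have "e \<sigma> = 0" using fchains_imp_in[OF assms(2)] by blast
      then show ?thesis using False by (simp add: push_def)
    qed
  qed
  have inj: "inj ((`) f)" using assms(1) by (simp add: inj_image_eq_iff inj_def)
  have "finite ((`) f ` supp c)"
    using assms(2) unfolding e by (simp add: fchains_def supp_push[OF assms(1)])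
  then have "finite (supp c)" by (rule finite_imageD) (rule inj_on_subset[OF inj subset_UNIV])
  moreover have "finite \<tau> \<and> \<tau> \<in> K" if "c \<tau> \<noteq> 0" for \<tau>
  proof -
    have "e (f ` \<tau>) \<noteq> 0" using that by (simp add: c_def)
    then have "finite (f ` \<tau>)" "f ` \<tau> \<in> (`) f ` K"
      using fchains_imp_finite[OF assms(2)] fchains_imp_in[OF assms(2)] by blast+
    then show ?thesis using assms(1) by (auto simp: inj_image_eq_iff finite_image_iff inj_on_def inj_def)
  qed
  ultimately have "c \<in> fchains K" by (simp add: fchains_def)
  then show ?thesis using that e by blast
qed

lemma acyclic_chains_image:
  assumes f: "inj f" and K: "acyclic_chains K"
  shows "acyclic_chains ((`) f ` K)"
  unfolding acyclic_chains_def
proof (intro ballI impI)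
  fix e assume e: "e \<in> fchains ((`) f ` K)" "bd e = 0"
  obtain c where c: "c \<in> fchains K" "e = push f c" using fchains_image[OF f e(1)] .
  have "push f (bd c) = push f 0" using e(2) bd_push[OF f c(1)] c(2) by simp
  then have "bd c = 0" by (rule push_inject[OF f])
  then obtain d where d: "d \<in> fchains K" "bd d = c" using K c(1) unfolding acyclic_chains_def by blast
  have "bd (push f d) = e" using bd_push[OF f d(1)] d(2) c(2) by simp
  then show "\<exists>d\<in>fchains ((`) f ` K). bd d = e" using push_in_fchains[OF f d(1)] by blast
qed

section \<open>Vietoris-Rips complexes of star-shaped sets of points\<close>

definition l1_dist :: "'a set \<Rightarrow> ('a \<Rightarrow> real) \<Rightarrow> ('a \<Rightarrow> real) \<Rightarrow> real" where
  "l1_dist V x y = (\<Sum>v\<in>V. \<bar>x v - y v\<bar>)"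

definition vietoris_rips :: "'a set \<Rightarrow> ('a \<Rightarrow> real) set \<Rightarrow> real \<Rightarrow> ('a \<Rightarrow> real) set set" where
  "vietoris_rips V C \<delta> = {P. finite P \<and> P \<subseteq> C \<and> (\<forall>x\<in>P. \<forall>y\<in>P. l1_dist V x y < \<delta>)}"

definition contraction :: "('a \<Rightarrow> real) \<Rightarrow> real \<Rightarrow> ('a \<Rightarrow> real) \<Rightarrow> 'a \<Rightarrow> real" where
  "contraction b s x = (\<lambda>v. (1 - s) * x v + s * b v)"

lemma l1_dist_self [simp]: "l1_dist V x x = 0"
  by (simp add: l1_dist_def)

lemma l1_dist_nonneg: "0 \<le> l1_dist V x y"
  by (simp add: l1_dist_def sum_nonneg)

lemma l1_dist_commute: "l1_dist V x y = l1_dist V y x"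
  by (simp add: l1_dist_def abs_minus_commute)

lemma l1_dist_triangle: "l1_dist V x z \<le> l1_dist V x y + l1_dist V y z"
  unfolding l1_dist_def sum.distrib[symmetric] by (intro sum_mono) linarith

lemma abs_diff_le_l1_dist: "finite V \<Longrightarrow> v \<in> V \<Longrightarrow> \<bar>x v - y v\<bar> \<le> l1_dist V x y"
  unfolding l1_dist_def by (rule member_le_sum) auto

lemma l1_dist_contraction:
  assumes "s \<le> 1"
  shows "l1_dist V (contraction b s x) (contraction b s y) = (1 - s) * l1_dist V x y"
proof -
  have "contraction b s x v - contraction b s y v = (1 - s) * (x v - y v)" for v
    by (simp add: contraction_def algebra_simps)
  then show ?thesis using assms by (simp add: l1_dist_def abs_mult sum_distrib_left)
qed

lemma contraction_center [simp]: "contraction b s b = b"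
  by (rule ext) (simp add: contraction_def algebra_simps)

lemma l1_dist_contraction_self:
  assumes "0 \<le> s"
  shows "l1_dist V x (contraction b s x) = s * l1_dist V x b"
proof -
  have "x v - contraction b s x v = s * (x v - b v)" for v
    by (simp add: contraction_def algebra_simps)
  then show ?thesis using assms by (simp add: l1_dist_def abs_mult sum_distrib_left)
qed

lemma down_closed_vietoris_rips: "down_closed (vietoris_rips V C \<delta>)"
  unfolding down_closed_def vietoris_rips_def by (auto intro: finite_subset)

text \<open>A cycle has finitely many edges, all shorter than some \<open>\<eta> < \<delta>\<close>. This slack allows contracting it by a
  fixed factor without leaving the complex, again and again until it can be coned off from \<open>b\<close>.\<close>

lemma acyclic_vietoris_rips:
  assumes b: "b \<in> C" and star: "\<And>x s. x \<in> C \<Longrightarrow> 0 \<le> s \<Longrightarrow> s \<le> 1 \<Longrightarrow> contraction b s x \<in> C"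
    and sep: "\<And>x. x \<in> C \<Longrightarrow> l1_dist V x b = 0 \<Longrightarrow> x = b"
    and bound: "\<And>x. x \<in> C \<Longrightarrow> l1_dist V x b \<le> M"
    and \<delta>: "0 < \<delta>"
  shows "acyclic_chains (vietoris_rips V C \<delta>)"
  unfolding acyclic_chains_def
proof (intro ballI impI)
  let ?K = "vietoris_rips V C \<delta>"
  let ?d = "l1_dist V"
  fix z assume z: "z \<in> fchains ?K" "bd z = 0"
  have zK: "finite \<sigma> \<and> \<sigma> \<subseteq> C \<and> (\<forall>x\<in>\<sigma>. \<forall>y\<in>\<sigma>. ?d x y < \<delta>)" if "z \<sigma> \<noteq> 0" for \<sigma>
    using fchains_imp_in[OF z(1) that] by (simp add: vietoris_rips_def)
  have M: "0 \<le> M" using bound[OF b] by simp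
  \<comment> \<open>Inserting 0 makes the maximum meaningful for the zero cycle and for cycles
    without vertices.\<close>
  define E where "E = insert 0 (\<Union>\<sigma>\<in>supp z. (\<lambda>(x, y). ?d x y) ` (\<sigma> \<times> \<sigma>))"
  have finE: "finite E"
    unfolding E_def using z(1) zK by (auto simp: fchains_def)
  define \<eta> where "\<eta> = Max E"
  have "\<eta> \<in> E" unfolding \<eta>_def by (rule Max_in[OF finE]) (simp add: E_def)
  then have \<eta>: "\<eta> < \<delta>" using \<delta> zK by (auto simp: E_def)
  have \<eta>0: "0 \<le> \<eta>" unfolding \<eta>_def by (rule Max_ge[OF finE]) (simp add: E_def)
  have \<eta>_ge: "?d x y \<le> \<eta>" if "z \<sigma> \<noteq> 0" "x \<in> \<sigma>" "y \<in> \<sigma>" for x y \<sigma>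
    unfolding \<eta>_def by (rule Max_ge[OF finE]) (use that in \<open>auto simp: E_def\<close>)
  \<comment> \<open>A point moves by at most \<open>s * M\<close>, which must stay below the slack
    \<open>\<delta> - \<eta>\<close>. The summand 1 in the denominator covers \<open>M = 0\<close>,
    and the bound 1/2 makes \<open>s\<close> a legitimate parameter of the contraction.\<close>
  define s where "s = min (1/2) ((\<delta> - \<eta>) / (2 * (M + 1)))"
  have s: "0 < s" "s \<le> 1" using \<eta> M by (auto simp: s_def)
  have sM: "s * M < \<delta> - \<eta>"
  proof -
    have "s * M \<le> (\<delta> - \<eta>) / (2 * (M + 1)) * M"
      using M by (intro mult_right_mono) (auto simp: s_def)
    also have "\<dots> = (\<delta> - \<eta>) * (M / (2 * (M + 1)))" by simp
    also have "\<dots> < (\<delta> - \<eta>) * 1"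
      using M \<eta> by (intro mult_strict_left_mono) (auto simp: field_simps)
    finally have "s * M < (\<delta> - \<eta>) * 1" .
    then show ?thesis by simp
  qed
  let ?f = "contraction b s"
  \<comment> \<open>The contraction shortens all distances by the factor \<open>1 - s\<close>, so
    the edge bound \<eta>, and with it the admissible \<open>s\<close>, survives every round, while
    the distance to \<open>b\<close> decays geometrically.\<close>
  have step: "\<exists>d\<in>fchains ?K. \<forall>\<sigma>. (z + bd d) \<sigma> \<noteq> 0 \<longrightarrow>
      finite \<sigma> \<and> \<sigma> \<subseteq> C \<and> (\<forall>x\<in>\<sigma>. \<forall>y\<in>\<sigma>. ?d x y \<le> \<eta>) \<and> (\<forall>x\<in>\<sigma>. ?d x b \<le> (1 - s) ^ k * M)" for k
  proof (induction k)
    case 0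
    have eq: "z + bd 0 = z" by (simp only: bd_0 add_0_right)
    have small: "finite \<sigma> \<and> \<sigma> \<subseteq> C \<and> (\<forall>x\<in>\<sigma>. \<forall>y\<in>\<sigma>. ?d x y \<le> \<eta>) \<and>
      (\<forall>x\<in>\<sigma>. ?d x b \<le> (1 - s) ^ 0 * M)" if \<sigma>: "z \<sigma> \<noteq> 0" for \<sigma>
    proof -
      have "?d x b \<le> (1 - s) ^ 0 * M" if "x \<in> \<sigma>" for x
        using bound[of x] zK[OF \<sigma>] that by auto
      then show ?thesis using zK[OF \<sigma>] \<eta>_ge[OF \<sigma>] by blast
    qed
    show ?case
      by (rule bexI[OF _ fchains_0]) (unfold eq, intro allI impI, erule small)
  next
    case (Suc k)
    then obtain d where d: "d \<in> fchains ?K" and small: "\<And>\<sigma>. (z + bd d) \<sigma> \<noteq> 0 \<Longrightarrow>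
        finite \<sigma> \<and> \<sigma> \<subseteq> C \<and> (\<forall>x\<in>\<sigma>. \<forall>y\<in>\<sigma>. ?d x y \<le> \<eta>) \<and> (\<forall>x\<in>\<sigma>. ?d x b \<le> (1 - s) ^ k * M)"
      by blast
    have bdd: "bd d \<in> fchains ?K" using d down_closed_vietoris_rips by (rule bd_in_fchains)
    have z': "z + bd d \<in> fchains ?K" using z(1) bdd by (rule fchains_add)
    have bz': "bd (z + bd d) = 0" using bd_add[OF z(1) bdd] bd_bd[OF d] z(2) by simp
    have contig: "\<sigma> \<union> ?f ` \<sigma> \<in> ?K" if "(z + bd d) \<sigma> \<noteq> 0" for \<sigma>
    proof -
      note sm = small[OF that]
      have xx: "?d x y \<le> \<eta>" if "x \<in> \<sigma>" "y \<in> \<sigma>" for x y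
        using sm that by blast
      have xy: "?d x (?f y) < \<delta>" if "x \<in> \<sigma>" "y \<in> \<sigma>" for x y
      proof -
        have "?d x (?f y) \<le> ?d x y + ?d y (?f y)" by (rule l1_dist_triangle)
        also have "?d y (?f y) = s * ?d y b" using s by (simp add: l1_dist_contraction_self)
        also have "\<dots> \<le> s * M" using bound sm that s by (intro mult_left_mono) auto
        finally show ?thesis using xx[OF that] sM by linarith
      qed
      have ff: "?d (?f x) (?f y) < \<delta>" if "x \<in> \<sigma>" "y \<in> \<sigma>" for x y
      proof -
        have "(1 - s) * ?d x y \<le> 1 * ?d x y" using s l1_dist_nonneg by (intro mult_right_mono) auto
        then show ?thesis
          using xx[OF that] \<eta> unfolding l1_dist_contraction[OF s(2)] by linarith
      qed
      have xx': "?d x y < \<delta>" if "x \<in> \<sigma>" "y \<in> \<sigma>" for x y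
        using xx[OF that] \<eta> by linarith
      have "?f x \<in> C" if "x \<in> \<sigma>" for x using sm that star s by (meson less_imp_le subsetD)
      then have "?f ` \<sigma> \<subseteq> C" by blast
      moreover have "?d u w < \<delta>" if "u \<in> \<sigma> \<union> ?f ` \<sigma>" "w \<in> \<sigma> \<union> ?f ` \<sigma>" for u w
        using that by (elim UnE imageE) (simp_all add: xx' xy ff l1_dist_commute[of V "?f _" w])
      ultimately show ?thesis using sm by (simp add: vietoris_rips_def)
    qed
    \<comment> \<open>By \<open>sep\<close> every vertex other than \<open>b\<close> has positive
      distance to \<open>b\<close>, so moving it strictly decreases that distance.\<close>
    have rank: "?d (?f x) b < ?d x b" if x: "x \<in> \<Union>(supp (z + bd d))" "?f x \<noteq> x" for x
    proof -
      obtain \<sigma> where "x \<in> \<sigma>" "\<sigma> \<in> supp (z + bd d)" using x(1) by (rule UnionE)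
      then have "x \<in> C" using small[of \<sigma>] unfolding supp_iff by blast
      moreover have "x \<noteq> b" using x(2) by (metis contraction_center)
      ultimately have "?d x b \<noteq> 0" using sep by blast
      then have "0 < ?d x b" using l1_dist_nonneg[of V x b] by linarith
      then have "(1 - s) * ?d x b < 1 * ?d x b" using s by (intro mult_strict_right_mono) auto
      then show ?thesis using l1_dist_contraction[OF s(2), of V b x b] by simp
    qed
    obtain e where e: "e \<in> fchains ?K"
      "\<And>\<sigma>. (z + bd d + bd e) \<sigma> \<noteq> 0 \<Longrightarrow> \<exists>\<rho>. (z + bd d) \<rho> \<noteq> 0 \<and> \<sigma> = ?f ` \<rho>"
    proof (rule deform_cycle[OF z' bz' down_closed_vietoris_rips, where f = ?f and r = "\<lambda>x. ?d x b"])
      show "\<sigma> \<union> ?f ` \<sigma> \<in> ?K" if "(z + bd d) \<sigma> \<noteq> 0" for \<sigma>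
        using that by (rule contig)
      show "?d (?f x) b < ?d x b" if "x \<in> \<Union>(supp (z + bd d))" "?f x \<noteq> x" for x
        using that by (rule rank)
    qed (rule that)
    have "finite \<sigma> \<and> \<sigma> \<subseteq> C \<and> (\<forall>x\<in>\<sigma>. \<forall>y\<in>\<sigma>. ?d x y \<le> \<eta>) \<and> (\<forall>x\<in>\<sigma>. ?d x b \<le> (1 - s) ^ Suc k * M)"
      if \<sigma>: "(z + bd (d + e)) \<sigma> \<noteq> 0" for \<sigma>
    proof -
      have "(z + bd d + bd e) \<sigma> \<noteq> 0" using \<sigma> unfolding bd_add[OF d e(1)] add.assoc .
      then obtain \<rho> where \<rho>: "(z + bd d) \<rho> \<noteq> 0" "\<sigma> = ?f ` \<rho>" using e(2) by blast
      note sm = small[OF \<rho>(1)]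
      have "?d (?f x) (?f y) \<le> \<eta>" if "x \<in> \<rho>" "y \<in> \<rho>" for x y
      proof -
        have "(1 - s) * ?d x y \<le> 1 * ?d x y" using s l1_dist_nonneg by (intro mult_right_mono) auto
        moreover have "?d x y \<le> \<eta>" using sm that by blast
        ultimately show ?thesis unfolding l1_dist_contraction[OF s(2)] by linarith
      qed
      moreover have "?d (?f x) b \<le> (1 - s) ^ Suc k * M" if "x \<in> \<rho>" for x
      proof -
        have "?d x b \<le> (1 - s) ^ k * M" using sm that by blast
        then have "(1 - s) * ?d x b \<le> (1 - s) * ((1 - s) ^ k * M)"
          using s by (intro mult_left_mono) auto
        then show ?thesis using l1_dist_contraction[OF s(2), of V b x b] by (simp add: mult.assoc)
      qed
      moreover have "?f x \<in> C" if "x \<in> \<rho>" for x using sm that star s by (meson less_imp_le subsetD)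
      ultimately show ?thesis using sm unfolding \<rho>(2) by blast
    qed
    moreover have "d + e \<in> fchains ?K" using d e(1) by (rule fchains_add)
    ultimately show ?case by blast
  qed
  have "(\<lambda>k. (1 - s) ^ k * M) \<longlonglongrightarrow> 0 * M"
    using s by (intro tendsto_mult LIMSEQ_realpow_zero tendsto_const) auto
  then have "\<forall>\<^sub>F k in sequentially. (1 - s) ^ k * M < \<delta>"
    using \<delta> by (intro order_tendstoD) auto
  then obtain k where k: "(1 - s) ^ k * M < \<delta>" by (auto simp: eventually_sequentially)
  obtain d where d: "d \<in> fchains ?K" and small: "\<And>\<sigma>. (z + bd d) \<sigma> \<noteq> 0 \<Longrightarrow>
      finite \<sigma> \<and> \<sigma> \<subseteq> C \<and> (\<forall>x\<in>\<sigma>. \<forall>y\<in>\<sigma>. ?d x y \<le> \<eta>) \<and> (\<forall>x\<in>\<sigma>. ?d x b \<le> (1 - s) ^ k * M)"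
    using step[of k] by blast
  have bdd: "bd d \<in> fchains ?K" using d down_closed_vietoris_rips by (rule bd_in_fchains)
  have z': "z + bd d \<in> fchains ?K" using z(1) bdd by (rule fchains_add)
  have bz': "bd (z + bd d) = 0" using bd_add[OF z(1) bdd] bd_bd[OF d] z(2) by simp
  \<comment> \<open>By the choice of \<open>k\<close> all vertices are now closer to
    \<open>b\<close> than \<delta>, so \<open>b\<close> can be joined to every simplex of the
    cycle.\<close>
  have cK: "cone b (z + bd d) \<in> fchains ?K"
  proof (rule cone_in_fchains[OF z'])
    fix \<sigma> assume "\<sigma> \<in> supp (z + bd d)"
    then have "(z + bd d) \<sigma> \<noteq> 0" by (simp only: supp_iff not_False_eq_True)
    note sm = small[OF this]
    have xb: "?d x b < \<delta>" if "x \<in> \<sigma>" for x using sm that k by (meson le_less_trans)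
    have bx: "?d b x < \<delta>" if "x \<in> \<sigma>" for x using xb[OF that] unfolding l1_dist_commute[of V b] .
    have xy: "?d x y < \<delta>" if "x \<in> \<sigma>" "y \<in> \<sigma>" for x y
      using sm that \<eta> by (meson le_less_trans)
    show "insert b \<sigma> \<in> ?K" using sm b \<delta> by (simp add: vietoris_rips_def bx xb xy)
  qed
  have "bd (d + cone b (z + bd d)) = z"
    unfolding bd_add[OF d cK] bd_cone[OF z'] bz' by (simp add: add.left_commute add.commute)
  then show "\<exists>e\<in>fchains ?K. bd e = z" using fchains_add[OF d cK] by blast
qed

section \<open>Geometric realizations\<close>

text \<open>The underlying set of \<open>realization X\<close>, separated from the topology so that
  compactness and continuity on subsets of a function type become available.\<close>

definition points :: "'a set set \<Rightarrow> ('a \<Rightarrow> real) set" where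
  "points X = {x. (\<forall>v. 0 \<le> x v) \<and> {v. x v \<noteq> 0} \<in> X \<and> (\<Sum>v | x v \<noteq> 0. x v) = 1}"

lemma realization_eq: "realization X = top_of_set (points X)"
  unfolding realization_def points_def euclidean_product_topology ..

lemma points_sum:
  assumes "x \<in> points X" "abstract_complex X" "finite V" "\<Union>X \<subseteq> V"
  shows "sum x V = 1"
proof -
  have x: "{v. x v \<noteq> 0} \<in> X" "(\<Sum>v | x v \<noteq> 0. x v) = 1" using assms(1) by (auto simp: points_def)
  have "sum x V = (\<Sum>v | x v \<noteq> 0. x v)"
    using assms x(1) by (intro sum.mono_neutral_right) auto
  then show ?thesis using x(2) by simp
qed

lemma pointsI:
  assumes "\<And>v. 0 \<le> x v" "{v. x v \<noteq> 0} \<in> X" "finite V" "\<Union>X \<subseteq> V" "sum x V = 1"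
  shows "x \<in> points X"
proof -
  have "sum x V = (\<Sum>v | x v \<noteq> 0. x v)"
    using assms by (intro sum.mono_neutral_right) auto
  then show ?thesis using assms by (simp add: points_def)
qed

text \<open>A finite union of closed simplices, each a closed subset of a power of the unit
  interval. That power is compact by Tychonoff even if the type of vertices is infinite.\<close>

lemma compact_points:
  assumes X: "finite X" "abstract_complex X"
  shows "compact (points X)"
proof -
  let ?I = "{x :: 'a \<Rightarrow> real. \<forall>v. x v \<in> {0..1}}"
  let ?C = "\<lambda>\<sigma>. ?I \<inter> ({x. \<forall>v. v \<notin> \<sigma> \<longrightarrow> x v = 0} \<inter> {x. sum x \<sigma> = 1})"
  have fin: "finite \<sigma>" if "\<sigma> \<in> X" for \<sigma> using X(2) that by (auto simp: abstract_complex_def)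
  have "compactin (product_topology (\<lambda>_::'a. euclideanreal) UNIV) (PiE UNIV (\<lambda>_. {0..1}))"
    by (simp add: compactin_PiE)
  moreover have "PiE UNIV (\<lambda>_::'a. {0..1::real}) = ?I" by (auto simp: PiE_def)
  ultimately have I: "compact ?I" by (simp add: euclidean_product_topology)
  have coord: "continuous_on UNIV (\<lambda>x :: 'a \<Rightarrow> real. x v)" for v
    by (rule continuous_on_product_coordinates)
  have C: "compact (?C \<sigma>)" for \<sigma>
  proof (intro compact_Int_closed[OF I] closed_Int)
    have "{x :: 'a \<Rightarrow> real. \<forall>v. v \<notin> \<sigma> \<longrightarrow> x v = 0} = (\<Inter>v\<in>- \<sigma>. {x. x v = 0})" by auto
    moreover have "closed {x :: 'a \<Rightarrow> real. x v = 0}" for v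
      by (rule closed_Collect_eq[OF coord continuous_on_const])
    ultimately show "closed {x :: 'a \<Rightarrow> real. \<forall>v. v \<notin> \<sigma> \<longrightarrow> x v = 0}" by (simp add: closed_INT)
    show "closed {x :: 'a \<Rightarrow> real. sum x \<sigma> = 1}"
      by (intro closed_Collect_eq continuous_on_sum coord continuous_on_const)
  qed
  have eq: "points X = (\<Union>\<sigma>\<in>X. ?C \<sigma>)"
  proof (intro equalityI subsetI)
    fix x assume x: "x \<in> points X"
    let ?s = "{v. x v \<noteq> 0}"
    have s: "?s \<in> X" "\<And>v. 0 \<le> x v" "sum x ?s = 1" using x by (auto simp: points_def)
    have "x v \<le> 1" for v
    proof (cases "x v = 0")
      case False
      then have "x v \<le> sum x ?s" using s fin[OF s(1)] by (intro member_le_sum) auto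
      then show ?thesis using s(3) by simp
    qed simp
    then have "x \<in> ?C ?s" using s by simp
    then show "x \<in> (\<Union>\<sigma>\<in>X. ?C \<sigma>)" using s(1) by blast
  next
    fix x assume "x \<in> (\<Union>\<sigma>\<in>X. ?C \<sigma>)"
    then obtain \<sigma> where \<sigma>: "\<sigma> \<in> X" "\<And>v. 0 \<le> x v" "\<And>v. v \<notin> \<sigma> \<Longrightarrow> x v = 0" "sum x \<sigma> = 1"
      by auto
    have sub: "{v. x v \<noteq> 0} \<subseteq> \<sigma>" using \<sigma>(3) by blast
    have eq: "sum x {v. x v \<noteq> 0} = sum x \<sigma>"
      using sub fin[OF \<sigma>(1)] by (intro sum.mono_neutral_left) auto
    then have "{v. x v \<noteq> 0} \<noteq> {}" using \<sigma>(4) by (metis sum.empty zero_neq_one)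
    then have "{v. x v \<noteq> 0} \<in> X" using sub \<sigma>(1) X(2) unfolding abstract_complex_def by blast
    then show "x \<in> points X" using \<sigma> eq by (simp add: points_def)
  qed
  show ?thesis unfolding eq by (rule compact_UN[OF X(1)]) (rule C)
qed

lemma continuous_on_l1_dist:
  assumes "continuous_on S f" "continuous_on S g"
  shows "continuous_on S (\<lambda>x. l1_dist V (f x) (g x))"
  unfolding l1_dist_def
  by (intro continuous_on_sum continuous_on_rabs continuous_on_diff
      assms[THEN continuous_on_product_then_coordinatewise])

text \<open>\<open>l1_dist V\<close> sees only the coordinates in \<open>V\<close> and is assumed to
  separate points only within \<open>S\<close>, so uniform continuity is derived by hand. On the
  compact set \<open>T\<close> of pairs whose images are at least \<epsilon> apart, the distance
  \<open>D\<close> of the arguments is continuous and positive; its minimum is the required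
  \<delta>.\<close>

lemma homotopy_uniformly_continuous:
  fixes S :: "('a \<Rightarrow> real) set"
  assumes S: "compact S" and h: "continuous_on ({0..1} \<times> S) h"
    and sep: "\<And>x y. x \<in> S \<Longrightarrow> y \<in> S \<Longrightarrow> l1_dist V x y = 0 \<Longrightarrow> x = y" and \<epsilon>: "0 < \<epsilon>"
  obtains \<delta> :: real where "0 < \<delta>"
    "\<And>s t x y. s \<in> {0..1} \<Longrightarrow> t \<in> {0..1} \<Longrightarrow> x \<in> S \<Longrightarrow> y \<in> S \<Longrightarrow>
       \<bar>s - t\<bar> + l1_dist V x y < \<delta> \<Longrightarrow> l1_dist V (h (s, x)) (h (t, y)) < \<epsilon>"
proof -
  let ?K = "({0..1::real} \<times> S) \<times> ({0..1::real} \<times> S)"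
  define F where "F = (\<lambda>pq. l1_dist V (h (fst pq)) (h (snd pq)))"
  define D where "D = (\<lambda>pq::(real \<times> ('a \<Rightarrow> real)) \<times> (real \<times> ('a \<Rightarrow> real)).
    \<bar>fst (fst pq) - fst (snd pq)\<bar> + l1_dist V (snd (fst pq)) (snd (snd pq)))"
  define T where "T = ?K \<inter> F -` {\<epsilon>..}"
  have K: "compact ?K" by (intro compact_Times S compact_Icc)
  have contF: "continuous_on ?K F" unfolding F_def
    by (intro continuous_on_l1_dist continuous_on_compose2[OF h] continuous_on_fst
        continuous_on_snd continuous_on_id) auto
  have "closedin (top_of_set ?K) T" unfolding T_def
    by (rule continuous_closedin_preimage[OF contF closed_atLeast])
  then have T: "compact T" by (rule closedin_compact[OF K])
  have contD: "continuous_on T D" unfolding D_def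
    by (intro continuous_on_add continuous_on_rabs continuous_on_diff continuous_on_l1_dist
        continuous_on_fst continuous_on_snd continuous_on_id)
  have far: "F (p, q) < \<epsilon>" if "p \<in> {0..1} \<times> S" "q \<in> {0..1} \<times> S" "(p, q) \<notin> T" for p q
    using that by (auto simp: T_def)
  show ?thesis
  proof (cases "T = {}")
    case True
    show ?thesis
    proof (rule that[of 1])
      fix s t x y assume "s \<in> {0..1::real}" "t \<in> {0..1::real}" "x \<in> S" "y \<in> S"
      then show "l1_dist V (h (s, x)) (h (t, y)) < \<epsilon>"
        using far[of "(s, x)" "(t, y)"] True by (simp add: F_def)
    qed simp
  next
    case False
    obtain pq where pq: "pq \<in> T" "\<And>rs. rs \<in> T \<Longrightarrow> D pq \<le> D rs"
      using continuous_attains_inf[OF T False contD] by blast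
    have "D pq \<noteq> 0"
    proof
      assume D0: "D pq = 0"
      obtain s x t y where st: "pq = ((s, x), (t, y))" by (metis surj_pair)
      have xy: "x \<in> S" "y \<in> S" and "F pq \<ge> \<epsilon>" using pq(1) by (auto simp: T_def st)
      have "\<bar>s - t\<bar> + l1_dist V x y = 0" using D0 by (simp add: D_def st)
      then have "\<bar>s - t\<bar> = 0 \<and> l1_dist V x y = 0" using l1_dist_nonneg[of V x y] by linarith
      then have "s = t" "x = y" using sep[OF xy] by auto
      then have "F pq = 0" by (simp add: F_def st)
      then show False using \<open>F pq \<ge> \<epsilon>\<close> \<epsilon> by simp
    qed
    moreover have "0 \<le> D pq" by (simp add: D_def l1_dist_nonneg)
    ultimately have "0 < D pq" by simp
    then show ?thesis
    proof (rule that)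
      fix s t x y assume *: "s \<in> {0..1::real}" "t \<in> {0..1::real}" "x \<in> S" "y \<in> S"
        "\<bar>s - t\<bar> + l1_dist V x y < D pq"
      then have "((s, x), (t, y)) \<notin> T" using pq(2) by (fastforce simp: D_def)
      then show "l1_dist V (h (s, x)) (h (t, y)) < \<epsilon>"
        using far[of "(s, x)" "(t, y)"] * by (simp add: F_def)
    qed
  qed
qed

lemma points_eqI:
  assumes "x \<in> points X" "y \<in> points X" "finite V" "\<Union>X \<subseteq> V" "l1_dist V x y = 0"
  shows "x = y"
proof
  fix v
  show "x v = y v"
  proof (cases "v \<in> V")
    case True
    have "\<bar>x v - y v\<bar> \<le> 0"
      using abs_diff_le_l1_dist[OF assms(3) True, of x y] unfolding assms(5) .
    then show ?thesis by simp
  next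
    case False
    have "z v = 0" if z: "z \<in> points X" for z
    proof (rule ccontr)
      assume "z v \<noteq> 0"
      moreover have "{v. z v \<noteq> 0} \<in> X" using z by (simp add: points_def)
      ultimately have "v \<in> \<Union>X" by blast
      then show False using False assms(4) by blast
    qed
    then show ?thesis using assms(1,2) by metis
  qed
qed

lemma l1_dist_points_le:
  assumes "x \<in> points X" "y \<in> points X" "abstract_complex X" "finite V" "\<Union>X \<subseteq> V"
  shows "l1_dist V x y \<le> 2"
proof -
  have "l1_dist V x y \<le> (\<Sum>v\<in>V. x v + y v)" unfolding l1_dist_def
  proof (rule sum_mono)
    fix v
    have "0 \<le> x v" "0 \<le> y v" using assms(1,2) by (simp_all add: points_def)
    then show "\<bar>x v - y v\<bar> \<le> x v + y v" by linarith
  qed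
  also have "\<dots> = 2" using points_sum[OF _ assms(3-5)] assms(1,2) by (simp add: sum.distrib)
  finally show ?thesis .
qed

section \<open>Stars and mapping cylinders\<close>

lemma down_closedD: "down_closed K \<Longrightarrow> \<sigma> \<in> K \<Longrightarrow> \<tau> \<subseteq> \<sigma> \<Longrightarrow> \<tau> \<in> K"
  by (auto simp: down_closed_def)

text \<open>The largest complex on both kinds of vertices from which the identity together with
  \<open>g\<close> is a simplicial map to \<open>K\<close>. The points carry no simplicial structure
  of their own, so \<open>g\<close> may be any function.\<close>

definition mapping_cylinder :: "'a set set \<Rightarrow> ('p \<Rightarrow> 'a) \<Rightarrow> ('a + 'p) set set" where
  "mapping_cylinder K g = {\<rho>. Inl -` \<rho> \<union> g ` (Inr -` \<rho>) \<in> K}"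

lemma down_closed_mapping_cylinder:
  assumes "down_closed K"
  shows "down_closed (mapping_cylinder K g)"
  unfolding down_closed_def mapping_cylinder_def
proof (intro ballI allI impI CollectI)
  fix \<sigma> \<tau> :: "('a + 'b) set"
  assume "\<sigma> \<in> {\<rho>. Inl -` \<rho> \<union> g ` (Inr -` \<rho>) \<in> K}" "\<tau> \<subseteq> \<sigma>"
  moreover have "Inl -` \<tau> \<union> g ` (Inr -` \<tau>) \<subseteq> Inl -` \<sigma> \<union> g ` (Inr -` \<sigma>)"
    using \<open>\<tau> \<subseteq> \<sigma>\<close> by blast
  ultimately show "Inl -` \<tau> \<union> g ` (Inr -` \<tau>) \<in> K"
    using assms unfolding down_closed_def by blast
qed

lemma Inl_part_eq:
  fixes \<rho> :: "('a + 'b) set"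
  assumes "\<rho> \<inter> range Inr = {}"
  shows "\<rho> = Inl ` (Inl -` \<rho>)" "Inr -` \<rho> = {}"
proof -
  show "Inr -` \<rho> = {}" using assms by blast
  show "\<rho> = Inl ` (Inl -` \<rho>)"
  proof (intro equalityI subsetI)
    fix x assume "x \<in> \<rho>"
    then show "x \<in> Inl ` (Inl -` \<rho>)" using assms by (cases x) auto
  qed auto
qed

lemma Inr_part_eq:
  fixes \<rho> :: "('a + 'b) set"
  assumes "\<rho> \<inter> range Inl = {}"
  shows "\<rho> = Inr ` (Inr -` \<rho>)" "Inl -` \<rho> = {}"
proof -
  show "Inl -` \<rho> = {}" using assms by blast
  show "\<rho> = Inr ` (Inr -` \<rho>)"
  proof (intro equalityI subsetI)
    fix x assume "x \<in> \<rho>"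
    then show "x \<in> Inr ` (Inr -` \<rho>)" using assms by (cases x) auto
  qed auto
qed

lemma Inl_vimage_Inr_image [simp]: "Inl -` Inr ` A = {}"
  and Inr_vimage_Inl_image [simp]: "Inr -` Inl ` B = {}"
  and Inl_vimage_Inl_image [simp]: "Inl -` Inl ` B = B"
  and Inr_vimage_Inr_image [simp]: "Inr -` Inr ` A = A"
  by auto

text \<open>If \<tau> consists of points and contains \<open>p\<close>, adding the vertex
  \<open>g p\<close> changes nothing in the image in \<open>K\<close>; the link of \<tau> is
  therefore a cone with apex \<open>g p\<close>.\<close>

lemma rel_acyclic_mapping_cylinder:
  fixes g :: "'p \<Rightarrow> 'a"
  assumes K: "down_closed K"
  shows "rel_acyclic (mapping_cylinder K g) ((`) Inl ` K)"
proof -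
  let ?M = "mapping_cylinder K g"
  have "{\<rho>\<in>?M. \<rho> \<inter> range Inr = {}} = (`) Inl ` K"
  proof (intro equalityI subsetI)
    fix \<rho> assume "\<rho> \<in> {\<rho>\<in>?M. \<rho> \<inter> range Inr = {}}"
    then have \<rho>: "\<rho> \<in> ?M" "\<rho> \<inter> range Inr = {}" by blast+
    note eq = Inl_part_eq[OF \<rho>(2)]
    have "Inl -` \<rho> \<in> K" using \<rho>(1) by (simp add: mapping_cylinder_def eq(2))
    then show "\<rho> \<in> (`) Inl ` K" using eq(1) by blast
  next
    fix \<rho> :: "('a + 'p) set" assume "\<rho> \<in> (`) Inl ` K"
    then show "\<rho> \<in> {\<rho>\<in>?M. \<rho> \<inter> range Inr = {}}" by (auto simp: mapping_cylinder_def)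
  qed
  moreover have "rel_acyclic ?M {\<rho>\<in>?M. \<rho> \<inter> range Inr = {}}"
  proof (rule rel_acyclic_join[OF down_closed_mapping_cylinder[OF K]])
    fix \<tau> :: "('a + 'p) set"
    assume \<tau>: "\<tau> \<noteq> {}" "\<tau> \<subseteq> range Inr"
    then obtain p where p: "Inr p \<in> \<tau>" by blast
    show "acyclic_chains {\<rho>. \<rho> \<inter> range Inr = {} \<and> \<rho> \<union> \<tau> \<in> ?M}"
    proof (rule acyclic_chains_cone[where w = "Inl (g p)"])
      fix \<rho> assume \<rho>: "\<rho> \<in> {\<rho>. \<rho> \<inter> range Inr = {} \<and> \<rho> \<union> \<tau> \<in> ?M}"
      have "Inl -` (insert (Inl (g p)) \<rho> \<union> \<tau>) \<union> g ` (Inr -` (insert (Inl (g p)) \<rho> \<union> \<tau>))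
          = Inl -` (\<rho> \<union> \<tau>) \<union> g ` (Inr -` (\<rho> \<union> \<tau>))"
        using p by auto
      moreover have "Inl -` (\<rho> \<union> \<tau>) \<union> g ` (Inr -` (\<rho> \<union> \<tau>)) \<in> K"
        using \<rho> unfolding mapping_cylinder_def by blast
      ultimately have "insert (Inl (g p)) \<rho> \<union> \<tau> \<in> ?M"
        unfolding mapping_cylinder_def by (simp only: mem_Collect_eq)
      then show "insert (Inl (g p)) \<rho> \<in> {\<rho>. \<rho> \<inter> range Inr = {} \<and> \<rho> \<union> \<tau> \<in> ?M}"
        using \<rho> by auto
    qed
  qed
  ultimately show ?thesis by simp
qed

section \<open>Closed stars, and passage from vertices to nearby points\<close>

lemma down_closed_complex: "abstract_complex X \<Longrightarrow> down_closed (insert {} X)"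
  unfolding abstract_complex_def down_closed_def by blast

lemma exists_large_coordinate:
  assumes x: "x \<in> points X" and X: "abstract_complex X" "finite V" "\<Union>X \<subseteq> V"
  shows "\<exists>v\<in>V. 1 / real (card V) \<le> x v"
proof (rule ccontr)
  assume "\<not> ?thesis"
  then have small: "x v < 1 / real (card V)" if "v \<in> V" for v using that by force
  have sum1: "sum x V = 1" using points_sum[OF x X] .
  then have "V \<noteq> {}" by auto
  then have "sum x V < (\<Sum>v\<in>V. 1 / real (card V))"
    using X(2) small by (intro sum_strict_mono) auto
  also have "\<dots> = 1" using \<open>V \<noteq> {}\<close> X(2) by simp
  finally show False using sum1 by simp
qed

text \<open>The last hypothesis places \<open>x\<close> in the closed star of \<sigma>. The segment
  from \<open>x\<close> to \<open>b\<close> stays in the simplex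
  \<open>\<sigma> \<union> {v. x v \<noteq> 0}\<close>, so the closed star is star-shaped about
  \<open>b\<close>.\<close>

lemma contraction_in_points:
  assumes x: "x \<in> points X" and b: "b \<in> points X" and s: "0 \<le> s" "s \<le> 1"
    and X: "abstract_complex X" "finite V" "\<Union>X \<subseteq> V"
    and \<sigma>: "{v. b v \<noteq> 0} = \<sigma>" "\<sigma> \<union> {v. x v \<noteq> 0} \<in> X"
  shows "contraction b s x \<in> points X"
    and "\<sigma> \<union> {v. contraction b s x v \<noteq> 0} \<in> X"
proof -
  let ?y = "contraction b s x"
  have nonneg: "0 \<le> x v" "0 \<le> b v" for v using x b by (simp_all add: points_def)
  have y: "0 \<le> ?y v" for v using nonneg s by (simp add: contraction_def)
  have sub: "{v. ?y v \<noteq> 0} \<subseteq> \<sigma> \<union> {v. x v \<noteq> 0}"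
    unfolding \<sigma>(1)[symmetric] contraction_def by auto
  have sums: "sum x V = 1" "sum b V = 1"
    using points_sum[OF x X] points_sum[OF b X] by simp_all
  have "sum ?y V = (1 - s) * sum x V + s * sum b V"
    by (simp add: contraction_def sum.distrib sum_distrib_left)
  also have "\<dots> = 1" by (simp add: sums)
  finally have sum1: "sum ?y V = 1" .
  have "{v. ?y v \<noteq> 0} \<noteq> {}"
  proof
    assume "{v. ?y v \<noteq> 0} = {}"
    then have "?y v = 0" for v by blast
    then show False using sum1 by simp
  qed
  then have "{v. ?y v \<noteq> 0} \<in> X" using sub \<sigma>(2) X(1) unfolding abstract_complex_def by blast
  then show "?y \<in> points X" using y X(2,3) sum1 by (intro pointsI)
  have "\<sigma> \<union> {v. ?y v \<noteq> 0} \<subseteq> \<sigma> \<union> {v. x v \<noteq> 0}" using sub by blast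
  moreover have "\<sigma> \<union> {v. ?y v \<noteq> 0} \<noteq> {}" using \<open>{v. ?y v \<noteq> 0} \<noteq> {}\<close> by blast
  ultimately show "\<sigma> \<union> {v. ?y v \<noteq> 0} \<in> X" using \<sigma>(2) X(1) unfolding abstract_complex_def by blast
qed

lemma barycenter_in_points:
  assumes "\<sigma> \<in> X" "abstract_complex X"
  defines "b \<equiv> \<lambda>v. if v \<in> \<sigma> then 1 / real (card \<sigma>) else 0"
  shows "b \<in> points X" "{v. b v \<noteq> 0} = \<sigma>"
proof -
  have \<sigma>: "finite \<sigma>" "\<sigma> \<noteq> {}" using assms(1,2) by (auto simp: abstract_complex_def)
  then have c: "card \<sigma> \<noteq> 0" by simp
  then show supp: "{v. b v \<noteq> 0} = \<sigma>" by (auto simp: b_def)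
  have "sum b \<sigma> = 1" using c by (simp add: b_def)
  moreover have "\<And>v. 0 \<le> b v" by (simp add: b_def)
  ultimately show "b \<in> points X" using assms(1) unfolding points_def mem_Collect_eq supp by blast
qed

lemma acyclic_vietoris_rips_star:
  assumes \<sigma>: "\<sigma> \<in> X" and X: "abstract_complex X" "finite V" "\<Union>X \<subseteq> V" and \<delta>: "0 < \<delta>"
  shows "acyclic_chains (vietoris_rips V {x\<in>points X. \<sigma> \<union> {v. x v \<noteq> 0} \<in> X} \<delta>)"
proof -
  obtain b where b: "b \<in> points X" "{v. b v \<noteq> 0} = \<sigma>"
    using barycenter_in_points[OF \<sigma> X(1)] by blast
  show ?thesis
  proof (rule acyclic_vietoris_rips[where b = b and M = 2])
    show "b \<in> {x\<in>points X. \<sigma> \<union> {v. x v \<noteq> 0} \<in> X}" using b \<sigma> by simp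
  next
    fix x s assume x: "x \<in> {x\<in>points X. \<sigma> \<union> {v. x v \<noteq> 0} \<in> X}" and s: "0 \<le> s" "s \<le> (1::real)"
    then show "contraction b s x \<in> {x\<in>points X. \<sigma> \<union> {v. x v \<noteq> 0} \<in> X}"
      using contraction_in_points[OF _ b(1) s X b(2)] by blast
  next
    fix x assume "x \<in> {x\<in>points X. \<sigma> \<union> {v. x v \<noteq> 0} \<in> X}" "l1_dist V x b = 0"
    then show "x = b" using points_eqI[OF _ b(1) X(2,3)] by blast
  next
    fix x assume "x \<in> {x\<in>points X. \<sigma> \<union> {v. x v \<noteq> 0} \<in> X}"
    then show "l1_dist V x b \<le> 2" using l1_dist_points_le[OF _ b(1) X] by blast
  qed (rule \<delta>)
qed

text \<open>Connects \<open>X\<close> with finely spaced points of its realization. A simplex of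
  \<open>X\<close> may be joined with a small set of points of its closed star, so its link is the
  Vietoris-Rips complex of that star. The points carry time 0 because they will be moved along the
  homotopy.\<close>

definition star_complex ::
    "'a set set \<Rightarrow> 'a set \<Rightarrow> real \<Rightarrow> ('a + real \<times> ('a \<Rightarrow> real)) set set" where
  "star_complex X V \<delta> = {\<rho>. Inl -` \<rho> \<in> insert {} X \<and>
     (\<exists>P\<in>vietoris_rips V (points X) \<delta>. Inr -` \<rho> = Pair 0 ` P \<and>
        (\<forall>x\<in>P. Inl -` \<rho> \<union> {v. x v \<noteq> 0} \<in> X))}"

lemma star_complexE:
  assumes "\<rho> \<in> star_complex X V \<delta>"
  obtains P where "P \<in> vietoris_rips V (points X) \<delta>" "Inr -` \<rho> = Pair 0 ` P"
    "\<forall>x\<in>P. Inl -` \<rho> \<union> {v. x v \<noteq> 0} \<in> X" "Inl -` \<rho> \<in> insert {} X"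
  using assms unfolding star_complex_def mem_Collect_eq by (elim conjE bexE) (rule that)

lemma star_complexI:
  assumes "P \<in> vietoris_rips V (points X) \<delta>" "Inr -` \<rho> = Pair 0 ` P"
    "\<And>x. x \<in> P \<Longrightarrow> Inl -` \<rho> \<union> {v. x v \<noteq> 0} \<in> X" "Inl -` \<rho> \<in> insert {} X"
  shows "\<rho> \<in> star_complex X V \<delta>"
  unfolding star_complex_def mem_Collect_eq
  by (intro conjI bexI[OF _ assms(1)] ballI assms)

lemma down_closed_star_complex:
  assumes X: "abstract_complex X"
  shows "down_closed (star_complex X V \<delta>)"
  unfolding down_closed_def
proof (intro ballI allI impI)
  fix \<sigma> \<tau> assume \<sigma>Z: "\<sigma> \<in> star_complex X V \<delta>" and sub: "\<tau> \<subseteq> \<sigma>"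
  obtain P where P: "P \<in> vietoris_rips V (points X) \<delta>"
    "Inr -` \<sigma> = Pair 0 ` P" "\<forall>x\<in>P. Inl -` \<sigma> \<union> {v. x v \<noteq> 0} \<in> X" and \<sigma>: "Inl -` \<sigma> \<in> insert {} X"
    using star_complexE[OF \<sigma>Z] .
  define Q where "Q = {x\<in>P. Inr (0, x) \<in> \<tau>}"
  have Q: "Q \<in> vietoris_rips V (points X) \<delta>"
    by (rule down_closedD[OF down_closed_vietoris_rips P(1)]) (auto simp: Q_def)
  have "Inr -` \<tau> \<subseteq> Pair 0 ` P" unfolding P(2)[symmetric] using sub by (rule vimage_mono)
  then have "Inr -` \<tau> = Pair 0 ` Q" unfolding Q_def by auto
  moreover have "Inl -` \<tau> \<in> insert {} X"
    by (rule down_closedD[OF down_closed_complex[OF X] \<sigma> vimage_mono[OF sub]])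
  moreover have "Inl -` \<tau> \<union> {v. x v \<noteq> 0} \<in> X" if x: "x \<in> Q" for x
  proof -
    have "x \<in> P" using x by (simp add: Q_def)
    then have in_X: "Inl -` \<sigma> \<union> {v. x v \<noteq> 0} \<in> X" using P(3) by blast
    have "x \<in> points X" using \<open>x \<in> P\<close> P(1) unfolding vietoris_rips_def by blast
    then have "{v. x v \<noteq> 0} \<in> X" by (simp add: points_def)
    then have "{v. x v \<noteq> 0} \<noteq> {}" using X by (auto simp: abstract_complex_def)
    then have ne: "Inl -` \<tau> \<union> {v. x v \<noteq> 0} \<noteq> {}" by blast
    have "Inl -` \<tau> \<union> {v. x v \<noteq> 0} \<subseteq> Inl -` \<sigma> \<union> {v. x v \<noteq> 0}" using sub by blast
    with down_closed_complex[OF X] in_X have "Inl -` \<tau> \<union> {v. x v \<noteq> 0} \<in> insert {} X"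
      by (metis (no_types) down_closedD insertI2)
    then show ?thesis using ne by (metis (no_types) insertE)
  qed
  ultimately show "\<tau> \<in> star_complex X V \<delta>" by (intro star_complexI[OF Q])
qed

text \<open>Here the vertices of \<open>X\<close> play the role of \<open>B\<close>: cycles are
  pushed off \<open>X\<close> onto points, opposite to the direction in
  \<open>rel_acyclic_mapping_cylinder\<close>.\<close>

lemma rel_acyclic_star_complex:
  assumes X: "abstract_complex X" "finite V" "\<Union>X \<subseteq> V" and \<delta>: "0 < \<delta>"
  shows "rel_acyclic (star_complex X V \<delta>) {\<rho>\<in>star_complex X V \<delta>. \<rho> \<inter> range Inl = {}}"
proof (rule rel_acyclic_join[OF down_closed_star_complex[OF X(1)]])
  let ?Z = "star_complex X V \<delta>"
  let ?i = "Inr \<circ> Pair 0 :: ('a \<Rightarrow> real) \<Rightarrow> 'a + real \<times> ('a \<Rightarrow> real)"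
  fix \<tau> :: "('a + real \<times> ('a \<Rightarrow> real)) set"
  assume "\<tau> \<noteq> {}" "\<tau> \<subseteq> range Inl" "\<tau> \<in> ?Z"
  then obtain \<sigma> where \<tau>: "\<tau> = Inl ` \<sigma>" and "\<sigma> \<noteq> {}" by (auto simp: subset_image_iff)
  have "Inl -` \<tau> \<in> insert {} X" using \<open>\<tau> \<in> ?Z\<close> by (rule star_complexE)
  then have \<sigma>: "\<sigma> \<in> X" using \<open>\<sigma> \<noteq> {}\<close> by (simp add: \<tau>)
  let ?C = "{x\<in>points X. \<sigma> \<union> {v. x v \<noteq> 0} \<in> X}"
  have "{\<rho>. \<rho> \<inter> range Inl = {} \<and> \<rho> \<union> \<tau> \<in> ?Z} = (`) ?i ` vietoris_rips V ?C \<delta>"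
  proof (intro equalityI subsetI)
    fix \<rho> assume "\<rho> \<in> {\<rho>. \<rho> \<inter> range Inl = {} \<and> \<rho> \<union> \<tau> \<in> ?Z}"
    then have \<rho>: "\<rho> \<inter> range Inl = {}" "\<rho> \<union> \<tau> \<in> ?Z" by blast+
    note eq = Inr_part_eq[OF \<rho>(1)]
    obtain P where P: "P \<in> vietoris_rips V (points X) \<delta>" "Inr -` (\<rho> \<union> \<tau>) = Pair 0 ` P"
      "\<forall>x\<in>P. Inl -` (\<rho> \<union> \<tau>) \<union> {v. x v \<noteq> 0} \<in> X"
      using star_complexE[OF \<rho>(2)] .
    have "Inl -` (\<rho> \<union> \<tau>) = \<sigma>" "Inr -` (\<rho> \<union> \<tau>) = Inr -` \<rho>"
      unfolding vimage_Un eq(2) \<tau> by simp_all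
    then have "P \<in> vietoris_rips V ?C \<delta>" "Inr -` \<rho> = Pair 0 ` P"
      using P unfolding vietoris_rips_def by auto
    then show "\<rho> \<in> (`) ?i ` vietoris_rips V ?C \<delta>" using eq(1) by (simp add: image_comp)
  next
    fix \<rho> assume "\<rho> \<in> (`) ?i ` vietoris_rips V ?C \<delta>"
    then obtain P where P: "P \<in> vietoris_rips V ?C \<delta>" "\<rho> = Inr ` Pair 0 ` P"
      by (auto simp: image_comp)
    have "Inl -` (\<rho> \<union> \<tau>) = \<sigma>" "Inr -` (\<rho> \<union> \<tau>) = Pair 0 ` P"
      unfolding vimage_Un \<tau> P(2) by simp_all
    moreover have "P \<in> vietoris_rips V (points X) \<delta>" "\<forall>x\<in>P. \<sigma> \<union> {v. x v \<noteq> 0} \<in> X"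
      using P(1) unfolding vietoris_rips_def by auto
    ultimately have "\<rho> \<union> \<tau> \<in> ?Z" using \<sigma> by (intro star_complexI[of P]) auto
    moreover have "\<rho> \<inter> range Inl = {}" unfolding P(2) by blast
    ultimately show "\<rho> \<in> {\<rho>. \<rho> \<inter> range Inl = {} \<and> \<rho> \<union> \<tau> \<in> ?Z}" by blast
  qed
  moreover have "inj ?i" by (simp add: inj_def)
  ultimately show "acyclic_chains {\<rho>. \<rho> \<inter> range Inl = {} \<and> \<rho> \<union> \<tau> \<in> ?Z}"
    using acyclic_chains_image[OF _ acyclic_vietoris_rips_star[OF \<sigma> X \<delta>], of ?i] by simp
qed

section \<open>Contractible complexes are acyclic\<close>

lemma rel_acyclicE:
  assumes "rel_acyclic Z A" "c \<in> fchains Z" "bd c \<in> fchains A"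
  obtains d where "d \<in> fchains Z" "c + bd d \<in> fchains A"
  using assms unfolding rel_acyclic_def by blast

lemma points_mem_simplex: "x \<in> points X \<Longrightarrow> {v. x v \<noteq> 0} \<in> X"
  by (simp add: points_def)

text \<open>If the coordinate of \<open>H p\<close> at its chosen vertex is at least \<epsilon> and
  \<open>x\<close> is closer to \<open>H p\<close> than \<epsilon>, then \<open>x\<close> cannot
  vanish at that vertex. All chosen vertices thus lie in the support of the one point
  \<open>x\<close>.\<close>

lemma near_vertices_simplex:
  assumes V: "finite V" "\<And>p. p \<in> R \<Longrightarrow> \<phi> (H p) \<in> V"
    and large: "\<And>p. p \<in> R \<Longrightarrow> \<epsilon> \<le> H p (\<phi> (H p))"
    and near: "\<And>p. p \<in> R \<Longrightarrow> l1_dist V x (H p) < \<epsilon>"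
  shows "\<phi> ` H ` R \<subseteq> {v. x v \<noteq> 0}"
proof clarify
  fix p assume p: "p \<in> R" "x (\<phi> (H p)) = 0"
  have "\<bar>x (\<phi> (H p)) - H p (\<phi> (H p))\<bar> \<le> l1_dist V x (H p)"
    by (rule abs_diff_le_l1_dist[OF V(1) V(2)[OF p(1)]])
  also have "\<dots> < \<epsilon>" by (rule near[OF p(1)])
  finally show False using large[OF p(1)] p(2) by linarith
qed

text \<open>For any \<open>x\<close> in \<open>P\<close>, the vertices chosen for all of
  \<open>P\<close> lie in the support of \<open>x\<close>, and this support spans a simplex with the
  vertices of \<open>X\<close> in \<rho>. The map at time 0 is the choice \<phi> itself, as
  \<open>h\<close> starts at the identity.\<close>

lemma star_complex_subset_mapping_cylinder:
  assumes X: "abstract_complex X" and V: "finite V" "\<And>x. x \<in> points X \<Longrightarrow> \<phi> x \<in> V"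
    and large: "\<And>x. x \<in> points X \<Longrightarrow> \<epsilon> \<le> x (\<phi> x)"
    and h0: "\<And>x. x \<in> points X \<Longrightarrow> h (0, x) = x" and \<delta>: "\<delta> \<le> \<epsilon>"
  shows "star_complex X V \<delta> \<subseteq> mapping_cylinder (insert {} X) (\<lambda>p. \<phi> (h p))"
proof
  fix \<rho> assume "\<rho> \<in> star_complex X V \<delta>"
  then obtain P where P: "P \<in> vietoris_rips V (points X) \<delta>" "Inr -` \<rho> = Pair 0 ` P"
    "\<forall>x\<in>P. Inl -` \<rho> \<union> {v. x v \<noteq> 0} \<in> X" and \<rho>: "Inl -` \<rho> \<in> insert {} X"
    by (rule star_complexE)
  have pts: "x \<in> points X" if "x \<in> P" for x using P(1) that by (auto simp: vietoris_rips_def)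
  have eq: "(\<lambda>p. \<phi> (h p)) ` (Inr -` \<rho>) = \<phi> ` id ` P"
    unfolding P(2) image_image by (rule image_cong) (simp_all add: h0 pts)
  have "Inl -` \<rho> \<union> \<phi> ` id ` P \<in> insert {} X"
  proof (cases "P = {}")
    case True
    then show ?thesis using \<rho> by simp
  next
    case False
    then obtain x where x: "x \<in> P" by blast
    have "\<phi> ` id ` P \<subseteq> {v. x v \<noteq> 0}"
    proof (rule near_vertices_simplex[OF V(1), where \<epsilon> = \<epsilon>])
      fix y assume y: "y \<in> P"
      show "l1_dist V x (id y) < \<epsilon>" using P(1) x y \<delta> by (force simp: vietoris_rips_def)
    qed (simp_all add: pts V large)
    then have "Inl -` \<rho> \<union> \<phi> ` id ` P \<subseteq> Inl -` \<rho> \<union> {v. x v \<noteq> 0}" by blast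
    moreover have "Inl -` \<rho> \<union> {v. x v \<noteq> 0} \<in> insert {} X" using P(3) x by blast
    ultimately show ?thesis by (rule down_closedD[OF down_closed_complex[OF X], rotated])
  qed
  then show "\<rho> \<in> mapping_cylinder (insert {} X) (\<lambda>p. \<phi> (h p))"
    unfolding mapping_cylinder_def mem_Collect_eq eq .
qed

definition time_slice :: "'a set set \<Rightarrow> 'a set \<Rightarrow> real \<Rightarrow> real \<Rightarrow> ('b + real \<times> ('a \<Rightarrow> real)) set set" where
  "time_slice X V \<delta> t = (\<lambda>P. Inr ` Pair t ` P) ` vietoris_rips V (points X) \<delta>"

text \<open>Only the images under \<open>h\<close> have to be close, not the points of
  \<open>R\<close>. Two consecutive times may therefore occur in one simplex, and at time 1, where
  all images coincide, any finite set of points becomes one.\<close>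

lemma slice_into_mapping_cylinder:
  fixes R :: "(real \<times> ('a \<Rightarrow> real)) set"
  assumes X: "abstract_complex X" and V: "finite V" "\<And>x. x \<in> points X \<Longrightarrow> \<phi> x \<in> V"
    and large: "\<And>x. x \<in> points X \<Longrightarrow> \<epsilon> \<le> x (\<phi> x)"
    and h: "\<And>p. p \<in> R \<Longrightarrow> h p \<in> points X"
    and near: "\<And>p q. p \<in> R \<Longrightarrow> q \<in> R \<Longrightarrow> l1_dist V (h p) (h q) < \<epsilon>"
  shows "Inr ` R \<in> mapping_cylinder (insert {} X) (\<lambda>p. \<phi> (h p))"
proof (cases "R = {}")
  case True
  then show ?thesis by (simp add: mapping_cylinder_def)
next
  case False
  then obtain p where p: "p \<in> R" by blast
  have "\<phi> ` h ` R \<subseteq> {v. h p v \<noteq> 0}"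
    by (rule near_vertices_simplex[OF V(1), where \<epsilon> = \<epsilon>])
      (simp_all add: h V large near p)
  moreover have "{v. h p v \<noteq> 0} \<in> insert {} X" using points_mem_simplex[OF h[OF p]] by simp
  ultimately have "\<phi> ` h ` R \<in> insert {} X"
    by (rule down_closedD[OF down_closed_complex[OF X], rotated])
  then show ?thesis by (simp add: mapping_cylinder_def image_image)
qed

lemma contractible_spaceE:
  assumes "contractible_space (top_of_set S)"
  obtains h c where "continuous_on ({0..1::real} \<times> S) h" "h \<in> {0..1} \<times> S \<rightarrow> S"
    "\<And>x. h (0, x) = x" "\<And>x. h (1, x) = c"
proof -
  obtain c where c: "homotopic_with (\<lambda>x. True) (top_of_set S) (top_of_set S) id (\<lambda>x. c)"
    using assms unfolding contractible_space_def by (rule exE)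
  obtain h where h: "continuous_map (prod_topology (top_of_set {0..1::real}) (top_of_set S)) (top_of_set S) h
      \<and> (\<forall>x. h (0, x) = id x) \<and> (\<forall>x. h (1, x) = c) \<and> (\<forall>t\<in>{0..1::real}. True)"
    using c unfolding homotopic_with_def by (rule exE)
  have "continuous_on ({0..1::real} \<times> S) h \<and> h \<in> {0..1} \<times> S \<rightarrow> S"
    using conjunct1[OF h] unfolding prod_topology_subtopology_eu continuous_map_subtopology_eu .
  then show ?thesis using that[of h c] h by simp
qed

text \<open>The cylinder belongs to \<open>\<phi> \<circ> h\<close>, defined on pairs of a time and
  a point. At time 0 it contains the star complex, at time 1 its map is constant, and fillings found
  in it can be brought back to \<open>X\<close>.\<close>

theorem acyclic_chains_contractible:
  assumes fin: "finite X" and X: "abstract_complex X" and contr: "contractible_complex X"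
  shows "acyclic_chains (insert {} X)"
  unfolding acyclic_chains_def
proof (intro ballI impI)
  define S where "S = points X"
  define V where "V = \<Union>X"
  have V: "finite V" "\<Union>X \<subseteq> V" using fin X by (auto simp: V_def abstract_complex_def)
  have contrS: "contractible_space (top_of_set S)"
    using contr unfolding contractible_complex_def realization_eq S_def by (rule conjunct2)
  obtain h c where hcont: "continuous_on ({0..1::real} \<times> S) h" and hS: "h \<in> {0..1} \<times> S \<rightarrow> S"
    and h0: "\<And>x. h (0, x) = x" and h1: "\<And>x. h (1, x) = c"
    by (rule contractible_spaceE[OF contrS]) (rule that)
  have "S \<noteq> {}"
  proof -
    obtain \<sigma> where "\<sigma> \<in> X" using contr unfolding contractible_complex_def by blast
    then show ?thesis using barycenter_in_points(1)[OF _ X] unfolding S_def by blast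
  qed
  then obtain x0 where "x0 \<in> S" by blast
  then have "h (1, x0) \<in> S" using hS by auto
  then have c: "c \<in> S" unfolding h1 .
  \<comment> \<open>The average of the coordinates over \<open>V\<close>, since they sum to 1; some
    coordinate is at least as large.\<close>
  define \<epsilon> where "\<epsilon> = 1 / real (card V)"
  define \<phi> where "\<phi> = (\<lambda>x. SOME v. v \<in> V \<and> \<epsilon> \<le> x v)"
  have \<phi>: "\<phi> x \<in> V" "\<epsilon> \<le> x (\<phi> x)" if "x \<in> S" for x
  proof -
    have "\<exists>v. v \<in> V \<and> \<epsilon> \<le> x v"
      using exists_large_coordinate[OF _ X V] that unfolding S_def \<epsilon>_def by blast
    from someI_ex[OF this] show "\<phi> x \<in> V" "\<epsilon> \<le> x (\<phi> x)" by (simp_all add: \<phi>_def)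
  qed
  have "V \<noteq> {}" using \<phi>(1)[OF c] by blast
  then have \<epsilon>: "0 < \<epsilon>" using V(1) by (simp add: \<epsilon>_def card_gt_0_iff)
  have sep: "x = y" if "x \<in> S" "y \<in> S" "l1_dist V x y = 0" for x y
    using points_eqI[OF _ _ V] that unfolding S_def by blast
  have comp: "compact S" unfolding S_def by (rule compact_points[OF fin X])
  obtain \<gamma> where \<gamma>: "0 < \<gamma>" and unif:
    "\<And>s t x y. s \<in> {0..1} \<Longrightarrow> t \<in> {0..1} \<Longrightarrow> x \<in> S \<Longrightarrow> y \<in> S \<Longrightarrow>
       \<bar>s - t\<bar> + l1_dist V x y < \<gamma> \<Longrightarrow> l1_dist V (h (s, x)) (h (t, y)) < \<epsilon>"
  proof (rule homotopy_uniformly_continuous[OF comp hcont _ \<epsilon>, where V = V])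
    show "x = y" if "x \<in> S" "y \<in> S" "l1_dist V x y = 0" for x y
      using that by (rule sep)
  qed (rule that)
  \<comment> \<open>The bound \<epsilon> puts the star complex into the cylinder. Half of \<gamma>
    is spent on the distance of points, the other half is left for the time step
    \<open>1 / m\<close>.\<close>
  define \<delta> where "\<delta> = min \<epsilon> (\<gamma> / 2)"
  have \<delta>: "0 < \<delta>" "\<delta> \<le> \<epsilon>" "\<delta> \<le> \<gamma> / 2" using \<epsilon> \<gamma> by (simp_all add: \<delta>_def)
  obtain m where m': "2 / \<gamma> < real m" using reals_Archimedean2 by blast
  have "0 < real m" by (rule less_trans[OF _ m']) (use \<gamma> in simp)
  then have m: "0 < m" "1 / real m < \<gamma> / 2" using m' \<gamma> by (simp_all add: field_simps)
  let ?M = "mapping_cylinder (insert {} X) (\<lambda>p. \<phi> (h p))"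
  let ?Z = "star_complex X V \<delta>"
  have M: "down_closed ?M" by (rule down_closed_mapping_cylinder[OF down_closed_complex[OF X]])
  have ZM: "?Z \<subseteq> ?M"
    by (rule star_complex_subset_mapping_cylinder[OF X V(1)]) (use \<phi> h0 \<delta> in \<open>simp_all add: S_def\<close>)
  fix z assume z: "z \<in> fchains (insert {} X)" "bd z = 0"
  let ?z = "push Inl z :: ('a + real \<times> ('a \<Rightarrow> real)) set \<Rightarrow> bit"
  have injl: "inj (Inl :: 'a \<Rightarrow> 'a + real \<times> ('a \<Rightarrow> real))" by simp
  have z': "?z \<in> fchains ((`) Inl ` insert {} X)" by (rule push_in_fchains[OF injl z(1)])
  have "(`) Inl ` insert {} X \<subseteq> ?Z"
  proof
    fix \<rho> :: "('a + real \<times> ('a \<Rightarrow> real)) set" assume "\<rho> \<in> (`) Inl ` insert {} X"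
    then obtain \<sigma> where "\<sigma> \<in> insert {} X" "\<rho> = Inl ` \<sigma>" by blast
    then show "\<rho> \<in> ?Z" by (intro star_complexI[of "{}"]) (auto simp: vietoris_rips_def)
  qed
  then have zZ: "?z \<in> fchains ?Z" by (rule fchains_monoD[OF z'])
  have bdz: "bd ?z = 0" using bd_push[OF injl z(1)] z(2) by simp
  have bdz_A: "bd ?z \<in> fchains {\<rho>\<in>?Z. \<rho> \<inter> range Inl = {}}" unfolding bdz by (rule fchains_0)
  obtain d where d: "d \<in> fchains ?Z" "?z + bd d \<in> fchains {\<rho>\<in>?Z. \<rho> \<inter> range Inl = {}}"
    using rel_acyclicE[OF rel_acyclic_star_complex[OF X V \<delta>(1)] zZ bdz_A] .
  have dM: "d \<in> fchains ?M" by (rule fchains_monoD[OF d(1) ZM])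
  \<comment> \<open>A cycle of points at time 0, homologous to the given one inside the star
    complex.\<close>
  define v where "v = ?z + bd d"
  have vslice: "\<rho> \<in> time_slice X V \<delta> 0" if v\<rho>: "v \<rho> \<noteq> 0" for \<rho>
  proof -
    have "\<rho> \<in> {\<rho>\<in>?Z. \<rho> \<inter> range Inl = {}}"
      by (rule fchains_imp_in[OF d(2) v\<rho>[unfolded v_def]])
    then have \<rho>: "\<rho> \<in> ?Z" "\<rho> \<inter> range Inl = {}" by blast+
    obtain P where P: "P \<in> vietoris_rips V (points X) \<delta>" "Inr -` \<rho> = Pair 0 ` P"
      using star_complexE[OF \<rho>(1)] .
    have "\<rho> = Inr ` Pair 0 ` P" using Inr_part_eq(1)[OF \<rho>(2)] P(2) by simp
    then show ?thesis using P(1) unfolding time_slice_def by blast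
  qed
  have vM: "v \<in> fchains ?M"
  proof -
    have "{\<rho>\<in>?Z. \<rho> \<inter> range Inl = {}} \<subseteq> ?M" using ZM by blast
    then show ?thesis unfolding v_def by (rule fchains_monoD[OF d(2)])
  qed
  have bdv: "bd v = 0"
    using bd_add[OF zZ bd_in_fchains[OF d(1) down_closed_star_complex[OF X]]] bdz bd_bd[OF d(1)]
    unfolding v_def by simp
  have stage: "\<exists>e\<in>fchains ?M. \<forall>\<rho>. (v + bd e) \<rho> \<noteq> 0 \<longrightarrow> \<rho> \<in> time_slice X V \<delta> (real k / real m)"
    if "k \<le> m" for k
    using that
  proof (induction k)
    case 0
    have eq: "v + bd 0 = v" by (simp only: bd_0 add_0_right)
    show ?case
      by (rule bexI[OF _ fchains_0]) (simp only: eq of_nat_0 div_0, intro allI impI, erule vslice)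
  next
    case (Suc k)
    let ?s = "real k / real m" and ?t = "real (Suc k) / real m"
    have st: "?s \<in> {0..1}" "?t \<in> {0..1}" "?t - ?s = 1 / real m"
      using Suc.prems m(1) by (simp_all add: field_simps)
    obtain e where e: "e \<in> fchains ?M"
      and es: "\<And>\<rho>. (v + bd e) \<rho> \<noteq> 0 \<Longrightarrow> \<rho> \<in> time_slice X V \<delta> ?s"
      using Suc.IH Suc.prems by (meson Suc_leD)
    have bde: "bd e \<in> fchains ?M" by (rule bd_in_fchains[OF e M])
    have w: "v + bd e \<in> fchains ?M" using vM bde by (rule fchains_add)
    have bw: "bd (v + bd e) = 0" using bd_add[OF vM bde] bdv bd_bd[OF e] by simp
    define f :: "'a + real \<times> ('a \<Rightarrow> real) \<Rightarrow> 'a + real \<times> ('a \<Rightarrow> real)"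
      where "f = map_sum id (\<lambda>p. (?t, snd p))"
    \<comment> \<open>Moving to a later time lowers this rank, as \<open>deform_cycle\<close>
      requires; \<open>f\<close> keeps the point and changes only the time.\<close>
    define r :: "'a + real \<times> ('a \<Rightarrow> real) \<Rightarrow> real"
      where "r = case_sum (\<lambda>_. 0) (\<lambda>p. - fst p)"
    have f_slice: "f ` Inr ` Pair ?s ` P = Inr ` Pair ?t ` P" for P
      unfolding image_image f_def by simp
    obtain e' where e': "e' \<in> fchains ?M"
      "\<And>\<rho>. (v + bd e + bd e') \<rho> \<noteq> 0 \<Longrightarrow> \<exists>\<pi>. (v + bd e) \<pi> \<noteq> 0 \<and> \<rho> = f ` \<pi>"
    proof (rule deform_cycle[OF w bw M, where f = f and r = r])
      fix \<rho> assume "(v + bd e) \<rho> \<noteq> 0"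
      then obtain P where P: "P \<in> vietoris_rips V (points X) \<delta>" "\<rho> = Inr ` Pair ?s ` P"
        using es unfolding time_slice_def by blast
      \<comment> \<open>A simplex together with its translate to the next time. Two of its elements
        differ by at most \<open>1 / m\<close> in time and by less than \<delta> in space, so their
        images under \<open>h\<close> are closer than \<epsilon>.\<close>
      let ?R = "Pair ?s ` P \<union> Pair ?t ` P"
      have "Inr ` ?R \<in> ?M"
      proof (rule slice_into_mapping_cylinder[OF X V(1), where \<epsilon> = \<epsilon>])
        have R: "fst p \<in> {0..1} \<and> snd p \<in> S \<and> snd p \<in> P \<and> (fst p = ?s \<or> fst p = ?t)"
          if "p \<in> ?R" for p
          using that st P(1) unfolding vietoris_rips_def S_def by auto
        show "h p \<in> points X" if "p \<in> ?R" for p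
        proof -
          have "p \<in> {0..1} \<times> S" using R[OF that] by (simp add: mem_Times_iff)
          then show ?thesis using hS unfolding S_def by blast
        qed
        fix p q assume p: "p \<in> ?R" and q: "q \<in> ?R"
        have "0 \<le> 1 / real m" by simp
        moreover have "fst p = ?s \<or> fst p = ?t" "fst q = ?s \<or> fst q = ?t"
          using R[OF p] R[OF q] by blast+
        ultimately have "\<bar>fst p - fst q\<bar> \<le> 1 / real m"
          using st(3) by (elim disjE; linarith)
        moreover have "l1_dist V (snd p) (snd q) < \<delta>"
        proof -
          have "\<forall>x\<in>P. \<forall>y\<in>P. l1_dist V x y < \<delta>" using P(1) by (simp add: vietoris_rips_def)
          then show ?thesis using R[OF p] R[OF q] by blast
        qed
        ultimately have "\<bar>fst p - fst q\<bar> + l1_dist V (snd p) (snd q) < \<gamma>"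
          using m(2) \<delta>(3) by linarith
        then show "l1_dist V (h p) (h q) < \<epsilon>"
          using unif[of "fst p" "fst q" "snd p" "snd q"] R[OF p] R[OF q] by simp
      qed (use \<phi> in \<open>simp_all add: S_def\<close>)
      then show "\<rho> \<union> f ` \<rho> \<in> ?M" unfolding P(2) f_slice image_Un .
    next
      fix u assume "u \<in> \<Union>(supp (v + bd e))"
      then obtain \<rho> where "u \<in> \<rho>" "\<rho> \<in> supp (v + bd e)" by (rule UnionE)
      then obtain x where "u = Inr (?s, x)"
        using es[of \<rho>] unfolding supp_iff time_slice_def by blast
      then have "r (f u) = - ?t" "r u = - ?s" by (simp_all add: r_def f_def)
      moreover have "?s < ?t" using m(1) by (simp add: divide_strict_right_mono)
      ultimately show "r (f u) < r u" by linarith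
    qed (rule that)
    have "\<rho> \<in> time_slice X V \<delta> ?t" if \<rho>: "(v + bd (e + e')) \<rho> \<noteq> 0" for \<rho>
    proof -
      have "(v + bd e + bd e') \<rho> \<noteq> 0" using \<rho> unfolding bd_add[OF e e'(1)] add.assoc .
      then obtain \<pi> where \<pi>: "(v + bd e) \<pi> \<noteq> 0" "\<rho> = f ` \<pi>" using e'(2) by blast
      obtain P where P: "P \<in> vietoris_rips V (points X) \<delta>" "\<pi> = Inr ` Pair ?s ` P"
        using es[OF \<pi>(1)] unfolding time_slice_def by blast
      show ?thesis unfolding time_slice_def \<pi>(2) P(2) f_slice using P(1) by blast
    qed
    moreover have "e + e' \<in> fchains ?M" using e e'(1) by (rule fchains_add)
    ultimately show ?case by blast
  qed
  have "\<exists>e\<in>fchains ?M. \<forall>\<rho>. (v + bd e) \<rho> \<noteq> 0 \<longrightarrow> \<rho> \<in> time_slice X V \<delta> 1"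
    using stage[of m] m(1) by simp
  then obtain e where e: "e \<in> fchains ?M"
    and es: "\<And>\<rho>. (v + bd e) \<rho> \<noteq> 0 \<Longrightarrow> \<rho> \<in> time_slice X V \<delta> 1" by blast
  have bde: "bd e \<in> fchains ?M" by (rule bd_in_fchains[OF e M])
  have w: "v + bd e \<in> fchains ?M" using vM bde by (rule fchains_add)
  have bw: "bd (v + bd e) = 0" using bd_add[OF vM bde] bdv bd_bd[OF e] by simp
  \<comment> \<open>All points at time 1 are sent to \<open>c\<close> and hence share one chosen
    vertex, so the point \<open>(1, c)\<close> can be joined to every simplex of this slice.\<close>
  let ?c = "cone (Inr (1, c)) (v + bd e)"
  have cM: "?c \<in> fchains ?M"
  proof (rule cone_in_fchains[OF w])
    fix \<rho> assume "\<rho> \<in> supp (v + bd e)"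
    then obtain P where P: "P \<in> vietoris_rips V (points X) \<delta>" "\<rho> = Inr ` Pair 1 ` P"
      using es[of \<rho>] unfolding supp_iff time_slice_def by blast
    let ?R = "insert (1, c) (Pair 1 ` P)"
    have hc: "h p = c" if "p \<in> ?R" for p using that h1 by auto
    have "Inr ` ?R \<in> ?M"
      by (rule slice_into_mapping_cylinder[OF X V(1), where \<epsilon> = \<epsilon>])
        (use \<phi> c \<epsilon> hc in \<open>simp_all add: S_def\<close>)
    then show "insert (Inr (1, c)) \<rho> \<in> ?M" unfolding P(2) image_insert .
  qed
  have "bd (e + ?c) = v" unfolding bd_add[OF e cM] bd_cone[OF w] bw
    by (simp add: add.left_commute add.commute)
  then have "bd (d + (e + ?c)) = bd d + v"
    unfolding bd_add[OF dM fchains_add[OF e cM]] by (rule arg_cong)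
  also have "\<dots> = ?z" unfolding v_def by (simp add: add.left_commute add.commute)
  finally have eq: "bd (d + (e + ?c)) = ?z" .
  have big: "d + (e + ?c) \<in> fchains ?M" by (intro fchains_add dM e cM)
  \<comment> \<open>The filling lives in the cylinder but its boundary lies in the copy of
    \<open>X\<close>; relative acyclicity of the cylinder replaces it by a filling in
    \<open>X\<close>.\<close>
  have "bd (d + (e + ?c)) \<in> fchains ((`) Inl ` insert {} X)" unfolding eq by (rule z')
  from rel_acyclic_boundary[OF rel_acyclic_mapping_cylinder[OF down_closed_complex[OF X]] M big this]
  obtain y where y: "y \<in> fchains ((`) Inl ` insert {} X)" "bd y = ?z"
    unfolding eq .
  obtain x where x: "x \<in> fchains (insert {} X)" "y = push Inl x" using fchains_image[OF injl y(1)] .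
  have "push Inl (bd x) = ?z" using y(2) bd_push[OF injl x(1)] unfolding x(2) by simp
  then have "bd x = z" by (rule push_inject[OF injl])
  then show "\<exists>x\<in>fchains (insert {} X). bd x = z" using x(1) by blast
qed

section \<open>Homology classes\<close>

text \<open>Extracts one degree from the ungraded chains. The index counts vertices, so degree
  \<open>k\<close> of \<open>chains\<close> corresponds to \<open>part (Suc k)\<close>, and
  \<open>part 0\<close> is the augmentation degree.\<close>

definition part :: "nat \<Rightarrow> ('a set \<Rightarrow> bit) \<Rightarrow> 'a set \<Rightarrow> bit" where
  "part k c = (\<lambda>\<sigma>. if card \<sigma> = k then c \<sigma> else 0)"

lemma part_in_fchains:
  assumes "c \<in> fchains K"
  shows "part k c \<in> fchains {\<sigma>\<in>K. card \<sigma> = k}"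
proof -
  have "supp (part k c) \<subseteq> supp c" by (auto simp: part_def split: if_splits)
  moreover have "finite (supp c)" using assms by (simp add: fchains_def)
  ultimately have "finite (supp (part k c))" by (rule finite_subset)
  moreover have "finite \<sigma> \<and> \<sigma> \<in> K \<and> card \<sigma> = k" if "part k c \<sigma> \<noteq> 0" for \<sigma>
  proof -
    have "card \<sigma> = k" "c \<sigma> \<noteq> 0" using that by (auto simp: part_def split: if_splits)
    then show ?thesis using fchains_imp_finite[OF assms] fchains_imp_in[OF assms] by simp
  qed
  ultimately show ?thesis by (simp add: fchains_def)
qed

lemma part_eq:
  assumes "c \<in> fchains {\<sigma>\<in>K. card \<sigma> = k}"
  shows "part k c = c"
proof
  fix \<sigma> show "part k c \<sigma> = c \<sigma>"
  proof (cases "c \<sigma> = 0")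
    case False
    then have "card \<sigma> = k" using fchains_imp_in[OF assms False] by blast
    then show ?thesis by (simp add: part_def)
  qed (simp add: part_def)
qed

lemma part_add: "part k (c + d) = part k c + part k d"
  by (rule ext) (simp add: part_def)

lemma bd_part:
  assumes c: "c \<in> fchains K"
  shows "bd (part (Suc k) c) = part k (bd c)"
proof
  fix \<tau>
  let ?V = "\<Union>(supp c)"
  have fin: "finite ?V" using c by (rule finite_vertices)
  have "supp (part (Suc k) c) \<subseteq> supp c" by (auto simp: part_def split: if_splits)
  then have sub: "\<Union>(supp (part (Suc k) c)) \<subseteq> ?V" by blast
  show "bd (part (Suc k) c) \<tau> = part k (bd c) \<tau>"
  proof (cases "finite \<tau>")
    case True
    have "part (Suc k) c (insert x \<tau>) = (if card \<tau> = k then c (insert x \<tau>) else 0)"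
      if "x \<in> ?V - \<tau>" for x
      using that True by (simp add: part_def)
    then have "bd (part (Suc k) c) \<tau> = (\<Sum>x\<in>?V - \<tau>. if card \<tau> = k then c (insert x \<tau>) else 0)"
      unfolding bd_eq[OF fin sub] by (rule sum.cong[OF refl])
    also have "\<dots> = part k (bd c) \<tau>" by (simp add: part_def bd_def)
    finally show ?thesis .
  next
    case False
    \<comment> \<open>An infinite set has \<open>card\<close> equal to 0 and could be mistaken for a
      simplex in degree 0; chains vanish on such sets, so both sides are 0.\<close>
    have "c (insert x \<tau>) = 0" for x
      using fchains_imp_finite[OF c, of "insert x \<tau>"] False by (metis finite_insert)
    moreover have "part (Suc k) c (insert x \<tau>) = 0" for x
      using \<open>c (insert x \<tau>) = 0\<close> by (simp add: part_def)
    ultimately have "bd c \<tau> = 0" "bd (part (Suc k) c) \<tau> = 0" by (simp_all add: bd_def)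
    then show ?thesis by (simp add: part_def)
  qed
qed

text \<open>The empty simplex has no vertices and is excluded by the cardinality, so adding it to
  \<open>X\<close> leaves the graded chains unchanged.\<close>

lemma chains_eq:
  assumes "abstract_complex X"
  shows "chains X k = fchains {\<sigma>\<in>insert {} X. card \<sigma> = Suc k}"
proof (intro equalityI subsetI)
  fix c assume "c \<in> chains X k"
  then have c: "finite (supp c)" "\<And>\<sigma>. c \<sigma> \<noteq> 0 \<Longrightarrow> \<sigma> \<in> X \<and> card \<sigma> = Suc k"
    unfolding chains_def supp_def by blast+
  have "finite \<sigma>" if "c \<sigma> \<noteq> 0" for \<sigma> using c(2)[OF that] by (intro card_ge_0_finite) simp
  then show "c \<in> fchains {\<sigma>\<in>insert {} X. card \<sigma> = Suc k}" using c by (simp add: fchains_def)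
next
  fix c assume c: "c \<in> fchains {\<sigma>\<in>insert {} X. card \<sigma> = Suc k}"
  have "\<sigma> \<in> X \<and> card \<sigma> = Suc k" if "c \<sigma> \<noteq> 0" for \<sigma>
    using fchains_imp_in[OF c that] by auto
  moreover have "finite (supp c)" using c by (simp add: fchains_def)
  ultimately show "c \<in> chains X k" unfolding chains_def supp_def by blast
qed

lemma boundary_eq:
  assumes c: "c \<in> fchains K" and \<tau>: "\<tau> \<noteq> {}"
  shows "boundary c \<tau> = bd c \<tau>"
proof -
  let ?V = "\<Union>(supp c)"
  let ?A = "{x\<in>?V - \<tau>. c (insert x \<tau>) \<noteq> 0}"
  have "{\<sigma>. c \<sigma> \<noteq> 0 \<and> \<tau> \<subseteq> \<sigma> \<and> card \<sigma> = Suc (card \<tau>)} = (\<lambda>x. insert x \<tau>) ` ?A"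
  proof (intro equalityI subsetI)
    fix \<sigma> assume "\<sigma> \<in> {\<sigma>. c \<sigma> \<noteq> 0 \<and> \<tau> \<subseteq> \<sigma> \<and> card \<sigma> = Suc (card \<tau>)}"
    then have \<sigma>: "c \<sigma> \<noteq> 0" "\<tau> \<subseteq> \<sigma>" "card \<sigma> = Suc (card \<tau>)" by blast+
    have fin: "finite \<sigma>" using fchains_imp_finite[OF c \<sigma>(1)] .
    then have "finite \<tau>" using \<sigma>(2) finite_subset by blast
    then have "card (\<sigma> - \<tau>) = 1" using \<sigma>(2,3) by (simp add: card_Diff_subset)
    then obtain x where x: "\<sigma> - \<tau> = {x}" by (rule card_1_singletonE)
    then have eq: "\<sigma> = insert x \<tau>" using \<sigma>(2) by blast
    have "x \<in> \<sigma>" "x \<notin> \<tau>" using x by blast+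
    moreover have "\<sigma> \<in> supp c" using \<sigma>(1) by simp
    ultimately have "x \<in> ?A" using \<sigma>(1) eq by blast
    then show "\<sigma> \<in> (\<lambda>x. insert x \<tau>) ` ?A" using eq by blast
  next
    fix \<sigma> assume "\<sigma> \<in> (\<lambda>x. insert x \<tau>) ` ?A"
    then obtain x where x: "x \<notin> \<tau>" "c (insert x \<tau>) \<noteq> 0" "\<sigma> = insert x \<tau>" by blast
    have "finite \<tau>" using fchains_imp_finite[OF c x(2)] by simp
    then show "\<sigma> \<in> {\<sigma>. c \<sigma> \<noteq> 0 \<and> \<tau> \<subseteq> \<sigma> \<and> card \<sigma> = Suc (card \<tau>)}"
      using x by (auto simp: card_insert_if)
  qed
  then have "boundary c \<tau> = sum c ((\<lambda>x. insert x \<tau>) ` ?A)"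
    using \<tau> by (simp add: boundary_def)
  also have "\<dots> = (\<Sum>x\<in>?A. c (insert x \<tau>))"
    by (subst sum.reindex) (auto simp: inj_on_def)
  also have "\<dots> = bd c \<tau>" unfolding bd_def
    using finite_vertices[OF c] by (intro sum.mono_neutral_left) auto
  finally show ?thesis .
qed

lemma boundary_empty [simp]: "boundary c {} = 0"
  by (simp add: boundary_def)

text \<open>From degree 1 on, no simplex has the empty set as a facet, so the augmented and the
  unreduced boundary agree. They can differ in degree 0, which is why the degree is a
  successor.\<close>

lemma boundary_chains_Suc:
  assumes X: "abstract_complex X" and c: "c \<in> chains X (Suc k)"
  shows "boundary c = bd c" "bd c \<in> chains X k"
proof -
  have c': "c \<in> fchains {\<sigma>\<in>insert {} X. card \<sigma> = Suc (Suc k)}" using c unfolding chains_eq[OF X] .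
  have "c (insert x {}) = 0" for x
    using fchains_imp_in[OF c', of "{x}"] by auto
  then have "bd c {} = 0" by (simp add: bd_def)
  then show "boundary c = bd c" using boundary_eq[OF c'] boundary_empty by (metis ext)
  have c'': "c \<in> fchains (insert {} X)" by (rule fchains_monoD[OF c']) blast
  have "bd c = part (Suc k) (bd c)"
    using bd_part[OF c'', of "Suc k"] unfolding part_eq[OF c'] .
  then show "bd c \<in> chains X k" unfolding chains_eq[OF X]
    using part_in_fchains[OF bd_in_fchains[OF c'' down_closed_complex[OF X]], of "Suc k"] by metis
qed

text \<open>An unreduced cycle may keep an augmented boundary at the empty simplex; in degree 0 this
  is the parity of the number of vertices.\<close>

lemma boundary_zero_iff:
  assumes "c \<in> fchains K"
  shows "boundary c = 0 \<longleftrightarrow> (\<forall>\<tau>. \<tau> \<noteq> {} \<longrightarrow> bd c \<tau> = 0)"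
proof
  assume "boundary c = 0"
  then show "\<forall>\<tau>. \<tau> \<noteq> {} \<longrightarrow> bd c \<tau> = 0" using boundary_eq[OF assms] by (metis zero_fun_apply)
next
  assume *: "\<forall>\<tau>. \<tau> \<noteq> {} \<longrightarrow> bd c \<tau> = 0"
  show "boundary c = 0"
  proof
    fix \<tau> show "boundary c \<tau> = 0 \<tau>"
      using boundary_eq[OF assms] * by (cases "\<tau> = {}") simp_all
  qed
qed

definition cycles :: "'a set set \<Rightarrow> nat \<Rightarrow> ('a set \<Rightarrow> bit) set" where
  "cycles X k = {c \<in> chains X k. boundary c = 0}"

text \<open>The summands are in the order of \<open>r_coset\<close>, so that unfolding the quotient
  group produces exactly these sets.\<close>

definition hclass :: "'a set set \<Rightarrow> nat \<Rightarrow> ('a set \<Rightarrow> bit) \<Rightarrow> ('a set \<Rightarrow> bit) set" where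
  "hclass X k z = (\<lambda>b. b + z) ` boundaries X k"

lemma chains_0 [simp]: "0 \<in> chains X k"
  by (simp add: chains_def)

lemma chains_add:
  assumes "abstract_complex X" "c \<in> chains X k" "d \<in> chains X k"
  shows "c + d \<in> chains X k"
  using assms(2,3) unfolding chains_eq[OF assms(1)] by (rule fchains_add)

lemma cycles_add:
  assumes X: "abstract_complex X" and c: "c \<in> cycles X k" and d: "d \<in> cycles X k"
  shows "c + d \<in> cycles X k"
proof -
  have cd: "c \<in> chains X k" "d \<in> chains X k" "boundary c = 0" "boundary d = 0"
    using c d by (simp_all add: cycles_def)
  note f = cd(1,2)[unfolded chains_eq[OF X]]
  have "bd c \<tau> = 0" "bd d \<tau> = 0" if "\<tau> \<noteq> {}" for \<tau>
    using that cd(3,4) boundary_zero_iff[OF f(1)] boundary_zero_iff[OF f(2)] by blast+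
  then have "bd (c + d) \<tau> = 0" if "\<tau> \<noteq> {}" for \<tau>
    unfolding bd_add[OF f] using that by simp
  then have "boundary (c + d) = 0" unfolding boundary_zero_iff[OF fchains_add[OF f]] by blast
  then show ?thesis using chains_add[OF X cd(1,2)] by (simp add: cycles_def)
qed

lemma boundaries_eq:
  assumes X: "abstract_complex X"
  shows "boundaries X k = bd ` chains X (Suc k)"
  unfolding boundaries_def by (rule image_cong[OF refl boundary_chains_Suc(1)[OF X]])

lemma boundaries_0:
  assumes X: "abstract_complex X"
  shows "0 \<in> boundaries X k"
  unfolding boundaries_eq[OF X] by (rule image_eqI[of _ _ 0]) simp_all

lemma boundaries_add:
  assumes X: "abstract_complex X" and "c \<in> boundaries X k" "d \<in> boundaries X k"
  shows "c + d \<in> boundaries X k"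
proof -
  obtain a b where ab: "a \<in> chains X (Suc k)" "b \<in> chains X (Suc k)" "c = bd a" "d = bd b"
    using assms(2,3) unfolding boundaries_eq[OF X] by blast
  have "c + d = bd (a + b)"
    using bd_add[OF ab(1,2)[unfolded chains_eq[OF X]]] ab(3,4) by simp
  then show ?thesis unfolding boundaries_eq[OF X] using chains_add[OF X ab(1,2)] by (rule image_eqI)
qed

lemma boundaries_mono:
  assumes "X \<subseteq> Y"
  shows "boundaries X k \<subseteq> boundaries Y k"
  unfolding boundaries_def using assms by (intro image_mono) (auto simp: chains_def)

lemma cycles_mono: "X \<subseteq> Y \<Longrightarrow> cycles X k \<subseteq> cycles Y k"
  by (auto simp: cycles_def chains_def)

lemma hclass_eq_iff:
  assumes X: "abstract_complex X"
  shows "hclass X k z = hclass X k w \<longleftrightarrow> z + w \<in> boundaries X k"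
proof
  assume eq: "hclass X k z = hclass X k w"
  have "0 + z \<in> hclass X k z" unfolding hclass_def using boundaries_0[OF X] by (rule imageI)
  then have "z \<in> hclass X k w" using eq by simp
  then obtain b where b: "b \<in> boundaries X k" "z = b + w" unfolding hclass_def by blast
  then have "z + w = b" by (simp add: add.assoc)
  then show "z + w \<in> boundaries X k" using b by simp
next
  have *: "hclass X k z \<subseteq> hclass X k w" if "z + w \<in> boundaries X k" for z w
  proof
    fix y assume "y \<in> hclass X k z"
    then obtain b where b: "b \<in> boundaries X k" "y = b + z" unfolding hclass_def by blast
    have "y = (b + (z + w)) + w" using b(2) by (simp add: add.assoc)
    moreover have "b + (z + w) \<in> boundaries X k" by (rule boundaries_add[OF X b(1) that])
    ultimately show "y \<in> hclass X k w" unfolding hclass_def by (rule image_eqI)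
  qed
  assume zw: "z + w \<in> boundaries X k"
  then have wz: "w + z \<in> boundaries X k" by (simp only: add.commute)
  show "hclass X k z = hclass X k w" using *[OF zw] *[OF wz] by (rule equalityI)
qed

lemma cycle_group_simps [simp]:
  "carrier (cycle_group X k) = cycles X k"
  "x \<otimes>\<^bsub>cycle_group X k\<^esub> y = x + y"
  by (simp_all add: cycle_group_def cycles_def plus_fun_def zero_fun_def)

lemma carrier_homology: "carrier (homology X k) = hclass X k ` cycles X k"
  by (auto simp: homology_def FactGroup_def RCOSETS_def r_coset_def hclass_def)

text \<open>One computation for two purposes: \<open>X = Y\<close> gives the addition of homology
  classes, \<open>w = 0\<close> the map induced by an inclusion.\<close>

lemma hclass_set_mult:
  assumes X: "abstract_complex X" and Y: "abstract_complex Y" and "X \<subseteq> Y"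
  shows "hclass X k z <#>\<^bsub>cycle_group Y k\<^esub> hclass Y k w = hclass Y k (z + w)"
proof (intro equalityI subsetI)
  fix y assume "y \<in> hclass X k z <#>\<^bsub>cycle_group Y k\<^esub> hclass Y k w"
  then obtain a b where ab: "a \<in> boundaries X k" "b \<in> boundaries Y k" "y = (a + z) + (b + w)"
    by (auto simp: set_mult_def hclass_def)
  have "y = (a + b) + (z + w)" using ab(3) by (simp add: add.assoc add.left_commute)
  moreover have "a + b \<in> boundaries Y k"
    using boundaries_add[OF Y] ab(1,2) boundaries_mono[OF assms(3)] by blast
  ultimately show "y \<in> hclass Y k (z + w)" unfolding hclass_def by (rule image_eqI)
next
  fix y assume "y \<in> hclass Y k (z + w)"
  then obtain b where b: "b \<in> boundaries Y k" "y = b + (z + w)" by (auto simp: hclass_def)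
  have "0 + z \<in> hclass X k z" unfolding hclass_def using boundaries_0[OF X] by (rule imageI)
  moreover have "b + w \<in> hclass Y k w" unfolding hclass_def using b(1) by (rule imageI)
  moreover have "y = (0 + z) + (b + w)" using b(2) by (simp add: add.left_commute)
  ultimately show "y \<in> hclass X k z <#>\<^bsub>cycle_group Y k\<^esub> hclass Y k w"
    unfolding set_mult_def by auto
qed

lemma mult_homology:
  "abstract_complex X \<Longrightarrow> hclass X k z \<otimes>\<^bsub>homology X k\<^esub> hclass X k w = hclass X k (z + w)"
  using hclass_set_mult[of X X] by (simp add: homology_def FactGroup_def)

lemma homology_incl_hclass:
  assumes X: "abstract_complex X" and Y: "abstract_complex Y" and "X \<subseteq> Y"
  shows "homology_incl Y k (hclass X k z) = hclass Y k z"
proof -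
  have "hclass Y k 0 = boundaries Y k" by (simp add: hclass_def)
  then show ?thesis using hclass_set_mult[OF assms, of k z 0] by (simp add: homology_incl_def)
qed

section \<open>Isomorphisms of persistence modules\<close>

lemma push_chains:
  assumes f: "inj f" and X: "abstract_complex X" "abstract_complex Z"
    and sub: "(`) f ` X \<subseteq> Z" and c: "c \<in> chains X k"
  shows "push f c \<in> chains Z k"
proof -
  have "push f c \<in> fchains ((`) f ` {\<sigma>\<in>insert {} X. card \<sigma> = Suc k})"
    using c unfolding chains_eq[OF X(1)] by (rule push_in_fchains[OF f])
  moreover have "(`) f ` {\<sigma>\<in>insert {} X. card \<sigma> = Suc k} \<subseteq> {\<sigma>\<in>insert {} Z. card \<sigma> = Suc k}"
    using sub card_image[OF inj_on_subset[OF f subset_UNIV]] by auto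
  ultimately show ?thesis unfolding chains_eq[OF X(2)] by (rule fchains_monoD)
qed

lemma push_cycles:
  assumes f: "inj f" and X: "abstract_complex X" "abstract_complex Z"
    and sub: "(`) f ` X \<subseteq> Z" and c: "c \<in> cycles X k"
  shows "push f c \<in> cycles Z k"
proof -
  have c': "c \<in> chains X k" "boundary c = 0" using c by (simp_all add: cycles_def)
  have p: "push f c \<in> chains Z k" by (rule push_chains[OF f X sub c'(1)])
  note fc = c'(1)[unfolded chains_eq[OF X(1)]] and fp = p[unfolded chains_eq[OF X(2)]]
  have "bd (push f c) \<sigma> = 0" if "\<sigma> \<noteq> {}" for \<sigma>
  proof (rule ccontr)
    assume "bd (push f c) \<sigma> \<noteq> 0"
    then have "push f (bd c) \<sigma> \<noteq> 0" unfolding bd_push[OF f fc] .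
    then obtain \<tau> where \<tau>: "\<sigma> = f ` \<tau>" "bd c \<tau> \<noteq> 0" by (rule push_nonzeroE)
    then have "\<tau> \<noteq> {}" using \<open>\<sigma> \<noteq> {}\<close> by blast
    then show False using \<tau>(2) c'(2) unfolding boundary_zero_iff[OF fc] by blast
  qed
  then have "boundary (push f c) = 0" unfolding boundary_zero_iff[OF fp] by blast
  then show ?thesis using p by (simp add: cycles_def)
qed

lemma push_boundaries:
  assumes f: "inj f" and X: "abstract_complex X" "abstract_complex Z"
    and sub: "(`) f ` X \<subseteq> Z" and c: "c \<in> boundaries X k"
  shows "push f c \<in> boundaries Z k"
proof -
  obtain d where d: "d \<in> chains X (Suc k)" "c = bd d"
    using c unfolding boundaries_eq[OF X(1)] by blast
  have "push f c = bd (push f d)"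
    unfolding d(2) by (rule bd_push[OF f d(1)[unfolded chains_eq[OF X(1)]], symmetric])
  then show ?thesis
    unfolding boundaries_eq[OF X(2)] using push_chains[OF f X sub d(1)] by (rule image_eqI)
qed

text \<open>A filling of \<open>push f y\<close> in \<open>Z\<close> yields one in \<open>X\<close>
  by \<open>rel_acyclic_boundary\<close>. It may have mixed dimensions, but its part with
  \<open>k + 2\<close> vertices already has boundary \<open>y\<close>.\<close>

lemma rel_acyclic_homology_injective:
  assumes f: "inj f" and X: "abstract_complex X" "abstract_complex Z"
    and rel: "rel_acyclic (insert {} Z) ((`) f ` insert {} X)"
    and y: "y \<in> chains X k" and b: "push f y \<in> boundaries Z k"
  shows "y \<in> boundaries X k"
proof -
  obtain d where d: "d \<in> chains Z (Suc k)" "push f y = bd d"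
    using b unfolding boundaries_eq[OF X(2)] by blast
  have dZ: "d \<in> fchains (insert {} Z)"
    by (rule fchains_monoD[OF d(1)[unfolded chains_eq[OF X(2)]]]) blast
  note y' = y[unfolded chains_eq[OF X(1)]]
  have yX: "y \<in> fchains (insert {} X)" by (rule fchains_monoD[OF y']) blast
  have "bd d \<in> fchains ((`) f ` insert {} X)"
    unfolding d(2)[symmetric] by (rule push_in_fchains[OF f yX])
  from rel_acyclic_boundary[OF rel down_closed_complex[OF X(2)] dZ this]
  obtain e where e: "e \<in> fchains ((`) f ` insert {} X)" "bd e = bd d" .
  obtain e1 where e1: "e1 \<in> fchains (insert {} X)" "e = push f e1" using fchains_image[OF f e(1)] .
  have "push f (bd e1) = push f y" unfolding d(2) e(2)[symmetric] e1(2)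
    by (rule bd_push[OF f e1(1), symmetric])
  then have bde1: "bd e1 = y" by (rule push_inject[OF f])
  have "y = bd (part (Suc (Suc k)) e1)"
    unfolding bd_part[OF e1(1)] bde1 by (rule part_eq[OF y', symmetric])
  moreover have "part (Suc (Suc k)) e1 \<in> chains X (Suc k)"
    unfolding chains_eq[OF X(1)] by (rule part_in_fchains[OF e1(1)])
  ultimately show ?thesis unfolding boundaries_eq[OF X(1)] by (rule image_eqI)
qed

text \<open>The augmented boundary of an unreduced cycle is supported on the empty simplex, which
  belongs to the copy of \<open>X\<close>. So the cycle is a relative cycle, and the reduced notion
  yields unreduced homology also in degree 0.\<close>

lemma rel_acyclic_homology_surjective:
  assumes f: "inj f" and X: "abstract_complex X" "abstract_complex Z"
    and sub: "(`) f ` X \<subseteq> Z"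
    and rel: "rel_acyclic (insert {} Z) ((`) f ` insert {} X)"
    and z: "z \<in> cycles Z k"
  obtains y where "y \<in> cycles X k" "z + push f y \<in> boundaries Z k"
proof -
  have z': "z \<in> chains Z k" "boundary z = 0" using z by (simp_all add: cycles_def)
  note zk = z'(1)[unfolded chains_eq[OF X(2)]]
  have zZ: "z \<in> fchains (insert {} Z)" by (rule fchains_monoD[OF zk]) blast
  have bz: "bd z \<tau> = 0" if "\<tau> \<noteq> {}" for \<tau>
    using that z'(2) unfolding boundary_zero_iff[OF zZ] by blast
  have bdz: "bd z \<in> fchains ((`) f ` insert {} X)"
  proof -
    have "supp (bd z) \<subseteq> {{}}"
    proof
      fix \<tau> assume "\<tau> \<in> supp (bd z)"
      then show "\<tau> \<in> {{}}" using bz[of \<tau>] unfolding supp_iff by blast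
    qed
    then have "supp (bd z) \<subseteq> (`) f ` insert {} X" by blast
    then show ?thesis
      by (rule fchains_subset_supp[OF bd_in_fchains[OF zZ down_closed_complex[OF X(2)]]])
  qed
  obtain d where d: "d \<in> fchains (insert {} Z)" "z + bd d \<in> fchains ((`) f ` insert {} X)"
    using rel_acyclicE[OF rel zZ bdz] .
  let ?d = "part (Suc (Suc k)) d"
  have dk: "?d \<in> chains Z (Suc k)"
    unfolding chains_eq[OF X(2)] by (rule part_in_fchains[OF d(1)])
  have "part (Suc k) (z + bd d) = z + bd ?d"
    unfolding part_add part_eq[OF zk] bd_part[OF d(1)] ..
  then have "z + bd ?d \<in> fchains {\<sigma>\<in>(`) f ` insert {} X. card \<sigma> = Suc k}"
    using part_in_fchains[OF d(2), of "Suc k"] by (simp only:)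
  moreover have "{\<sigma>\<in>(`) f ` insert {} X. card \<sigma> = Suc k} = (`) f ` {\<sigma>\<in>insert {} X. card \<sigma> = Suc k}"
    using card_image[OF inj_on_subset[OF f subset_UNIV]] by auto
  ultimately have "z + bd ?d \<in> fchains ((`) f ` {\<sigma>\<in>insert {} X. card \<sigma> = Suc k})" by (simp only:)
  from fchains_image[OF f this]
  obtain y where y: "y \<in> fchains {\<sigma>\<in>insert {} X. card \<sigma> = Suc k}" "z + bd ?d = push f y" .
  have yX: "y \<in> chains X k" unfolding chains_eq[OF X(1)] by (rule y(1))
  have bdd: "bd ?d \<in> boundaries Z k" unfolding boundaries_eq[OF X(2)] using dk by (rule imageI)
  have "bd y \<tau> = 0" if "\<tau> \<noteq> {}" for \<tau>
  proof -
    have "push f (bd y) = bd (z + bd ?d)" unfolding y(2) by (rule bd_push[OF f y(1), symmetric])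
    also have "\<dots> = bd z + bd (bd ?d)"
      using boundary_chains_Suc(2)[OF X(2) dk] unfolding chains_eq[OF X(2)] by (rule bd_add[OF zk])
    also have "bd (bd ?d) = 0" using dk unfolding chains_eq[OF X(2)] by (rule bd_bd)
    finally have "push f (bd y) = bd z" by simp
    then have "bd y \<tau> = bd z (f ` \<tau>)" using push_image[OF f] by metis
    also have "\<dots> = 0" by (rule bz) (use that in simp)
    finally show ?thesis .
  qed
  then have "boundary y = 0" unfolding boundary_zero_iff[OF y(1)] by blast
  then have "y \<in> cycles X k" using yX by (simp add: cycles_def)
  moreover have "z + push f y = bd ?d" unfolding y(2)[symmetric] by simp
  then have "z + push f y \<in> boundaries Z k" using bdd by simp
  ultimately show ?thesis by (rule that)
qed

text \<open>The union over all representatives avoids choosing one: all of them give the same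
  class.\<close>

definition push_hclass :: "('a \<Rightarrow> 'b) \<Rightarrow> 'b set set \<Rightarrow> nat \<Rightarrow> ('a set \<Rightarrow> bit) set \<Rightarrow> ('b set \<Rightarrow> bit) set" where
  "push_hclass f Z k C = (\<Union>y\<in>C. hclass Z k (push f y))"

lemma push_hclass:
  assumes f: "inj f" and X: "abstract_complex X" "abstract_complex Z"
    and sub: "(`) f ` X \<subseteq> Z"
  shows "push_hclass f Z k (hclass X k z) = hclass Z k (push f z)"
proof -
  have "hclass Z k (push f y) = hclass Z k (push f z)" if "y \<in> hclass X k z" for y
  proof -
    obtain b where b: "b \<in> boundaries X k" "y = b + z" using \<open>y \<in> hclass X k z\<close> unfolding hclass_def by blast
    have "push f y + push f z = push f b" unfolding b(2) push_add by (simp add: add.assoc)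
    then show ?thesis
      unfolding hclass_eq_iff[OF X(2)] using push_boundaries[OF f X sub b(1)] by simp
  qed
  moreover have "hclass X k z \<noteq> {}" unfolding hclass_def using boundaries_0[OF X(1)] by blast
  ultimately show ?thesis unfolding push_hclass_def by auto
qed

lemma push_hclass_iso:
  assumes f: "inj f" and X: "abstract_complex X" "abstract_complex Z"
    and sub: "(`) f ` X \<subseteq> Z"
    and rel: "rel_acyclic (insert {} Z) ((`) f ` insert {} X)"
  shows "push_hclass f Z k \<in> iso (homology X k) (homology Z k)"
proof -
  let ?h = "push_hclass f Z k"
  note h = push_hclass[OF f X sub]
  note pc = push_cycles[OF f X sub]
  have "?h \<in> hom (homology X k) (homology Z k)"
    unfolding hom_def carrier_homology
    by (auto simp: h pc mult_homology X push_add)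
  moreover have "inj_on ?h (hclass X k ` cycles X k)"
  proof (rule inj_onI)
    fix C D assume "C \<in> hclass X k ` cycles X k" "D \<in> hclass X k ` cycles X k" and eq: "?h C = ?h D"
    then obtain z w where zw: "z \<in> cycles X k" "w \<in> cycles X k" "C = hclass X k z" "D = hclass X k w"
      by blast
    have "push f (z + w) \<in> boundaries Z k"
      using eq unfolding zw(3,4) h hclass_eq_iff[OF X(2)] push_add .
    moreover have "z + w \<in> chains X k" using cycles_add[OF X(1) zw(1,2)] by (simp add: cycles_def)
    ultimately have "z + w \<in> boundaries X k"
      using rel_acyclic_homology_injective[OF f X rel] by blast
    then show "C = D" unfolding zw(3,4) hclass_eq_iff[OF X(1)] .
  qed
  moreover have "?h ` hclass X k ` cycles X k = hclass Z k ` cycles Z k"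
  proof (intro equalityI subsetI)
    fix D assume "D \<in> hclass Z k ` cycles Z k"
    then obtain z where z: "z \<in> cycles Z k" "D = hclass Z k z" by blast
    obtain y where y: "y \<in> cycles X k" "z + push f y \<in> boundaries Z k"
      using rel_acyclic_homology_surjective[OF f X sub rel z(1)] .
    have "D = ?h (hclass X k y)" unfolding z(2) h hclass_eq_iff[OF X(2)] by (rule y(2))
    then show "D \<in> ?h ` hclass X k ` cycles X k" using y(1) by blast
  qed (auto simp: h pc)
  ultimately show ?thesis unfolding iso_def bij_betw_def carrier_homology by blast
qed

section \<open>Persistence modules: composition and inversion of isomorphisms, equality of
  barcodes\<close>

lemma pers_iso_trans:
  assumes "pers_iso M N" "pers_iso N P"
  shows "pers_iso M P"
proof -
  obtain h where h: "\<And>\<alpha>. 0 \<le> \<alpha> \<Longrightarrow> h \<alpha> \<in> iso (spc M \<alpha>) (spc N \<alpha>)"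
    "\<And>\<alpha> \<beta> x. 0 \<le> \<alpha> \<Longrightarrow> \<alpha> \<le> \<beta> \<Longrightarrow> x \<in> carrier (spc M \<alpha>) \<Longrightarrow> h \<beta> (trn M \<alpha> \<beta> x) = trn N \<alpha> \<beta> (h \<alpha> x)"
    using assms(1) unfolding pers_iso_def by blast
  obtain g where g: "\<And>\<alpha>. 0 \<le> \<alpha> \<Longrightarrow> g \<alpha> \<in> iso (spc N \<alpha>) (spc P \<alpha>)"
    "\<And>\<alpha> \<beta> x. 0 \<le> \<alpha> \<Longrightarrow> \<alpha> \<le> \<beta> \<Longrightarrow> x \<in> carrier (spc N \<alpha>) \<Longrightarrow> g \<beta> (trn N \<alpha> \<beta> x) = trn P \<alpha> \<beta> (g \<alpha> x)"
    using assms(2) unfolding pers_iso_def by blast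
  have "(g \<alpha> \<circ> h \<alpha>) \<in> iso (spc M \<alpha>) (spc P \<alpha>)" if "0 \<le> \<alpha>" for \<alpha>
  proof -
    have "h \<alpha> \<in> hom (spc M \<alpha>) (spc N \<alpha>)" "g \<alpha> \<in> hom (spc N \<alpha>) (spc P \<alpha>)"
      and "bij_betw (h \<alpha>) (carrier (spc M \<alpha>)) (carrier (spc N \<alpha>))"
        "bij_betw (g \<alpha>) (carrier (spc N \<alpha>)) (carrier (spc P \<alpha>))"
      using h(1)[OF that] g(1)[OF that] by (simp_all add: iso_def)
    then show ?thesis unfolding iso_def by (simp add: Group.hom_compose bij_betw_trans)
  qed
  moreover have "(g \<beta> \<circ> h \<beta>) (trn M \<alpha> \<beta> x) = trn P \<alpha> \<beta> ((g \<alpha> \<circ> h \<alpha>) x)"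
    if "0 \<le> \<alpha>" "\<alpha> \<le> \<beta>" "x \<in> carrier (spc M \<alpha>)" for \<alpha> \<beta> x
  proof -
    have "h \<alpha> x \<in> carrier (spc N \<alpha>)"
      using h(1)[OF that(1)] that(3) by (auto simp: iso_def hom_def)
    then show ?thesis using h(2)[OF that] g(2)[OF that(1,2)] by simp
  qed
  ultimately show ?thesis unfolding pers_iso_def by (intro exI[of _ "\<lambda>\<alpha>. g \<alpha> \<circ> h \<alpha>"]) blast
qed

text \<open>A \<open>pers_module\<close> is raw data without axioms. To invert \<open>h\<close> on a
  product or on the image of a structure map, that element must be known to lie in the carrier of
  \<open>M\<close>; the two closure hypotheses say so.\<close>

lemma pers_iso_sym:
  assumes iso: "pers_iso M N"
    and mult: "\<And>\<alpha> x y. 0 \<le> \<alpha> \<Longrightarrow> x \<in> carrier (spc M \<alpha>) \<Longrightarrow> y \<in> carrier (spc M \<alpha>) \<Longrightarrow>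
      x \<otimes>\<^bsub>spc M \<alpha>\<^esub> y \<in> carrier (spc M \<alpha>)"
    and trn: "\<And>\<alpha> \<beta> x. 0 \<le> \<alpha> \<Longrightarrow> \<alpha> \<le> \<beta> \<Longrightarrow> x \<in> carrier (spc M \<alpha>) \<Longrightarrow>
      trn M \<alpha> \<beta> x \<in> carrier (spc M \<beta>)"
  shows "pers_iso N M"
proof -
  obtain h where h: "\<And>\<alpha>. 0 \<le> \<alpha> \<Longrightarrow> h \<alpha> \<in> iso (spc M \<alpha>) (spc N \<alpha>)"
    "\<And>\<alpha> \<beta> x. 0 \<le> \<alpha> \<Longrightarrow> \<alpha> \<le> \<beta> \<Longrightarrow> x \<in> carrier (spc M \<alpha>) \<Longrightarrow> h \<beta> (trn M \<alpha> \<beta> x) = trn N \<alpha> \<beta> (h \<alpha> x)"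
    using iso unfolding pers_iso_def by blast
  define g where "g = (\<lambda>\<alpha>. inv_into (carrier (spc M \<alpha>)) (h \<alpha>))"
  have bij: "bij_betw (h \<alpha>) (carrier (spc M \<alpha>)) (carrier (spc N \<alpha>))"
    and hmult: "\<And>x y. x \<in> carrier (spc M \<alpha>) \<Longrightarrow> y \<in> carrier (spc M \<alpha>) \<Longrightarrow>
      h \<alpha> (x \<otimes>\<^bsub>spc M \<alpha>\<^esub> y) = h \<alpha> x \<otimes>\<^bsub>spc N \<alpha>\<^esub> h \<alpha> y" if "0 \<le> \<alpha>" for \<alpha>
    using h(1)[OF that] by (auto simp: iso_def hom_def)
  have g_in: "g \<alpha> y \<in> carrier (spc M \<alpha>)" and hg: "h \<alpha> (g \<alpha> y) = y"
    if "0 \<le> \<alpha>" "y \<in> carrier (spc N \<alpha>)" for \<alpha> y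
  proof -
    have "y \<in> h \<alpha> ` carrier (spc M \<alpha>)" using bij[OF that(1)] that(2) by (simp add: bij_betw_def)
    then show "g \<alpha> y \<in> carrier (spc M \<alpha>)" "h \<alpha> (g \<alpha> y) = y"
      unfolding g_def by (rule inv_into_into, rule f_inv_into_f)
  qed
  have gh: "g \<alpha> (h \<alpha> x) = x" if "0 \<le> \<alpha>" "x \<in> carrier (spc M \<alpha>)" for \<alpha> x
    unfolding g_def using bij[OF that(1)] that(2) by (intro inv_into_f_f) (simp_all add: bij_betw_def)
  have "g \<alpha> \<in> iso (spc N \<alpha>) (spc M \<alpha>)" if \<alpha>: "0 \<le> \<alpha>" for \<alpha>
  proof -
    have "bij_betw (g \<alpha>) (carrier (spc N \<alpha>)) (carrier (spc M \<alpha>))"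
      unfolding g_def by (rule bij_betw_inv_into[OF bij[OF \<alpha>]])
    moreover have "g \<alpha> (x \<otimes>\<^bsub>spc N \<alpha>\<^esub> y) = g \<alpha> x \<otimes>\<^bsub>spc M \<alpha>\<^esub> g \<alpha> y"
      if xy: "x \<in> carrier (spc N \<alpha>)" "y \<in> carrier (spc N \<alpha>)" for x y
    proof -
      note gx = g_in[OF \<alpha> xy(1)] and gy = g_in[OF \<alpha> xy(2)]
      have "h \<alpha> (g \<alpha> x \<otimes>\<^bsub>spc M \<alpha>\<^esub> g \<alpha> y) = x \<otimes>\<^bsub>spc N \<alpha>\<^esub> y"
        unfolding hmult[OF \<alpha> gx gy] hg[OF \<alpha> xy(1)] hg[OF \<alpha> xy(2)] ..
      then show ?thesis using gh[OF \<alpha> mult[OF \<alpha> gx gy]] by metis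
    qed
    ultimately show ?thesis using g_in[OF \<alpha>] unfolding iso_def hom_def by blast
  qed
  moreover have "g \<beta> (trn N \<alpha> \<beta> y) = trn M \<alpha> \<beta> (g \<alpha> y)"
    if \<alpha>: "0 \<le> \<alpha>" "\<alpha> \<le> \<beta>" and y: "y \<in> carrier (spc N \<alpha>)" for \<alpha> \<beta> y
  proof -
    have \<beta>: "0 \<le> \<beta>" using \<alpha> by linarith
    note gy = g_in[OF \<alpha>(1) y]
    have "trn N \<alpha> \<beta> y = h \<beta> (trn M \<alpha> \<beta> (g \<alpha> y))"
      unfolding h(2)[OF \<alpha> gy] hg[OF \<alpha>(1) y] ..
    then show ?thesis using gh[OF \<beta> trn[OF \<alpha> gy]] by metis
  qed
  ultimately show ?thesis unfolding pers_iso_def by blast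
qed

lemma homology_module_simps [simp]:
  "spc (homology_module F k) = (\<lambda>\<alpha>. homology (F \<alpha>) k)"
  "trn (homology_module F k) = (\<lambda>\<alpha> \<beta>. homology_incl (F \<beta>) k)"
  by (simp_all add: homology_module_def)

lemma pers_iso_homology_sym:
  assumes X: "\<And>\<alpha>. 0 \<le> \<alpha> \<Longrightarrow> abstract_complex (F \<alpha>)"
    and mono: "\<And>\<alpha> \<beta>. 0 \<le> \<alpha> \<Longrightarrow> \<alpha> \<le> \<beta> \<Longrightarrow> F \<alpha> \<subseteq> F \<beta>"
    and iso: "pers_iso (homology_module F k) N"
  shows "pers_iso N (homology_module F k)"
proof (rule pers_iso_sym[OF iso], unfold homology_module_simps carrier_homology)
  fix \<alpha> :: real and x y assume \<alpha>: "0 \<le> \<alpha>"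
    and "x \<in> hclass (F \<alpha>) k ` cycles (F \<alpha>) k" "y \<in> hclass (F \<alpha>) k ` cycles (F \<alpha>) k"
  then show "x \<otimes>\<^bsub>homology (F \<alpha>) k\<^esub> y \<in> hclass (F \<alpha>) k ` cycles (F \<alpha>) k"
    using mult_homology[OF X[OF \<alpha>]] cycles_add[OF X[OF \<alpha>]] by fastforce
next
  fix \<alpha> \<beta> :: real and x assume \<alpha>: "0 \<le> \<alpha>" "\<alpha> \<le> \<beta>" and "x \<in> hclass (F \<alpha>) k ` cycles (F \<alpha>) k"
  then obtain z where z: "z \<in> cycles (F \<alpha>) k" "x = hclass (F \<alpha>) k z" by blast
  have "0 \<le> \<beta>" using \<alpha> by linarith
  then have "homology_incl (F \<beta>) k x = hclass (F \<beta>) k z"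
    unfolding z(2) using homology_incl_hclass X \<alpha>(1) mono[OF \<alpha>] by blast
  then show "homology_incl (F \<beta>) k x \<in> hclass (F \<beta>) k ` cycles (F \<beta>) k"
    using z(1) cycles_mono[OF mono[OF \<alpha>]] by blast
qed

text \<open>The map \<open>f\<close> is the same at all parameters, so both ways around the square
  send the class of \<open>z\<close> to the class of \<open>push f z\<close>.\<close>

lemma pers_iso_push:
  assumes f: "inj f"
    and X: "\<And>\<alpha>. 0 \<le> \<alpha> \<Longrightarrow> abstract_complex (F \<alpha>)" "\<And>\<alpha>. 0 \<le> \<alpha> \<Longrightarrow> abstract_complex (Z \<alpha>)"
    and mono: "\<And>\<alpha> \<beta>. 0 \<le> \<alpha> \<Longrightarrow> \<alpha> \<le> \<beta> \<Longrightarrow> F \<alpha> \<subseteq> F \<beta>" "\<And>\<alpha> \<beta>. 0 \<le> \<alpha> \<Longrightarrow> \<alpha> \<le> \<beta> \<Longrightarrow> Z \<alpha> \<subseteq> Z \<beta>"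
    and sub: "\<And>\<alpha>. 0 \<le> \<alpha> \<Longrightarrow> (`) f ` F \<alpha> \<subseteq> Z \<alpha>"
    and rel: "\<And>\<alpha>. 0 \<le> \<alpha> \<Longrightarrow> rel_acyclic (insert {} (Z \<alpha>)) ((`) f ` insert {} (F \<alpha>))"
  shows "pers_iso (homology_module F k) (homology_module Z k)"
proof -
  have "push_hclass f (Z \<beta>) k (homology_incl (F \<beta>) k x) = homology_incl (Z \<beta>) k (push_hclass f (Z \<alpha>) k x)"
    if \<alpha>: "0 \<le> \<alpha>" "\<alpha> \<le> \<beta>" and x: "x \<in> carrier (homology (F \<alpha>) k)" for \<alpha> \<beta> x
  proof -
    obtain z where z: "x = hclass (F \<alpha>) k z" using x unfolding carrier_homology by blast
    have \<beta>: "0 \<le> \<beta>" using \<alpha> by linarith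
    show ?thesis
      unfolding z homology_incl_hclass[OF X(1)[OF \<alpha>(1)] X(1)[OF \<beta>] mono(1)[OF \<alpha>]]
        push_hclass[OF f X(1)[OF \<alpha>(1)] X(2)[OF \<alpha>(1)] sub[OF \<alpha>(1)]]
        push_hclass[OF f X(1)[OF \<beta>] X(2)[OF \<beta>] sub[OF \<beta>]]
        homology_incl_hclass[OF X(2)[OF \<alpha>(1)] X(2)[OF \<beta>] mono(2)[OF \<alpha>]] ..
  qed
  moreover have "push_hclass f (Z \<alpha>) k \<in> iso (homology (F \<alpha>) k) (homology (Z \<alpha>) k)" if "0 \<le> \<alpha>" for \<alpha>
    by (rule push_hclass_iso[OF f X(1)[OF that] X(2)[OF that] sub[OF that] rel[OF that]])
  ultimately show ?thesis unfolding pers_iso_def homology_module_simps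
    by (intro exI[of _ "\<lambda>\<alpha>. push_hclass f (Z \<alpha>) k"]) blast
qed

text \<open>Isomorphic modules have the same predicate \<open>is_barcode\<close>, so both barcodes
  are the same definite description.\<close>

lemma barcode_cong:
  assumes "pers_iso M N" "pers_iso N M"
  shows "barcode M = barcode N"
proof -
  have "is_barcode M m \<longleftrightarrow> is_barcode N m" for m
    unfolding is_barcode_def using pers_iso_trans[OF assms(1)] pers_iso_trans[OF assms(2)] by blast
  then have "is_barcode M = is_barcode N" by (rule ext)
  then show ?thesis unfolding barcode_def by (rule arg_cong)
qed

section \<open>The join of a cover with its nerve\<close>

text \<open>The witness \<sigma> is kept apart from the left part of \<rho>, which may be empty. Its
  membership in the union is stated explicitly because the condition on the indices is vacuous when
  \<rho> has no nerve vertices.\<close>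

definition join_complex :: "nat \<Rightarrow> (nat \<Rightarrow> 'a set set) \<Rightarrow> ('a + nat) set set" where
  "join_complex n V = {\<rho>. \<rho> \<noteq> {} \<and>
     (\<exists>\<sigma>\<in>(\<Union>i\<in>{0..n}. V i). Inl -` \<rho> \<subseteq> \<sigma> \<and> Inr -` \<rho> \<subseteq> {i\<in>{0..n}. \<sigma> \<in> V i})}"

lemma join_complexI:
  assumes "\<rho> \<noteq> {}" "\<sigma> \<in> (\<Union>i\<in>{0..n}. V i)" "Inl -` \<rho> \<subseteq> \<sigma>" "Inr -` \<rho> \<subseteq> {i\<in>{0..n}. \<sigma> \<in> V i}"
  shows "\<rho> \<in> join_complex n V"
  using assms unfolding join_complex_def by blast

lemma join_complexE:
  assumes "\<rho> \<in> join_complex n V"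
  obtains \<sigma> where "\<rho> \<noteq> {}" "\<sigma> \<in> (\<Union>i\<in>{0..n}. V i)" "Inl -` \<rho> \<subseteq> \<sigma>"
    "Inr -` \<rho> \<subseteq> {i\<in>{0..n}. \<sigma> \<in> V i}"
  using assms unfolding join_complex_def by blast

lemma abstract_complex_join:
  assumes V: "\<And>i. i \<le> n \<Longrightarrow> abstract_complex (V i)"
  shows "abstract_complex (join_complex n V)"
  unfolding abstract_complex_def
proof (intro ballI conjI allI impI)
  fix \<rho> assume "\<rho> \<in> join_complex n V"
  then obtain \<sigma> where \<rho>: "\<rho> \<noteq> {}" "\<sigma> \<in> (\<Union>i\<in>{0..n}. V i)" "Inl -` \<rho> \<subseteq> \<sigma>"
    "Inr -` \<rho> \<subseteq> {i\<in>{0..n}. \<sigma> \<in> V i}" by (rule join_complexE) (rule that)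
  show "\<rho> \<noteq> {}" by (rule \<rho>(1))
  have "finite \<sigma>" using \<rho>(2) V by (auto simp: abstract_complex_def)
  then have "finite (Inl -` \<rho>)" using \<rho>(3) finite_subset by blast
  moreover have "finite (Inr -` \<rho>)" by (rule finite_subset[OF \<rho>(4)]) simp
  moreover have "\<rho> \<subseteq> Inl ` (Inl -` \<rho>) \<union> Inr ` (Inr -` \<rho>)"
  proof
    fix x assume "x \<in> \<rho>"
    then show "x \<in> Inl ` (Inl -` \<rho>) \<union> Inr ` (Inr -` \<rho>)" by (cases x) auto
  qed
  ultimately show "finite \<rho>" by (meson finite_UnI finite_imageI finite_subset)
  fix \<tau> assume \<tau>: "\<tau> \<subseteq> \<rho> \<and> \<tau> \<noteq> {}"
  note mono = order_trans[OF vimage_mono[OF conjunct1[OF \<tau>]]]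
  show "\<tau> \<in> join_complex n V"
    by (rule join_complexI[OF conjunct2[OF \<tau>] \<rho>(2) mono[OF \<rho>(3)] mono[OF \<rho>(4)]])
qed

lemma abstract_complex_Union:
  "(\<And>i. i \<in> I \<Longrightarrow> abstract_complex (V i)) \<Longrightarrow> abstract_complex (\<Union>i\<in>I. V i)"
  unfolding abstract_complex_def by blast

lemma abstract_complex_Inter:
  "(\<And>i. i \<in> I \<Longrightarrow> abstract_complex (V i)) \<Longrightarrow> I \<noteq> {} \<Longrightarrow> abstract_complex (\<Inter>i\<in>I. V i)"
  unfolding abstract_complex_def by blast

lemma abstract_complex_nerve: "abstract_complex (nerve n V)"
  unfolding abstract_complex_def
proof (intro ballI conjI allI impI)
  fix \<sigma> assume \<sigma>: "\<sigma> \<in> nerve n V"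
  then have "\<sigma> \<subseteq> {0..n}" by (simp add: nerve_def)
  then show "finite \<sigma>" by (rule finite_subset) simp
  show "\<sigma> \<noteq> {}" using \<sigma> by (simp add: nerve_def)
  fix \<tau> assume \<tau>: "\<tau> \<subseteq> \<sigma> \<and> \<tau> \<noteq> {}"
  have "(\<Inter>i\<in>\<sigma>. V i) \<subseteq> (\<Inter>i\<in>\<tau>. V i)" using \<tau> by blast
  then show "\<tau> \<in> nerve n V" using \<sigma> \<tau> by (auto simp: nerve_def)
qed

text \<open>Puts the nerve into the shape of \<open>join_complex\<close>, so that it can be
  recognized there as the simplices without vertices of the cover.\<close>

lemma nerve_iff:
  "\<tau> \<in> nerve n V \<longleftrightarrow> \<tau> \<noteq> {} \<and> (\<exists>\<sigma>\<in>(\<Union>i\<in>{0..n}. V i). \<tau> \<subseteq> {i\<in>{0..n}. \<sigma> \<in> V i})"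
proof
  assume "\<tau> \<in> nerve n V"
  then obtain \<sigma> where \<tau>: "\<tau> \<noteq> {}" "\<tau> \<subseteq> {0..n}" "\<And>i. i \<in> \<tau> \<Longrightarrow> \<sigma> \<in> V i"
    unfolding nerve_def by blast
  then have "\<sigma> \<in> (\<Union>i\<in>{0..n}. V i)" "\<tau> \<subseteq> {i\<in>{0..n}. \<sigma> \<in> V i}" by blast+
  then show "\<tau> \<noteq> {} \<and> (\<exists>\<sigma>\<in>(\<Union>i\<in>{0..n}. V i). \<tau> \<subseteq> {i\<in>{0..n}. \<sigma> \<in> V i})" using \<tau>(1) by blast
next
  assume "\<tau> \<noteq> {} \<and> (\<exists>\<sigma>\<in>(\<Union>i\<in>{0..n}. V i). \<tau> \<subseteq> {i\<in>{0..n}. \<sigma> \<in> V i})"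
  then show "\<tau> \<in> nerve n V" unfolding nerve_def by blast
qed

lemma rel_acyclic_join_cover:
  assumes V: "\<And>i. i \<le> n \<Longrightarrow> abstract_complex (V i)"
    and good: "\<And>\<tau>. \<tau> \<noteq> {} \<Longrightarrow> \<tau> \<subseteq> {0..n} \<Longrightarrow> (\<Inter>i\<in>\<tau>. V i) \<noteq> {} \<Longrightarrow>
      acyclic_chains (insert {} (\<Inter>i\<in>\<tau>. V i))"
  shows "rel_acyclic (insert {} (join_complex n V)) ((`) Inl ` insert {} (\<Union>i\<in>{0..n}. V i))"
proof -
  let ?Z = "insert {} (join_complex n V)" and ?W = "\<Union>i\<in>{0..n}. V i"
  have Z: "down_closed ?Z" by (rule down_closed_complex[OF abstract_complex_join[OF V]])
  have W: "abstract_complex ?W" using V by (intro abstract_complex_Union) simp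
  have "{\<rho>\<in>?Z. \<rho> \<inter> range Inr = {}} = (`) Inl ` insert {} ?W"
  proof (intro equalityI subsetI)
    fix \<rho> assume "\<rho> \<in> {\<rho>\<in>?Z. \<rho> \<inter> range Inr = {}}"
    then have \<rho>: "\<rho> \<in> ?Z" "\<rho> \<inter> range Inr = {}" by blast+
    note eq = Inl_part_eq[OF \<rho>(2)]
    show "\<rho> \<in> (`) Inl ` insert {} ?W"
    proof (cases "\<rho> = {}")
      case False
      then have "\<rho> \<in> join_complex n V" using \<rho>(1) by blast
      then obtain \<sigma> where \<sigma>: "\<sigma> \<in> ?W" "Inl -` \<rho> \<subseteq> \<sigma>" by (rule join_complexE) (rule that)
      then have "\<sigma> \<in> insert {} ?W" by blast
      then have "Inl -` \<rho> \<in> insert {} ?W" using \<sigma>(2) by (rule down_closedD[OF down_closed_complex[OF W]])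
      then show ?thesis using eq(1) by blast
    qed simp
  next
    fix \<rho> :: "('a + nat) set" assume "\<rho> \<in> (`) Inl ` insert {} ?W"
    then obtain \<sigma> where \<sigma>: "\<rho> = Inl ` \<sigma>" "\<sigma> = {} \<or> \<sigma> \<in> ?W" by blast
    have "\<rho> \<in> ?Z"
    proof (cases "\<sigma> = {}")
      case False
      then have "\<rho> \<in> join_complex n V" using \<sigma> by (intro join_complexI[of _ \<sigma>]) auto
      then show ?thesis by blast
    qed (simp add: \<sigma>(1))
    then show "\<rho> \<in> {\<rho>\<in>?Z. \<rho> \<inter> range Inr = {}}" using \<sigma>(1) by blast
  qed
  moreover have "rel_acyclic ?Z {\<rho>\<in>?Z. \<rho> \<inter> range Inr = {}}"
  proof (rule rel_acyclic_join[OF Z])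
    fix \<tau> :: "('a + nat) set" assume \<tau>: "\<tau> \<noteq> {}" "\<tau> \<subseteq> range Inr" "\<tau> \<in> ?Z"
    then obtain T where T: "\<tau> = Inr ` T" "T \<noteq> {}" by (auto simp: subset_image_iff)
    have "\<tau> \<in> join_complex n V" using \<tau> by blast
    \<comment> \<open>A witness for \<tau> shows that the intersection over \<open>T\<close> is
      nonempty, as \<open>good\<close> demands.\<close>
    then obtain \<sigma>0 where \<sigma>0: "Inr -` \<tau> \<subseteq> {i\<in>{0..n}. \<sigma>0 \<in> V i}" by (rule join_complexE) (rule that)
    then have Tn: "T \<subseteq> {0..n}" "(\<Inter>i\<in>T. V i) \<noteq> {}" unfolding T(1) Inr_vimage_Inr_image by blast+
    let ?I = "\<Inter>i\<in>T. V i"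
    have I: "abstract_complex ?I" using V Tn(1) T(2) by (intro abstract_complex_Inter) auto
    have "{\<rho>. \<rho> \<inter> range Inr = {} \<and> \<rho> \<union> \<tau> \<in> ?Z} = (`) Inl ` insert {} ?I"
    proof (intro equalityI subsetI)
      fix \<rho> assume "\<rho> \<in> {\<rho>. \<rho> \<inter> range Inr = {} \<and> \<rho> \<union> \<tau> \<in> ?Z}"
      then have \<rho>: "\<rho> \<inter> range Inr = {}" "\<rho> \<union> \<tau> \<in> join_complex n V" using \<tau>(1) by blast+
      note eq = Inl_part_eq[OF \<rho>(1)]
      from \<rho>(2) obtain \<sigma> where \<sigma>: "Inl -` (\<rho> \<union> \<tau>) \<subseteq> \<sigma>" "Inr -` (\<rho> \<union> \<tau>) \<subseteq> {i\<in>{0..n}. \<sigma> \<in> V i}"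
        by (rule join_complexE) (rule that)
      have sub: "Inl -` \<rho> \<subseteq> \<sigma>" using \<sigma>(1) by blast
      have "T \<subseteq> {i\<in>{0..n}. \<sigma> \<in> V i}" using \<sigma>(2) unfolding vimage_Un T(1) Inr_vimage_Inr_image by blast
      then have "\<sigma> \<in> insert {} ?I" by blast
      then have "Inl -` \<rho> \<in> insert {} ?I" using sub by (rule down_closedD[OF down_closed_complex[OF I]])
      then show "\<rho> \<in> (`) Inl ` insert {} ?I" using eq(1) by blast
    next
      fix \<rho> :: "('a + nat) set" assume "\<rho> \<in> (`) Inl ` insert {} ?I"
      then obtain \<sigma> where \<sigma>: "\<rho> = Inl ` \<sigma>" "\<sigma> = {} \<or> \<sigma> \<in> ?I" by blast
      have parts: "Inl -` (\<rho> \<union> \<tau>) = \<sigma>" "Inr -` (\<rho> \<union> \<tau>) = T"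
        unfolding vimage_Un \<sigma>(1) T(1) by simp_all
      \<comment> \<open>The empty simplex of the link is no witness itself; any simplex of the
        nonempty intersection takes its place.\<close>
      obtain \<sigma>' where \<sigma>': "\<sigma> \<subseteq> \<sigma>'" "\<sigma>' \<in> ?I" using \<sigma>(2) Tn(2) by blast
      have "\<rho> \<union> \<tau> \<in> join_complex n V"
      proof (rule join_complexI[of _ \<sigma>'])
        show "\<rho> \<union> \<tau> \<noteq> {}" using \<tau>(1) by blast
        show "\<sigma>' \<in> ?W" using \<sigma>'(2) Tn(1) T(2) by blast
        show "Inl -` (\<rho> \<union> \<tau>) \<subseteq> \<sigma>'" unfolding parts by (rule \<sigma>'(1))
        show "Inr -` (\<rho> \<union> \<tau>) \<subseteq> {i\<in>{0..n}. \<sigma>' \<in> V i}" unfolding parts using \<sigma>'(2) Tn(1) by blast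
      qed
      moreover have "\<rho> \<inter> range Inr = {}" unfolding \<sigma>(1) by blast
      ultimately show "\<rho> \<in> {\<rho>. \<rho> \<inter> range Inr = {} \<and> \<rho> \<union> \<tau> \<in> ?Z}" by blast
    qed
    moreover have "acyclic_chains ((`) (Inl :: 'a \<Rightarrow> 'a + nat) ` insert {} ?I)"
      by (rule acyclic_chains_image[OF _ good[OF T(2) Tn]]) simp
    ultimately show "acyclic_chains {\<rho>. \<rho> \<inter> range Inr = {} \<and> \<rho> \<union> \<tau> \<in> ?Z}" by simp
  qed
  ultimately show ?thesis by simp
qed

lemma rel_acyclic_join_nerve:
  assumes V: "\<And>i. i \<le> n \<Longrightarrow> abstract_complex (V i)"
  shows "rel_acyclic (insert {} (join_complex n V)) ((`) Inr ` insert {} (nerve n V))"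
proof -
  let ?Z = "insert {} (join_complex n V)" and ?W = "\<Union>i\<in>{0..n}. V i"
  have Z: "down_closed ?Z" by (rule down_closed_complex[OF abstract_complex_join[OF V]])
  have "{\<rho>\<in>?Z. \<rho> \<inter> range Inl = {}} = (`) Inr ` insert {} (nerve n V)"
  proof (intro equalityI subsetI)
    fix \<rho> assume "\<rho> \<in> {\<rho>\<in>?Z. \<rho> \<inter> range Inl = {}}"
    then have \<rho>: "\<rho> \<in> ?Z" "\<rho> \<inter> range Inl = {}" by blast+
    note eq = Inr_part_eq[OF \<rho>(2)]
    show "\<rho> \<in> (`) Inr ` insert {} (nerve n V)"
    proof (cases "\<rho> = {}")
      case False
      then have "\<rho> \<in> join_complex n V" using \<rho>(1) by blast
      then obtain \<sigma> where \<sigma>: "\<sigma> \<in> ?W" "Inr -` \<rho> \<subseteq> {i\<in>{0..n}. \<sigma> \<in> V i}" by (rule join_complexE) (rule that)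
      moreover have "Inr -` \<rho> \<noteq> {}" using eq(1) False by blast
      ultimately have "Inr -` \<rho> \<in> nerve n V" unfolding nerve_iff by blast
      then show ?thesis using eq(1) by blast
    qed simp
  next
    fix \<rho> :: "('a + nat) set" assume "\<rho> \<in> (`) Inr ` insert {} (nerve n V)"
    then obtain T where T: "\<rho> = Inr ` T" "T = {} \<or> T \<in> nerve n V" by blast
    have "\<rho> \<in> ?Z"
    proof (cases "T = {}")
      case False
      then obtain \<sigma> where \<sigma>: "\<sigma> \<in> ?W" "T \<subseteq> {i\<in>{0..n}. \<sigma> \<in> V i}" using T(2) unfolding nerve_iff by blast
      then have "\<rho> \<in> join_complex n V"
        using False by (intro join_complexI[of _ \<sigma>]) (simp_all add: T(1))
      then show ?thesis by blast
    qed (simp add: T(1))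
    then show "\<rho> \<in> {\<rho>\<in>?Z. \<rho> \<inter> range Inl = {}}" using T(1) by blast
  qed
  moreover have "rel_acyclic ?Z {\<rho>\<in>?Z. \<rho> \<inter> range Inl = {}}"
  proof (rule rel_acyclic_join[OF Z])
    fix \<tau> :: "('a + nat) set" assume \<tau>: "\<tau> \<noteq> {}" "\<tau> \<subseteq> range Inl" "\<tau> \<in> ?Z"
    then obtain \<sigma> where \<sigma>: "\<tau> = Inl ` \<sigma>" "\<sigma> \<noteq> {}" by (auto simp: subset_image_iff)
    have face: "\<sigma> \<in> V i" if "\<sigma>' \<in> V i" "\<sigma> \<subseteq> \<sigma>'" "i \<le> n" for i \<sigma>'
      using V[OF that(3)] that(1,2) \<sigma>(2) unfolding abstract_complex_def by blast
    have "\<tau> \<in> join_complex n V" using \<tau> by blast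
    then obtain \<sigma>' where \<sigma>': "\<sigma>' \<in> ?W" "Inl -` \<tau> \<subseteq> \<sigma>'" by (rule join_complexE) (rule that)
    then obtain j where "j \<le> n" "\<sigma>' \<in> V j" "\<sigma> \<subseteq> \<sigma>'" by (auto simp: \<sigma>(1))
    then have j: "j \<le> n" "\<sigma> \<in> V j" using face by blast+
    show "acyclic_chains {\<rho>. \<rho> \<inter> range Inl = {} \<and> \<rho> \<union> \<tau> \<in> ?Z}"
    proof (rule acyclic_chains_cone[where w = "Inr j"])
      fix \<rho> assume "\<rho> \<in> {\<rho>. \<rho> \<inter> range Inl = {} \<and> \<rho> \<union> \<tau> \<in> ?Z}"
      then have \<rho>: "\<rho> \<inter> range Inl = {}" "\<rho> \<union> \<tau> \<in> join_complex n V" using \<tau>(1) by blast+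
      from \<rho>(2) obtain \<pi> where \<pi>: "Inl -` (\<rho> \<union> \<tau>) \<subseteq> \<pi>" "Inr -` (\<rho> \<union> \<tau>) \<subseteq> {i\<in>{0..n}. \<pi> \<in> V i}"
        by (rule join_complexE) (rule that)
      have "\<sigma> \<subseteq> \<pi>" using \<pi>(1) unfolding vimage_Un \<sigma>(1) Inl_vimage_Inl_image by blast
      \<comment> \<open>The old witness \<pi> contains \<sigma>, so by passing to faces \<sigma>
        lies in every cover element that was required to contain \<pi>. With \<sigma> as the new
        witness, the index \<open>j\<close> can be added as well.\<close>
      have "insert (Inr j) \<rho> \<union> \<tau> \<in> join_complex n V"
      proof (rule join_complexI[of _ \<sigma>])
        show "\<sigma> \<in> ?W" using j by auto
        show "Inl -` (insert (Inr j) \<rho> \<union> \<tau>) \<subseteq> \<sigma>"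
          unfolding \<sigma>(1) using \<rho>(1) by auto
        show "Inr -` (insert (Inr j) \<rho> \<union> \<tau>) \<subseteq> {i\<in>{0..n}. \<sigma> \<in> V i}"
        proof
          fix i assume "i \<in> Inr -` (insert (Inr j) \<rho> \<union> \<tau>)"
          then have "i = j \<or> i \<in> Inr -` (\<rho> \<union> \<tau>)" by blast
          then show "i \<in> {i\<in>{0..n}. \<sigma> \<in> V i}"
          proof
            assume "i \<in> Inr -` (\<rho> \<union> \<tau>)"
            then have "i \<le> n" "\<pi> \<in> V i" using \<pi>(2) by auto
            then show ?thesis using face[OF _ \<open>\<sigma> \<subseteq> \<pi>\<close>] by simp
          qed (use j in simp)
        qed
      qed simp
      then show "insert (Inr j) \<rho> \<in> {\<rho>. \<rho> \<inter> range Inl = {} \<and> \<rho> \<union> \<tau> \<in> ?Z}"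
        using \<rho>(1) by blast
    qed
  qed
  ultimately show ?thesis by simp
qed

lemma join_complex_mono:
  assumes "\<And>i. i \<le> n \<Longrightarrow> V i \<subseteq> V' i"
  shows "join_complex n V \<subseteq> join_complex n V'"
proof
  fix \<rho> assume "\<rho> \<in> join_complex n V"
  then obtain \<sigma> where \<rho>: "\<rho> \<noteq> {}" "\<sigma> \<in> (\<Union>i\<in>{0..n}. V i)" "Inl -` \<rho> \<subseteq> \<sigma>"
    "Inr -` \<rho> \<subseteq> {i\<in>{0..n}. \<sigma> \<in> V i}" by (rule join_complexE) (rule that)
  obtain j where "j \<le> n" "\<sigma> \<in> V j" using \<rho>(2) by auto
  then have "\<sigma> \<in> (\<Union>i\<in>{0..n}. V' i)" using assms[of j] by auto
  moreover have "Inr -` \<rho> \<subseteq> {i\<in>{0..n}. \<sigma> \<in> V' i}"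
  proof
    fix i assume "i \<in> Inr -` \<rho>"
    then have "i \<le> n" "\<sigma> \<in> V i" using \<rho>(4) by auto
    then show "i \<in> {i\<in>{0..n}. \<sigma> \<in> V' i}" using assms[of i] by auto
  qed
  ultimately show "\<rho> \<in> join_complex n V'" by (rule join_complexI[OF \<rho>(1) _ \<rho>(3)])
qed

lemma nerve_mono:
  assumes "\<And>i. i \<le> n \<Longrightarrow> V i \<subseteq> V' i"
  shows "nerve n V \<subseteq> nerve n V'"
proof
  fix \<tau> assume "\<tau> \<in> nerve n V"
  then have \<tau>: "\<tau> \<noteq> {}" "\<tau> \<subseteq> {0..n}" "(\<Inter>i\<in>\<tau>. V i) \<noteq> {}" by (simp_all add: nerve_def)
  have "(\<Inter>i\<in>\<tau>. V i) \<subseteq> (\<Inter>i\<in>\<tau>. V' i)" 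
  proof (intro subsetI INT_I)
    fix \<sigma> i assume "\<sigma> \<in> (\<Inter>i\<in>\<tau>. V i)" "i \<in> \<tau>"
    moreover from \<open>i \<in> \<tau>\<close> have "i \<le> n" using \<tau>(2) by auto
    ultimately show "\<sigma> \<in> V' i" using assms[of i] by blast
  qed
  then show "\<tau> \<in> nerve n V'" using \<tau> by (auto simp: nerve_def)
qed

theorem corollary12p1:
  fixes L :: "'a set set"
    and n :: nat
    and U :: "nat \<Rightarrow> real \<Rightarrow> 'a set set"
    and W :: "real \<Rightarrow> 'a set set"
  assumes "abstract_complex L"
    and "\<And>i. i \<le> n \<Longrightarrow> finite_filtration (U i)"
    and "\<And>i \<alpha>. i \<le> n \<Longrightarrow> 0 \<le> \<alpha> \<Longrightarrow> subcomplex (U i \<alpha>) L"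
    and "\<And>\<alpha>. 0 \<le> \<alpha> \<Longrightarrow> W \<alpha> = (\<Union>i\<in>{0..n}. U i \<alpha>)"
    and "good_cover_filtration n U"
    and "\<And>K. finite_diagram (Dgm W K)"
    and "\<And>K. finite_diagram (Dgm (nerve_filtration n U) K)"
  shows "\<forall>K. Dgm W K = Dgm (nerve_filtration n U) K"
proof
  fix K
  let ?N = "nerve_filtration n U" and ?Z = "\<lambda>\<alpha>. join_complex n (\<lambda>i. U i \<alpha>)"
  have U: "abstract_complex (U i \<alpha>)" "finite (U i \<alpha>)" if "i \<le> n" "0 \<le> \<alpha>" for i \<alpha>
    using assms(2)[OF that(1)] that(2) by (simp_all add: finite_filtration_def)
  have U_mono: "U i \<alpha> \<subseteq> U i \<beta>" if "i \<le> n" "0 \<le> \<alpha>" "\<alpha> \<le> \<beta>" for i \<alpha> \<beta>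
    using assms(2)[OF that(1)] that(2,3) by (simp add: finite_filtration_def)
  have Wc: "abstract_complex (W \<alpha>)" if "0 \<le> \<alpha>" for \<alpha>
    unfolding assms(4)[OF that] using U(1) that by (intro abstract_complex_Union) simp
  have Nc: "abstract_complex (?N \<alpha>)" for \<alpha>
    unfolding nerve_filtration_def by (rule abstract_complex_nerve)
  have Zc: "abstract_complex (?Z \<alpha>)" if "0 \<le> \<alpha>" for \<alpha>
    using U(1) that by (intro abstract_complex_join)
  have W_mono: "W \<alpha> \<subseteq> W \<beta>" if "0 \<le> \<alpha>" "\<alpha> \<le> \<beta>" for \<alpha> \<beta>
  proof -
    have "0 \<le> \<beta>" using that by linarith
    show ?thesis unfolding assms(4)[OF \<open>0 \<le> \<alpha>\<close>] assms(4)[OF \<open>0 \<le> \<beta>\<close>]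
      by (rule UN_mono[OF order_refl]) (rule U_mono[OF _ that], simp)
  qed
  have N_mono: "?N \<alpha> \<subseteq> ?N \<beta>" if "0 \<le> \<alpha>" "\<alpha> \<le> \<beta>" for \<alpha> \<beta>
    unfolding nerve_filtration_def by (rule nerve_mono) (rule U_mono[OF _ that])
  have Z_mono: "?Z \<alpha> \<subseteq> ?Z \<beta>" if "0 \<le> \<alpha>" "\<alpha> \<le> \<beta>" for \<alpha> \<beta>
    by (rule join_complex_mono) (rule U_mono[OF _ that])
  have relW: "rel_acyclic (insert {} (?Z \<alpha>)) ((`) Inl ` insert {} (W \<alpha>))" if \<alpha>: "0 \<le> \<alpha>" for \<alpha>
    unfolding assms(4)[OF \<alpha>]
  proof (rule rel_acyclic_join_cover)
    fix \<tau> :: "nat set" assume \<tau>: "\<tau> \<noteq> {}" "\<tau> \<subseteq> {0..n}" "(\<Inter>i\<in>\<tau>. U i \<alpha>) \<noteq> {}"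
    obtain j where j: "j \<in> \<tau>" using \<tau>(1) by blast
    have "finite (\<Inter>i\<in>\<tau>. U i \<alpha>)"
      by (rule finite_subset[OF _ U(2)[of j \<alpha>]]) (use j \<tau>(2) \<alpha> in auto)
    moreover have "abstract_complex (\<Inter>i\<in>\<tau>. U i \<alpha>)"
      using U(1)[OF _ \<alpha>] \<tau>(1,2) by (intro abstract_complex_Inter) auto
    moreover have "contractible_complex (\<Inter>i\<in>\<tau>. U i \<alpha>)"
      using assms(5) \<alpha> \<tau> unfolding good_cover_filtration_def by blast
    ultimately show "acyclic_chains (insert {} (\<Inter>i\<in>\<tau>. U i \<alpha>))"
      by (rule acyclic_chains_contractible)
  qed (rule U(1)[OF _ \<alpha>])
  have relN: "rel_acyclic (insert {} (?Z \<alpha>)) ((`) Inr ` insert {} (?N \<alpha>))" if \<alpha>: "0 \<le> \<alpha>" for \<alpha>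
    unfolding nerve_filtration_def by (rule rel_acyclic_join_nerve) (rule U(1)[OF _ \<alpha>])
  have subW: "(`) Inl ` W \<alpha> \<subseteq> ?Z \<alpha>" if \<alpha>: "0 \<le> \<alpha>" for \<alpha>
  proof
    fix \<rho> :: "('a + nat) set" assume "\<rho> \<in> (`) Inl ` W \<alpha>"
    then obtain \<sigma> where \<sigma>: "\<sigma> \<in> W \<alpha>" "\<rho> = Inl ` \<sigma>" by blast
    moreover have "\<sigma> \<noteq> {}" using Wc[OF \<alpha>] \<sigma>(1) by (auto simp: abstract_complex_def)
    ultimately show "\<rho> \<in> ?Z \<alpha>" using assms(4)[OF \<alpha>] by (intro join_complexI[of _ \<sigma>]) auto
  qed
  have subN: "(`) Inr ` ?N \<alpha> \<subseteq> ?Z \<alpha>" for \<alpha>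
  proof
    fix \<rho> :: "('a + nat) set" assume "\<rho> \<in> (`) Inr ` ?N \<alpha>"
    then obtain \<tau> where \<tau>: "\<tau> \<in> ?N \<alpha>" "\<rho> = Inr ` \<tau>" by blast
    then have "\<tau> \<noteq> {} \<and> (\<exists>\<sigma>\<in>(\<Union>i\<in>{0..n}. U i \<alpha>). \<tau> \<subseteq> {i\<in>{0..n}. \<sigma> \<in> U i \<alpha>})"
      unfolding nerve_filtration_def nerve_iff by blast
    then obtain \<sigma> where "\<tau> \<noteq> {}" "\<sigma> \<in> (\<Union>i\<in>{0..n}. U i \<alpha>)" "\<tau> \<subseteq> {i\<in>{0..n}. \<sigma> \<in> U i \<alpha>}" by blast
    then show "\<rho> \<in> ?Z \<alpha>" by (intro join_complexI[of _ \<sigma>]) (simp_all add: \<tau>(2))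
  qed
  \<comment> \<open>Both isomorphisms point into the homology of \<open>?Z\<close>. Each is inverted
    in turn, since equality of barcodes uses both directions.\<close>
  have W_Z: "pers_iso (homology_module W K) (homology_module ?Z K)"
    by (rule pers_iso_push[where f = Inl]) (simp, fact Wc, fact Zc, fact W_mono, fact Z_mono, fact subW, fact relW)
  have N_Z: "pers_iso (homology_module ?N K) (homology_module ?Z K)"
    by (rule pers_iso_push[where f = Inr]) (simp, rule Nc, fact Zc, fact N_mono, fact Z_mono, rule subN, fact relN)
  have "pers_iso (homology_module ?Z K) (homology_module W K)"
    by (rule pers_iso_homology_sym[OF _ _ W_Z]) (fact Wc, fact W_mono)
  with W_Z have "barcode (homology_module W K) = barcode (homology_module ?Z K)" by (rule barcode_cong)
  moreover have "pers_iso (homology_module ?Z K) (homology_module ?N K)"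
    by (rule pers_iso_homology_sym[OF _ _ N_Z]) (rule Nc, fact N_mono)
  with N_Z have "barcode (homology_module ?N K) = barcode (homology_module ?Z K)" by (rule barcode_cong)
  ultimately show "Dgm W K = Dgm ?N K" by (simp add: Dgm_def)
qed

end
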